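(* Let $N\geq2$, $0<R_{1}<R_{2}$ and $\Omega:=\{x\in\mathbb{R}^{N}\colon R_{1}<\|x\|<R_{2}\}$, where $\|\cdot\|$ is the Euclidean norm. Let $g \colon \mathbb{R}^{+} \to \mathbb{R}^{+}$ be a continuous function such that $g(0)=0$, $g(s)>0$ for all $s>0$, $\lim_{s\to0^{+}} g(s)/s = 0$ and $\lim_{s\to+\infty} g(s)/s = 0$. Let $\mathcal{Q}\colon[R_{1},R_{2}]\to\mathbb{R}$ be a continuous function, with $\mathcal{Q}^{-}\not\equiv0$, for which there exist $2m+2$ points (with $m\geq1$) $$R_{1}=\tau_{0}\leq\sigma_{1}<\tau_{1}<\ldots<\sigma_{i}<\tau_{i}<\ldots<\sigma_{m}<\tau_{m}\leq\sigma_{m+1}=R_{2}$$ such that $\mathcal{Q}\succ0$ on $[\sigma_{i},\tau_{i}]$ for $i=1,\ldots,m$, and $\mathcal{Q}\prec0$ on $[\tau_{i},\sigma_{i+1}]$ for each $i\in\{0,\ldots,m\}$ with $\tau_{i}<\sigma_{i+1}$. Let $q\colon\overline{\Omega}\to\mathbb{R}$ be defined by $q(x)=\mathcal{Q}(\|x\|)$. Then there exists $\lambda^{*}>0$ such that for each $\lambda>\lambda^{*}$ there exists $\mu^{*}(\lambda)>0$ such that for each $\mu>\mu^{*}(\lambda)$ the Neumann problem $$-\Delta u=\bigl(\lambda q^{+}(x)-\mu q^{-}(x)\bigr)g(u)\ \text{ in }\Omega,\qquad \frac{\partial u}{\partial\mathbf{n}}=0\ \text{ on }\partial\Omega,$$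 has at least $3^{m}-1$ radially symmetric positive classical solutions. The same result holds for the Dirichlet problem $$-\Delta u=\bigl(\lambda q^{+}(x)-\mu q^{-}(x)\bigr)g(u)\ \text{ in }\Omega,\qquad u=0\ \text{ on }\partial\Omega.$$
   Context: $\mathbb{R}^{+}:=[0,+\infty)$; the superscripts $\pm$ on a function denote its positive and negative parts. On a given interval, $w\succ0$ means that $w\geq0$ almost everywhere and $w$ is not almost everywhere zero on that interval; $w\prec0$ means $-w\succ0$. A classical solution is a function $u\in C^{2}(\overline{\Omega})$ satisfying the problem; it is radially symmetric if $u(x)=\mathcal{U}(\|x\|)$ for a scalar function $\mathcal{U}$ on $[R_{1},R_{2}]$. Positive means $u>0$ on $\overline{\Omega}$ for the Neumann problem and $u>0$ in $\Omega$ for the Dirichlet problem. *)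

theory Defs
  imports "HOL-Analysis.Analysis"
begin

definition annulus :: "real \<Rightarrow> real \<Rightarrow> 'a::real_normed_vector set"
  where "annulus R1 R2 = {x. R1 < norm x \<and> norm x < R2}"

text \<open>Outward unit normal at a point of the boundary of the annulus
  (\<open>norm x = R2\<close> or \<open>norm x = R1\<close>, with \<open>0 < R1 < R2\<close>).\<close>

definition annulus_normal :: "real \<Rightarrow> real \<Rightarrow> 'a::real_normed_vector \<Rightarrow> 'a"
  where "annulus_normal R1 R2 x = (if norm x = R2 then x /\<^sub>R norm x else - (x /\<^sub>R norm x))"

text \<open>The derivative of \<open>u\<close> at \<open>x\<close> in the outward direction \<open>n\<close>; as \<open>u\<close> matters only on the
  closure of the domain, the difference quotients are taken from inside.\<close>

definition has_normal_derivative :: "('a::real_normed_vector \<Rightarrow> real) \<Rightarrow> 'a \<Rightarrow> 'a \<Rightarrow> real \<Rightarrow> bool"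
  where "has_normal_derivative u x n d \<longleftrightarrow>
    ((\<lambda>t. u (x + t *\<^sub>R n)) has_real_derivative d) (at_left 0)"

text \<open>Meaningful where \<open>f\<close> is differentiable, which \<open>C2_closure\<close> below guarantees where it is used.\<close>

definition partial :: "'a::euclidean_space \<Rightarrow> ('a \<Rightarrow> real) \<Rightarrow> 'a \<Rightarrow> real"
  where "partial i f x = frechet_derivative f (at x) i"

definition laplacian :: "('a::euclidean_space \<Rightarrow> real) \<Rightarrow> 'a \<Rightarrow> real"
  where "laplacian u x = (\<Sum>i\<in>Basis. partial i (partial i u) x)"

definition extends_continuously :: "'a::topological_space set \<Rightarrow> ('a \<Rightarrow> real) \<Rightarrow> bool"
  where "extends_continuously \<Omega> f \<longleftrightarrow>
    (\<exists>v. continuous_on (closure \<Omega>) v \<and> (\<forall>x\<in>\<Omega>. v x = f x))"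

text \<open>\<open>u \<in> C\<^sup>2(closure \<Omega>)\<close> for open \<open>\<Omega>\<close>: \<open>u\<close> is continuous on the closure, twice
  differentiable in \<open>\<Omega>\<close>, and its first and second partial derivatives have continuous
  extensions to the closure (in particular they are continuous in \<open>\<Omega>\<close>).\<close>

definition C2_closure :: "'a::euclidean_space set \<Rightarrow> ('a \<Rightarrow> real) \<Rightarrow> bool"
  where "C2_closure \<Omega> u \<longleftrightarrow>
    continuous_on (closure \<Omega>) u \<and>
    (\<forall>x\<in>\<Omega>. u differentiable (at x)) \<and>
    (\<forall>i\<in>Basis. (\<forall>x\<in>\<Omega>. partial i u differentiable (at x)) \<and>
       extends_continuously \<Omega> (partial i u)) \<and>
    (\<forall>i\<in>Basis. \<forall>j\<in>Basis. extends_continuously \<Omega> (partial j (partial i u)))"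

definition radially_symmetric :: "'a::real_normed_vector set \<Rightarrow> ('a \<Rightarrow> real) \<Rightarrow> bool"
  where "radially_symmetric S u \<longleftrightarrow> (\<exists>U::real \<Rightarrow> real. \<forall>x\<in>S. u x = U (norm x))"

text \<open>Solutions are functions on the closure of the annulus. They are represented by functions
  that are \<open>undefined\<close> off the closure (\<open>extensional\<close>), so that two of them are equal iff they agree on
  the closure and counting them is meaningful. The function \<open>a\<close> is the weight.\<close>

definition neumann_solutions ::
    "real \<Rightarrow> real \<Rightarrow> ('a::euclidean_space \<Rightarrow> real) \<Rightarrow> (real \<Rightarrow> real) \<Rightarrow> ('a \<Rightarrow> real) set"
  where "neumann_solutions R1 R2 a g = {u \<in> extensional (closure (annulus R1 R2)).
    C2_closure (annulus R1 R2) u \<and>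
    radially_symmetric (closure (annulus R1 R2)) u \<and>
    (\<forall>x\<in>closure (annulus R1 R2). u x > 0) \<and>
    (\<forall>x\<in>annulus R1 R2. - laplacian u x = a x * g (u x)) \<and>
    (\<forall>x\<in>frontier (annulus R1 R2). has_normal_derivative u x (annulus_normal R1 R2 x) 0)}"

definition dirichlet_solutions ::
    "real \<Rightarrow> real \<Rightarrow> ('a::euclidean_space \<Rightarrow> real) \<Rightarrow> (real \<Rightarrow> real) \<Rightarrow> ('a \<Rightarrow> real) set"
  where "dirichlet_solutions R1 R2 a g = {u \<in> extensional (closure (annulus R1 R2)).
    C2_closure (annulus R1 R2) u \<and>
    radially_symmetric (closure (annulus R1 R2)) u \<and>
    (\<forall>x\<in>annulus R1 R2. u x > 0) \<and>
    (\<forall>x\<in>annulus R1 R2. - laplacian u x = a x * g (u x)) \<and>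
    (\<forall>x\<in>frontier (annulus R1 R2). u x = 0)}"

definition pos_part :: "('a \<Rightarrow> real) \<Rightarrow> 'a \<Rightarrow> real"
  where "pos_part w x = max (w x) 0"

definition neg_part :: "('a \<Rightarrow> real) \<Rightarrow> 'a \<Rightarrow> real"
  where "neg_part w x = max (- w x) 0"

definition succ_zero :: "(real \<Rightarrow> real) \<Rightarrow> real set \<Rightarrow> bool"
  where "succ_zero w I \<longleftrightarrow>
    (AE x\<in>I in lebesgue. w x \<ge> 0) \<and> \<not> (AE x\<in>I in lebesgue. w x = 0)"

definition prec_zero :: "(real \<Rightarrow> real) \<Rightarrow> real set \<Rightarrow> bool"
  where "prec_zero w I \<longleftrightarrow> succ_zero (\<lambda>x. - w x) I"

definition at_least :: "nat \<Rightarrow> 'a set \<Rightarrow> bool"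
  where "at_least k X \<longleftrightarrow> (\<exists>S\<subseteq>X. finite S \<and> card S = k)"

end

theory Submission
  imports Defs "HOL-Complex_Analysis.Great_Picard"
begin

text \<open>
  For radial \<open>u\<close> the equation is the planar system \<open>u' = v / t\<^sup>n\<close>, \<open>v' = - t\<^sup>n a(t) g(u)\<close> with
  \<open>n = N - 1\<close>. Fix levels \<open>r < 1 < R\<close> with \<open>r\<close> small and \<open>R\<close> large; solutions are coded by strings in
  \<open>{0,1,2}\<^sup>m\<close> that say in which of \<open>[0,r]\<close>, \<open>[r,1]\<close>, \<open>[1,R]\<close> the maximum of \<open>u\<close> over each
  positivity interval lies. For \<open>\<lambda>\<close> large, a maximum equal to \<open>1\<close> forces \<open>u\<close> to
  become negative. If the maximum is \<open>r\<close> or \<open>R\<close>, then \<open>g(s) = o(s)\<close> at \<open>0\<close> and at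
  infinity makes \<open>u\<close> nearly constant there, and for \<open>\<mu>\<close> large it exceeds \<open>R\<close> on the next positivity
  interval. So when \<open>g\<close> is Lipschitz, a segment of shooting parameters running from "\<open>u\<close> has died" to
  "\<open>u\<close> is above \<open>R\<close>" contains three segments of the same kind for the next interval, and at the
  end the boundary condition is met by the intermediate value theorem. A continuous \<open>g\<close> is
  reached by Lipschitz approximation and Arzela--Ascoli; the classes stay disjoint in the limit
  because no solution attains the levels \<open>r\<close>, \<open>1\<close>, \<open>R\<close>. The zero string is discarded since it may
  code the zero solution.
\<close>

section \<open>Planar initial value problems\<close>

text \<open>The levels 0, r, 1, R act alternately: after a maximum 0 or 1 a solution stays at or
  below 0, after a maximum r or R it exceeds R on the next positivity interval. So each of [0,r],
  [r,1], [1,R] again joins a dead end to a high end, the middle one in reverse order. The constants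
  follow the order of the quantifiers. A lower bound of g on an interval [\<eta>,1] given by the
  weights alone fixes the threshold for \<lambda>. Then r and R are chosen in terms of \<lambda>,
  and the threshold for \<mu> comes last: growth must beat the slope loss e R using only the minimum
  of g on [r/4,R]. For a merely continuous g there is no shooting map, but g clamped to [0,R]
  satisfies |f s| \<le> K |s|, and this still makes the zero solution unique. Hence all sign and
  level lemmas are proved without a Lipschitz hypothesis and with constants common to the limit and
  its approximations: they drive the shooting and later separate the limits. The clamp is harmless
  because the solutions found never exceed R.\<close>

lemma picard_lindelof_global:
  fixes F :: "real \<Rightarrow> 'a::banach \<Rightarrow> 'a"
  assumes AB: "A \<le> B"
    and cont: "continuous_on ({A..B} \<times> UNIV) (\<lambda>p. F (fst p) (snd p))"
    and lip: "\<And>t z w. t \<in> {A..B} \<Longrightarrow> norm (F t z - F t w) \<le> L * norm (z - w)"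
  obtains z where "z A = x"
    and "\<And>t. t \<in> {A..B} \<Longrightarrow> (z has_vector_derivative F t (z t)) (at t within {A..B})"
proof -
  \<comment> \<open>With the factor \<open>exp (- (K * (t - A)))\<close> the integral operator
    contracts by |L|/K \<le> 1/2 on all of [A,B] at once, so local solutions never have to be
    continued.\<close>
  define K where "K = 2 * \<bar>L\<bar> + 1"
  have K: "K > 0" "\<bar>L\<bar> / K \<le> 1/2"
    unfolding K_def by (auto simp: field_simps)
  \<comment> \<open>Elements of \<open>bcontfun\<close> live on the whole line; clamping time to
    [A,B] extends the operator to it.\<close>
  define cl where "cl t = max A (min B t)" for t
  have cl: "cl t \<in> {A..B}" for t using AB by (auto simp: cl_def)
  have cl_id: "cl t = t" if "t \<in> {A..B}" for t using that by (auto simp: cl_def)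
  have cl_cont: "continuous_on UNIV cl" unfolding cl_def by (intro continuous_intros)
  \<comment> \<open>The unknown \<open>w\<close> is the rescaled solution; the solution itself is
    \<open>exp (K * (t - A))\<close> times \<open>w\<close>.\<close>
  define h where "h w s = F s (exp (K * (s - A)) *\<^sub>R apply_bcontfun w s)" for w s
  have h_cont: "continuous_on {A..B} (h w)" for w
    unfolding h_def
    by (rule continuous_on_compose2[OF cont, where f = "\<lambda>s. (s, _ s)", simplified])
       (auto intro!: continuous_intros)
  define I where "I w t = integral {A..t} (h w)" for w t
  have I_deriv: "((I w) has_vector_derivative h w t) (at t within {A..B})" if "t \<in> {A..B}" for w t
    unfolding I_def by (rule integral_has_vector_derivative[OF h_cont that])
  have I_cont: "continuous_on {A..B} (I w)" for w
    unfolding continuous_on_eq_continuous_within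
    by (blast intro: I_deriv has_vector_derivative_continuous)
  define P where "P w t = exp (- (K * (cl t - A))) *\<^sub>R (x + I w (cl t))" for w t
  have P_bc: "P w \<in> bcontfun" for w
  proof -
    have c: "continuous_on {A..B} (\<lambda>t. exp (- (K * (t - A))) *\<^sub>R (x + I w t))"
      by (intro continuous_intros I_cont)
    have "continuous_on UNIV (P w)"
      unfolding P_def
      by (rule continuous_on_compose2[OF c cl_cont]) (use cl in auto)
    moreover have "bounded (range (P w))"
    proof -
      have "bounded ((\<lambda>t. exp (- (K * (t - A))) *\<^sub>R (x + I w t)) ` {A..B})"
        by (intro compact_imp_bounded compact_continuous_image c) auto
      then show ?thesis
        by (rule bounded_subset) (use cl in \<open>auto simp: P_def\<close>)
    qed
    ultimately show ?thesis by (auto simp: bcontfun_def)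
  qed
  define \<Phi> where "\<Phi> w = Bcontfun (P w)" for w
  have \<Phi>: "apply_bcontfun (\<Phi> w) t = P w t" for w t
    by (simp add: \<Phi>_def Bcontfun_inverse P_bc)
  have contr: "dist (\<Phi> v) (\<Phi> w) \<le> 1/2 * dist v w" for v w
  proof (rule dist_bound)
    fix t
    define T where "T = cl t"
    have T: "A \<le> T" "T \<le> B" using cl[of t] by (auto simp: T_def)
    have int: "h v integrable_on {A..T}" "h w integrable_on {A..T}"
      using T by (auto intro!: integrable_continuous_real continuous_on_subset[OF h_cont])
    have "norm (I v T - I w T) = norm (integral {A..T} (\<lambda>s. h v s - h w s))"
      unfolding I_def by (simp add: integral_diff int)
    also have "\<dots> \<le> integral {A..T} (\<lambda>s. \<bar>L\<bar> * dist v w * exp (K * (s - A)))"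
    proof (rule integral_norm_bound_integral)
      show "(\<lambda>s. h v s - h w s) integrable_on {A..T}" by (intro integrable_diff int)
      show "(\<lambda>s. \<bar>L\<bar> * dist v w * exp (K * (s - A))) integrable_on {A..T}"
        by (intro integrable_continuous_real continuous_intros)
      fix s assume s: "s \<in> {A..T}"
      have "norm (h v s - h w s) \<le> L * norm (exp (K * (s - A)) *\<^sub>R (v s - w s))"
        unfolding h_def using lip[of s "exp (K * (s - A)) *\<^sub>R v s" "exp (K * (s - A)) *\<^sub>R w s"] s T
        by (simp add: algebra_simps)
      also have "\<dots> \<le> \<bar>L\<bar> * (exp (K * (s - A)) * dist v w)"
        using dist_bounded[of v s w] by (auto simp: dist_norm intro!: mult_mono)
      finally show "norm (h v s - h w s) \<le> \<bar>L\<bar> * dist v w * exp (K * (s - A))"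
        by (simp add: mult_ac)
    qed
    also have "\<dots> = \<bar>L\<bar> * dist v w * ((exp (K * (T - A)) - 1) / K)"
    proof -
      have "((\<lambda>s. exp (K * (s - A))) has_integral (exp (K * (T - A)) / K - exp (K * (A - A)) / K)) {A..T}"
        by (rule fundamental_theorem_of_calculus)
           (use T K in \<open>auto intro!: derivative_eq_intros simp: has_real_derivative_iff_has_vector_derivative[symmetric]\<close>)
      then have "integral {A..T} (\<lambda>s. exp (K * (s - A))) = (exp (K * (T - A)) - 1) / K"
        by (simp add: integral_unique diff_divide_distrib)
      then show ?thesis by simp
    qed
    also have "\<dots> \<le> \<bar>L\<bar> * dist v w * (exp (K * (T - A)) / K)"
      using K by (intro mult_left_mono divide_right_mono) auto
    finally have *: "norm (I v T - I w T) \<le> \<bar>L\<bar> * dist v w * (exp (K * (T - A)) / K)" .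
    have "dist (P v t) (P w t) = exp (- (K * (T - A))) * norm (I v T - I w T)"
      unfolding P_def T_def dist_norm by (simp flip: scaleR_diff_right)
    also have "\<dots> \<le> exp (- (K * (T - A))) * (\<bar>L\<bar> * dist v w * (exp (K * (T - A)) / K))"
      by (intro mult_left_mono *) auto
    also have "\<dots> = \<bar>L\<bar> / K * dist v w"
      using K by (simp add: exp_minus divide_simps)
    also have "\<dots> \<le> 1/2 * dist v w" by (intro mult_right_mono K) auto
    finally show "dist (\<Phi> v t) (\<Phi> w t) \<le> 1/2 * dist v w" by (simp add: \<Phi>)
  qed
  obtain w where w: "\<Phi> w = w"
    using banach_fix_type[of "1/2" \<Phi>] contr by auto
  define z where "z t = x + I w t" for t
  have zw: "z t = exp (K * (t - A)) *\<^sub>R w t" if "t \<in> {A..B}" for t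
  proof -
    have "w t = P w t" using \<Phi>[of w t] w by simp
    then show ?thesis using that by (simp add: P_def cl_id z_def exp_minus)
  qed
  show ?thesis
  proof
    show "z A = x" by (simp add: z_def I_def)
    fix t assume t: "t \<in> {A..B}"
    have "(z has_vector_derivative h w t) (at t within {A..B})"
      unfolding z_def by (auto intro!: derivative_eq_intros I_deriv t)
    then show "(z has_vector_derivative F t (z t)) (at t within {A..B})"
      by (simp add: h_def zw[OF t])
  qed
qed

lemma continuous_on_interval_bounded:
  fixes h :: "real \<Rightarrow> real"
  assumes "continuous_on {A..B} h"
  shows "\<exists>c. \<forall>t\<in>{A..B}. \<bar>h t\<bar> \<le> c"
  using compact_imp_bounded[OF compact_continuous_image[OF assms]] by (auto simp: bounded_iff)

text \<open>The flux \<open>v\<close> replaces u' because the equation for it has no first-order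
  term: \<open>v\<close> is monotone wherever \<open>b\<close> has a sign and \<open>f\<close> is
  nonnegative.\<close>

definition solves ::
    "real \<Rightarrow> real \<Rightarrow> (real \<Rightarrow> real) \<Rightarrow> (real \<Rightarrow> real) \<Rightarrow> (real \<Rightarrow> real) \<Rightarrow> (real \<Rightarrow> real) \<Rightarrow> (real \<Rightarrow> real) \<Rightarrow> bool"
  where "solves A B \<alpha> b f u v \<longleftrightarrow> (\<forall>t\<in>{A..B}.
    (u has_real_derivative \<alpha> t * v t) (at t within {A..B}) \<and>
    (v has_real_derivative - (b t * f (u t))) (at t within {A..B}))"

lemma solves_exists:
  assumes AB: "A \<le> B" and \<alpha>: "continuous_on {A..B} \<alpha>" and b: "continuous_on {A..B} b"
    and f: "L-lipschitz_on UNIV f"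
  obtains u v where "solves A B \<alpha> b f u v" "u A = u0" "v A = v0"
proof -
  obtain a1 where a1: "\<And>t. t \<in> {A..B} \<Longrightarrow> \<bar>\<alpha> t\<bar> \<le> a1"
    using continuous_on_interval_bounded[OF \<alpha>] by blast
  obtain b1 where b1: "\<And>t. t \<in> {A..B} \<Longrightarrow> \<bar>b t\<bar> \<le> b1"
    using continuous_on_interval_bounded[OF b] by blast
  have L: "L \<ge> 0" using f by (rule lipschitz_on_nonneg)
  have fc: "continuous_on UNIV f" using f by (rule lipschitz_on_continuous_on)
  define F where "F t z = (\<alpha> t * snd z, - (b t * f (fst z)))" for t and z :: "real \<times> real"
  obtain z where z: "z A = (u0, v0)"
    "\<And>t. t \<in> {A..B} \<Longrightarrow> (z has_vector_derivative F t (z t)) (at t within {A..B})"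
  proof (rule picard_lindelof_global[OF AB, of F "a1 + b1 * L" "(u0, v0)"])
    show "continuous_on ({A..B} \<times> UNIV) (\<lambda>p. F (fst p) (snd p))"
      unfolding F_def
      by (intro continuous_intros continuous_on_compose2[OF \<alpha>] continuous_on_compose2[OF b]
            continuous_on_compose2[OF fc]) auto
    fix t and z w :: "real \<times> real" assume t: "t \<in> {A..B}"
    have "norm (F t z - F t w) = norm (\<alpha> t * (snd z - snd w), - (b t * (f (fst z) - f (fst w))))"
      by (simp add: F_def algebra_simps)
    also have "\<dots> \<le> \<bar>\<alpha> t\<bar> * \<bar>snd z - snd w\<bar> + \<bar>b t\<bar> * \<bar>f (fst z) - f (fst w)\<bar>"
      using norm_Pair_le[of "\<alpha> t * (snd z - snd w)" "- (b t * (f (fst z) - f (fst w)))"]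
      by (simp add: abs_mult)
    also have "\<dots> \<le> a1 * norm (z - w) + b1 * (L * norm (z - w))"
    proof (intro add_mono mult_mono a1 b1 t)
      show "\<bar>snd z - snd w\<bar> \<le> norm (z - w)" using norm_snd_le[of "snd (z - w)" "fst (z - w)"]
        unfolding prod.collapse by (simp only: snd_diff real_norm_def)
      have "\<bar>f (fst z) - f (fst w)\<bar> \<le> L * \<bar>fst z - fst w\<bar>"
        using lipschitz_onD[OF f, of "fst z" "fst w"] by (simp add: dist_real_def)
      also have "\<dots> \<le> L * norm (z - w)"
        using norm_fst_le[of "fst (z - w)" "snd (z - w)"] L
        unfolding prod.collapse by (intro mult_left_mono) (simp_all only: fst_diff real_norm_def)
      finally show "\<bar>f (fst z) - f (fst w)\<bar> \<le> L * norm (z - w)" .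
    qed (use a1[OF t] b1[OF t] in auto)
    finally show "norm (F t z - F t w) \<le> (a1 + b1 * L) * norm (z - w)"
      by (simp add: algebra_simps)
  qed (erule that, blast)
  show ?thesis
  proof
    show "solves A B \<alpha> b f (\<lambda>t. fst (z t)) (\<lambda>t. snd (z t))"
      unfolding solves_def
    proof (intro ballI conjI)
      fix t assume t: "t \<in> {A..B}"
      note d = z(2)[OF t]
      show "((\<lambda>t. fst (z t)) has_real_derivative \<alpha> t * snd (z t)) (at t within {A..B})"
        using bounded_linear.has_vector_derivative[OF bounded_linear_fst d]
        by (simp add: F_def has_real_derivative_iff_has_vector_derivative)
      show "((\<lambda>t. snd (z t)) has_real_derivative - (b t * f (fst (z t)))) (at t within {A..B})"
        using bounded_linear.has_vector_derivative[OF bounded_linear_snd d]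
        by (simp add: F_def has_real_derivative_iff_has_vector_derivative)
    qed
  qed (use z(1) in auto)
qed

lemma antimono_of_derivative_nonpos:
  fixes h h' :: "real \<Rightarrow> real"
  assumes d: "\<And>t. t \<in> {A..B} \<Longrightarrow> (h has_real_derivative h' t) (at t within {A..B})"
    and le: "\<And>x. x \<in> {s..t} \<Longrightarrow> h' x \<le> 0" and st: "s \<le> t" "A \<le> s" "t \<le> B"
  shows "h t \<le> h s"
proof -
  have "(h has_derivative (\<lambda>y. h' x * y)) (at x within {s..t})" if "s \<le> x" "x \<le> t" for x
    by (rule has_derivative_subset[of _ _ _ "{A..B}"])
       (use d[of x] st that in \<open>auto simp: has_field_derivative_def\<close>)
  from mvt_very_simple[OF st(1), of h "\<lambda>x y. h' x * y", OF this]
  have "\<exists>x\<in>{s..t}. h t - h s = h' x * (t - s)" .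
  then obtain x where "x \<in> {s..t}" "h t - h s = h' x * (t - s)" by auto
  with le[of x] st show ?thesis by (smt (verit) mult_nonpos_nonneg)
qed

text \<open>The squared distance E satisfies |E'| \<le> C E, so E exp(-Ct) decreases and E exp(Ct)
  increases, which covers both directions of time. The Lipschitz bound is asked only along the two
  solutions, so that one of them may be zero and \<open>f\<close> only linearly bounded.\<close>

lemma solves_gronwall:
  assumes s1: "solves A B \<alpha> b f u1 v1" and s2: "solves A B \<alpha> b f u2 v2"
    and a1: "\<And>t. t \<in> {A..B} \<Longrightarrow> \<bar>\<alpha> t\<bar> \<le> a1"
    and b1: "\<And>t. t \<in> {A..B} \<Longrightarrow> \<bar>b t\<bar> \<le> b1"
    and lip: "\<And>t. t \<in> {A..B} \<Longrightarrow> \<bar>f (u1 t) - f (u2 t)\<bar> \<le> L * \<bar>u1 t - u2 t\<bar>"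
    and L: "L \<ge> 0"
    and st: "s \<in> {A..B}" "t \<in> {A..B}"
  shows "(u1 t - u2 t)\<^sup>2 + (v1 t - v2 t)\<^sup>2 \<le> ((u1 s - u2 s)\<^sup>2 + (v1 s - v2 s)\<^sup>2) * exp ((a1 + b1 * L) * \<bar>t - s\<bar>)"
proof -
  define E where "E t = (u1 t - u2 t)\<^sup>2 + (v1 t - v2 t)\<^sup>2" for t
  define E' where "E' t = 2 * (u1 t - u2 t) * (\<alpha> t * (v1 t - v2 t))
     - 2 * (v1 t - v2 t) * (b t * (f (u1 t) - f (u2 t)))" for t
  define C where "C = a1 + b1 * L"
  have dE: "(E has_real_derivative E' t) (at t within {A..B})" if "t \<in> {A..B}" for t
  proof -
    have d: "((\<lambda>t. u1 t - u2 t) has_real_derivative \<alpha> t * (v1 t - v2 t)) (at t within {A..B})"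
      "((\<lambda>t. v1 t - v2 t) has_real_derivative - (b t * (f (u1 t) - f (u2 t)))) (at t within {A..B})"
      using s1 s2 that unfolding solves_def
      by (auto intro!: derivative_eq_intros simp: algebra_simps)
    show ?thesis unfolding E_def E'_def
      by (rule derivative_eq_intros d refl)+ (simp add: algebra_simps)
  qed
  have bd: "\<bar>E' t\<bar> \<le> C * E t" if t: "t \<in> {A..B}" for t
  proof -
    let ?x = "\<bar>u1 t - u2 t\<bar>" and ?y = "\<bar>v1 t - v2 t\<bar>"
    have "\<bar>E' t\<bar> \<le> 2 * ?x * (\<bar>\<alpha> t\<bar> * ?y) + 2 * ?y * (\<bar>b t\<bar> * \<bar>f (u1 t) - f (u2 t)\<bar>)"
      unfolding E'_def by (rule order_trans[OF abs_triangle_ineq4]) (simp only: abs_mult abs_numeral order_refl)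
    also have "\<dots> \<le> 2 * ?x * (a1 * ?y) + 2 * ?y * (b1 * (L * ?x))"
      by (intro add_mono mult_left_mono mult_mono a1 b1 lip t) (use a1[OF t] b1[OF t] in auto)
    also have "\<dots> = C * (2 * ?x * ?y)" by (simp add: C_def algebra_simps)
    also have "\<dots> \<le> C * E t"
    proof (rule mult_left_mono)
      show "2 * ?x * ?y \<le> E t"
        using sum_squares_bound[of ?x ?y] by (simp add: E_def)
      show "0 \<le> C"
        unfolding C_def using a1[OF t] b1[OF t] L by (intro add_nonneg_nonneg mult_nonneg_nonneg) auto
    qed
    finally show ?thesis .
  qed
  have *: "E t \<le> E s * exp (C * \<bar>t - s\<bar>)"
  proof (cases "s \<le> t")
    case True
    have "E t * exp (- (C * t)) \<le> E s * exp (- (C * s))"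
    proof (rule antimono_of_derivative_nonpos[where h = "\<lambda>t. E t * exp (- (C * t))"
          and h' = "\<lambda>t. (E' t - C * E t) * exp (- (C * t))" and A = A and B = B])
      show "((\<lambda>t. E t * exp (- (C * t))) has_real_derivative (E' t - C * E t) * exp (- (C * t)))
          (at t within {A..B})" if "t \<in> {A..B}" for t
        by (rule derivative_eq_intros dE that refl)+ (simp add: algebra_simps)
      show "(E' x - C * E x) * exp (- (C * x)) \<le> 0" if "x \<in> {s..t}" for x
        using bd[of x] that st by (auto intro!: mult_nonpos_nonneg)
    qed (use True st in auto)
    then have "E t * exp (- (C * t)) * exp (C * t) \<le> E s * exp (- (C * s)) * exp (C * t)"
      by (rule mult_right_mono) auto
    then show ?thesis using True by (simp add: exp_minus exp_diff field_simps right_diff_distrib)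
  next
    case False
    have "- E s * exp (C * s) \<le> - E t * exp (C * t)"
    proof (rule antimono_of_derivative_nonpos[where h = "\<lambda>t. - E t * exp (C * t)"
          and h' = "\<lambda>t. - (E' t + C * E t) * exp (C * t)" and A = A and B = B])
      show "((\<lambda>t. - E t * exp (C * t)) has_real_derivative - (E' t + C * E t) * exp (C * t))
          (at t within {A..B})" if "t \<in> {A..B}" for t
        by (rule derivative_eq_intros dE that refl)+ (simp add: algebra_simps)
      show "- (E' x + C * E x) * exp (C * x) \<le> 0" if "x \<in> {t..s}" for x
        using bd[of x] that st by (auto intro!: mult_nonpos_nonneg)
    qed (use False st in auto)
    then have "E t * exp (C * t) * exp (- (C * t)) \<le> E s * exp (C * s) * exp (- (C * t))"
      by (intro mult_right_mono) auto
    then show ?thesis using False by (simp add: exp_minus exp_diff field_simps right_diff_distrib)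
  qed
  then show ?thesis by (simp add: E_def C_def)
qed

text \<open>Compared with the zero solution, a linear bound on \<open>f\<close> acts as a Lipschitz
  condition. This is the form of uniqueness that is left for the continuous limit problem.\<close>

lemma solves_zero:
  assumes s: "solves A B \<alpha> b f u v"
    and \<alpha>: "continuous_on {A..B} \<alpha>" and b: "continuous_on {A..B} b"
    and f0: "f 0 = 0" and lip: "\<And>x. \<bar>f x\<bar> \<le> L * \<bar>x\<bar>"
    and z: "u s = 0" "v s = 0" and st: "s \<in> {A..B}" "t \<in> {A..B}"
  shows "u t = 0" "v t = 0"
proof -
  obtain a1 where a1: "\<And>t. t \<in> {A..B} \<Longrightarrow> \<bar>\<alpha> t\<bar> \<le> a1"
    using continuous_on_interval_bounded[OF \<alpha>] by blast
  obtain b1 where b1: "\<And>t. t \<in> {A..B} \<Longrightarrow> \<bar>b t\<bar> \<le> b1"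
    using continuous_on_interval_bounded[OF b] by blast
  have "(u t - 0)\<^sup>2 + (v t - 0)\<^sup>2 \<le> ((u s - 0)\<^sup>2 + (v s - 0)\<^sup>2) * exp ((a1 + b1 * L) * \<bar>t - s\<bar>)"
    by (rule solves_gronwall[OF s, where ?u2.0 = "\<lambda>_. 0" and ?v2.0 = "\<lambda>_. 0"])
       (use a1 b1 lip[of 1] lip f0 st in \<open>auto simp: solves_def\<close>)
  then have "(u t)\<^sup>2 + (v t)\<^sup>2 \<le> 0" using z by simp
  then show "u t = 0" "v t = 0" by (simp_all add: sum_power2_le_zero_iff)
qed

lemma solves_dist:
  assumes \<alpha>: "continuous_on {A..B} \<alpha>" and b: "continuous_on {A..B} b"
    and f: "L-lipschitz_on UNIV f"
  obtains D where "D > 0" and "\<And>u1 v1 u2 v2 t. \<lbrakk>solves A B \<alpha> b f u1 v1; solves A B \<alpha> b f u2 v2; t \<in> {A..B}\<rbrakk>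
     \<Longrightarrow> \<bar>u1 t - u2 t\<bar> \<le> D * (\<bar>u1 A - u2 A\<bar> + \<bar>v1 A - v2 A\<bar>) \<and>
         \<bar>v1 t - v2 t\<bar> \<le> D * (\<bar>u1 A - u2 A\<bar> + \<bar>v1 A - v2 A\<bar>)"
proof -
  obtain a1 where a1: "\<And>t. t \<in> {A..B} \<Longrightarrow> \<bar>\<alpha> t\<bar> \<le> a1"
    using continuous_on_interval_bounded[OF \<alpha>] by blast
  obtain b1 where b1: "\<And>t. t \<in> {A..B} \<Longrightarrow> \<bar>b t\<bar> \<le> b1"
    using continuous_on_interval_bounded[OF b] by blast
  have L: "L \<ge> 0" using f by (rule lipschitz_on_nonneg)
  have lip: "\<bar>f x - f y\<bar> \<le> L * \<bar>x - y\<bar>" for x y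
    using lipschitz_onD[OF f, of x y] by (simp add: dist_real_def)
  define X where "X = exp (\<bar>a1 + b1 * L\<bar> * \<bar>B - A\<bar>)"
  have X: "X > 0" by (simp add: X_def)
  show ?thesis
  proof (rule that[of "sqrt X"])
    fix u1 v1 u2 v2 t
    assume s: "solves A B \<alpha> b f u1 v1" "solves A B \<alpha> b f u2 v2" and t: "t \<in> {A..B}"
    define e where "e = \<bar>u1 A - u2 A\<bar> + \<bar>v1 A - v2 A\<bar>"
    have "(u1 t - u2 t)\<^sup>2 + (v1 t - v2 t)\<^sup>2
      \<le> ((u1 A - u2 A)\<^sup>2 + (v1 A - v2 A)\<^sup>2) * exp ((a1 + b1 * L) * \<bar>t - A\<bar>)"
      using t by (intro solves_gronwall[OF s a1 b1 lip L]) auto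
    also have "\<dots> \<le> e\<^sup>2 * X"
    proof (rule mult_mono)
      show "(u1 A - u2 A)\<^sup>2 + (v1 A - v2 A)\<^sup>2 \<le> e\<^sup>2"
        by (simp add: e_def power2_sum)
      have "(a1 + b1 * L) * \<bar>t - A\<bar> \<le> \<bar>a1 + b1 * L\<bar> * \<bar>B - A\<bar>"
        using t by (intro mult_mono) auto
      then show "exp ((a1 + b1 * L) * \<bar>t - A\<bar>) \<le> X" by (simp add: X_def)
    qed auto
    also have "\<dots> = (sqrt X * e)\<^sup>2" using X by (simp add: power_mult_distrib)
    finally have "(u1 t - u2 t)\<^sup>2 + (v1 t - v2 t)\<^sup>2 \<le> (sqrt X * e)\<^sup>2" .
    then have "\<bar>u1 t - u2 t\<bar>\<^sup>2 \<le> (sqrt X * e)\<^sup>2" "\<bar>v1 t - v2 t\<bar>\<^sup>2 \<le> (sqrt X * e)\<^sup>2"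
      unfolding power2_abs by (smt (verit) zero_le_power2)+
    moreover have "0 \<le> sqrt X * e" using X by (simp add: e_def)
    ultimately have "\<bar>u1 t - u2 t\<bar> \<le> sqrt X * e" "\<bar>v1 t - v2 t\<bar> \<le> sqrt X * e"
      by (blast intro: power2_le_imp_le)+
    then show "\<bar>u1 t - u2 t\<bar> \<le> sqrt X * (\<bar>u1 A - u2 A\<bar> + \<bar>v1 A - v2 A\<bar>) \<and>
         \<bar>v1 t - v2 t\<bar> \<le> sqrt X * (\<bar>u1 A - u2 A\<bar> + \<bar>v1 A - v2 A\<bar>)"
      by (simp add: e_def)
  qed (use X in simp)
qed

section \<open>Weights alternating in sign\<close>

lemma solves_mvt:
  assumes "solves A B \<alpha> b f u v" "A \<le> s" "s < t" "t \<le> B"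
  shows "\<exists>\<xi>\<in>{s<..<t}. u t - u s = (t - s) * (\<alpha> \<xi> * v \<xi>)"
    and "\<exists>\<xi>\<in>{s<..<t}. v s - v t = (t - s) * (b \<xi> * f (u \<xi>))"
proof -
  have d: "(u has_derivative (\<lambda>y. \<alpha> x * v x * y)) (at x within {s..t})"
    "(v has_derivative (\<lambda>y. - (b x * f (u x)) * y)) (at x within {s..t})" if "s \<le> x" "x \<le> t" for x
  proof -
    have sub: "{s..t} \<subseteq> {A..B}" and x: "x \<in> {A..B}" using assms that by auto
    show "(u has_derivative (\<lambda>y. \<alpha> x * v x * y)) (at x within {s..t})"
      using assms(1) x has_derivative_subset[OF _ sub]
      unfolding solves_def has_field_derivative_def by blast
    show "(v has_derivative (\<lambda>y. - (b x * f (u x)) * y)) (at x within {s..t})"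
      using assms(1) x has_derivative_subset[OF _ sub]
      unfolding solves_def has_field_derivative_def by blast
  qed
  show "\<exists>\<xi>\<in>{s<..<t}. u t - u s = (t - s) * (\<alpha> \<xi> * v \<xi>)"
    using mvt_simple[OF assms(3), of u, OF d(1)] by (simp add: mult_ac)
  show "\<exists>\<xi>\<in>{s<..<t}. v s - v t = (t - s) * (b \<xi> * f (u \<xi>))"
    using mvt_simple[OF assms(3), of v, OF d(2)] by (auto simp: algebra_simps intro!: bexI)
qed

lemma solves_continuous:
  assumes "solves A B \<alpha> b f u v"
  shows "continuous_on {A..B} u" "continuous_on {A..B} v"
  using assms unfolding solves_def continuous_on_eq_continuous_within
  by (blast intro: DERIV_continuous)+

text \<open>An interior zero of a nonnegative function is a minimum, so its slope vanishes
  there.\<close>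

lemma solves_interior_zero:
  assumes s: "solves A B \<alpha> b f u v" and st: "A < s" "s < t" "t \<le> B"
    and nn: "\<And>x. x \<in> {A..t} \<Longrightarrow> 0 \<le> u x" and z: "u s = 0"
    and \<alpha>: "\<alpha> s > 0"
  shows "v s = 0"
proof (rule ccontr)
  assume "v s \<noteq> 0"
  have "(u has_real_derivative \<alpha> s * v s) (at s within {A..B})"
    using s st by (auto simp: solves_def)
  then have D: "(u has_real_derivative \<alpha> s * v s) (at s)"
    using st at_within_interior[of s "{A..B}"] by simp
  consider "\<alpha> s * v s > 0" | "\<alpha> s * v s < 0"
    using \<open>v s \<noteq> 0\<close> \<alpha> by (metis less_numeral_extra(3) linorder_cases mult_eq_0_iff)
  then show False
  proof cases
    case 1
    from DERIV_pos_inc_left[OF D 1] obtain d where d: "d > 0" "\<And>h. 0 < h \<Longrightarrow> h < d \<Longrightarrow> u (s - h) < u s"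
      by blast
    have "u (s - min (d/2) (s - A)) < u s" using d(1) st by (intro d(2)) auto
    moreover have "0 \<le> u (s - min (d/2) (s - A))" using d(1) st by (intro nn) (auto simp: min_def)
    ultimately show False using z by simp
  next
    case 2
    from DERIV_neg_dec_right[OF D 2] obtain d where d: "d > 0" "\<And>h. 0 < h \<Longrightarrow> h < d \<Longrightarrow> u s > u (s + h)"
      by blast
    have "u (s + min (d/2) (t - s)) < u s" using d(1) st by (intro d(2)) auto
    moreover have "0 \<le> u (s + min (d/2) (t - s))" using d(1) st by (intro nn) (auto simp: min_def)
    ultimately show False using z by simp
  qed
qed

text \<open>One margin \<open>d\<close> serves every interval: it bounds the weight from below on a
  piece [x,y], the length of that piece, and its distance from both ends, which gives slopes room to
  act. Only the first and the last negativity interval may degenerate to a point, where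
  \<open>wp\<close> may be positive; \<open>not_whole\<close> guarantees that some negativity
  interval is proper.\<close>

locale indefinite_weights =
  fixes A B \<alpha>0 \<alpha>1 d W :: real and \<alpha> wp wm :: "real \<Rightarrow> real" and \<sigma> \<tau> :: "nat \<Rightarrow> real" and m :: nat
  assumes AB: "A < B"
    and \<alpha>_cont: "continuous_on {A..B} \<alpha>"
    and wp_cont: "continuous_on {A..B} wp" and wm_cont: "continuous_on {A..B} wm"
    and \<alpha>0: "0 < \<alpha>0" and \<alpha>_bounds: "\<And>t. t \<in> {A..B} \<Longrightarrow> \<alpha>0 \<le> \<alpha> t \<and> \<alpha> t \<le> \<alpha>1"
    and wp_bounds: "\<And>t. t \<in> {A..B} \<Longrightarrow> 0 \<le> wp t \<and> wp t \<le> W"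
    and wm_nonneg: "\<And>t. t \<in> {A..B} \<Longrightarrow> 0 \<le> wm t"
    and m: "1 \<le> m" and ends: "\<tau> 0 = A" "\<sigma> (Suc m) = B"
    and \<sigma>_less_\<tau>: "\<And>i. i \<in> {1..m} \<Longrightarrow> \<sigma> i < \<tau> i"
    and \<tau>_le_\<sigma>: "\<And>i. i \<le> m \<Longrightarrow> \<tau> i \<le> \<sigma> (Suc i)"
    and \<tau>_less_\<sigma>: "\<And>i. i \<in> {1..<m} \<Longrightarrow> \<tau> i < \<sigma> (Suc i)"
    and not_whole: "\<tau> 0 < \<sigma> 1 \<or> \<tau> m < \<sigma> (Suc m) \<or> 2 \<le> m"
    and wm_0: "\<And>i t. i \<in> {1..m} \<Longrightarrow> t \<in> {\<sigma> i..\<tau> i} \<Longrightarrow> wm t = 0"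
    and wp_0: "\<And>i t. i \<le> m \<Longrightarrow> \<tau> i < \<sigma> (Suc i) \<Longrightarrow> t \<in> {\<tau> i..\<sigma> (Suc i)} \<Longrightarrow> wp t = 0"
    and d: "0 < d"
    and wp_large: "\<And>i. i \<in> {1..m} \<Longrightarrow>
      \<exists>x y. \<sigma> i + d \<le> x \<and> x + d \<le> y \<and> y + d \<le> \<tau> i \<and> (\<forall>t\<in>{x..y}. d \<le> wp t)"
    and wm_large: "\<And>i. i \<le> m \<Longrightarrow> \<tau> i < \<sigma> (Suc i) \<Longrightarrow>
      \<exists>x y. \<tau> i + d \<le> x \<and> x + d \<le> y \<and> y + d \<le> \<sigma> (Suc i) \<and> (\<forall>t\<in>{x..y}. d \<le> wm t)"
begin

lemma \<tau>_bounds: "i \<le> m \<Longrightarrow> A \<le> \<tau> i \<and> \<tau> i \<le> B"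
proof -
  have mono: "\<tau> i \<le> \<tau> j" if "i \<le> j" "j \<le> m" for i j
    using that
  proof (induction j rule: dec_induct)
    case (step n)
    then have "\<tau> n \<le> \<sigma> (Suc n)" "\<sigma> (Suc n) < \<tau> (Suc n)"
      using \<tau>_le_\<sigma>[of n] \<sigma>_less_\<tau>[of "Suc n"] by auto
    with step show ?case by auto
  qed auto
  assume i: "i \<le> m"
  have "\<tau> m \<le> B" using \<tau>_le_\<sigma>[of m] ends by simp
  with mono[of 0 i] mono[of i m] i ends show ?thesis by auto
qed

lemma \<sigma>_bounds: "i \<in> {1..Suc m} \<Longrightarrow> A \<le> \<sigma> i \<and> \<sigma> i \<le> B"
proof -
  assume i: "i \<in> {1..Suc m}"
  then obtain j where j: "i = Suc j" "j \<le> m" by (cases i) auto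
  have "A \<le> \<sigma> i" using \<tau>_le_\<sigma>[of j] \<tau>_bounds[of j] j by auto
  moreover have "\<sigma> i \<le> B"
    using \<sigma>_less_\<tau>[of i] \<tau>_bounds[of i] j i ends by (cases "i = Suc m") auto
  ultimately show ?thesis by simp
qed

lemma \<alpha>1: "0 < \<alpha>1" "\<alpha>0 \<le> \<alpha>1"
  using \<alpha>_bounds[of A] \<alpha>0 AB by auto

lemma W_nonneg: "0 \<le> W"
  using wp_bounds[of A] AB by auto

text \<open>By the mean value theorem; the direction of the estimate decides whether
  \<open>\<alpha>0\<close> or \<open>\<alpha>1\<close> multiplies the bound on the flux.\<close>

lemma solution_bounds:
  assumes s: "solves A B \<alpha> b f u v" and st: "A \<le> s" "s \<le> t" "t \<le> B" and c: "0 \<le> c"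
  shows "(\<And>\<xi>. \<xi> \<in> {s..t} \<Longrightarrow> c \<le> v \<xi>) \<Longrightarrow> \<alpha>0 * c * (t - s) \<le> u t - u s"
    and "(\<And>\<xi>. \<xi> \<in> {s..t} \<Longrightarrow> - c \<le> v \<xi>) \<Longrightarrow> - (\<alpha>1 * c * (t - s)) \<le> u t - u s"
    and "(\<And>\<xi>. \<xi> \<in> {s..t} \<Longrightarrow> v \<xi> \<le> c) \<Longrightarrow> u t - u s \<le> \<alpha>1 * c * (t - s)"
    and "(\<And>\<xi>. \<xi> \<in> {s..t} \<Longrightarrow> v \<xi> \<le> - c) \<Longrightarrow> u t - u s \<le> - (\<alpha>0 * c * (t - s))"
proof -
  have "\<exists>\<xi>\<in>{s..t}. u t - u s = (t - s) * (\<alpha> \<xi> * v \<xi>)" if "s < t"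
    using solves_mvt(1)[OF s st(1) that st(3)] by (auto intro!: bexI)
  then have cs: thesis
    if "s = t \<Longrightarrow> thesis" "\<And>\<xi>. \<lbrakk>\<xi> \<in> {s..t}; u t - u s = (t - s) * (\<alpha> \<xi> * v \<xi>); s < t\<rbrakk> \<Longrightarrow> thesis"
    for thesis using that st(2) by (cases "s = t") auto
  have a: "\<alpha>0 \<le> \<alpha> \<xi> \<and> \<alpha> \<xi> \<le> \<alpha>1 \<and> 0 < \<alpha> \<xi>" if "\<xi> \<in> {s..t}" for \<xi>
    using \<alpha>_bounds[of \<xi>] \<alpha>0 that st by auto
  show "\<alpha>0 * c * (t - s) \<le> u t - u s" if v: "\<And>\<xi>. \<xi> \<in> {s..t} \<Longrightarrow> c \<le> v \<xi>"
  proof (rule cs)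
    fix \<xi> assume \<xi>: "\<xi> \<in> {s..t}" "u t - u s = (t - s) * (\<alpha> \<xi> * v \<xi>)" "s < t"
    have "\<alpha>0 * c \<le> \<alpha> \<xi> * v \<xi>" using a[OF \<xi>(1)] v[OF \<xi>(1)] c by (intro mult_mono) auto
    then show ?thesis using \<xi> by (simp add: mult.commute mult_left_mono)
  qed auto
  show "u t - u s \<le> \<alpha>1 * c * (t - s)" if v: "\<And>\<xi>. \<xi> \<in> {s..t} \<Longrightarrow> v \<xi> \<le> c"
  proof (rule cs)
    fix \<xi> assume \<xi>: "\<xi> \<in> {s..t}" "u t - u s = (t - s) * (\<alpha> \<xi> * v \<xi>)" "s < t"
    have "\<alpha> \<xi> * v \<xi> \<le> \<alpha> \<xi> * c" using a[OF \<xi>(1)] v[OF \<xi>(1)] by (intro mult_left_mono) auto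
    also have "\<dots> \<le> \<alpha>1 * c" using a[OF \<xi>(1)] c by (intro mult_right_mono) auto
    finally show ?thesis using \<xi> by (simp add: mult.commute mult_left_mono)
  qed auto
  show "- (\<alpha>1 * c * (t - s)) \<le> u t - u s" if v: "\<And>\<xi>. \<xi> \<in> {s..t} \<Longrightarrow> - c \<le> v \<xi>"
  proof (rule cs)
    fix \<xi> assume \<xi>: "\<xi> \<in> {s..t}" "u t - u s = (t - s) * (\<alpha> \<xi> * v \<xi>)" "s < t"
    have "\<alpha> \<xi> * - v \<xi> \<le> \<alpha> \<xi> * c" using a[OF \<xi>(1)] v[OF \<xi>(1)] by (intro mult_left_mono) auto
    also have "\<dots> \<le> \<alpha>1 * c" using a[OF \<xi>(1)] c by (intro mult_right_mono) auto
    finally have "- (\<alpha>1 * c) \<le> \<alpha> \<xi> * v \<xi>" by simp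
    from mult_left_mono[OF this, of "t - s"] show ?thesis using \<xi> by (simp add: mult_ac)
  qed auto
  show "u t - u s \<le> - (\<alpha>0 * c * (t - s))" if v: "\<And>\<xi>. \<xi> \<in> {s..t} \<Longrightarrow> v \<xi> \<le> - c"
  proof (rule cs)
    fix \<xi> assume \<xi>: "\<xi> \<in> {s..t}" "u t - u s = (t - s) * (\<alpha> \<xi> * v \<xi>)" "s < t"
    have "\<alpha>0 * c \<le> \<alpha> \<xi> * - v \<xi>" using a[OF \<xi>(1)] v[OF \<xi>(1)] c by (intro mult_mono) auto
    then have "\<alpha> \<xi> * v \<xi> \<le> - (\<alpha>0 * c)" by simp
    from mult_left_mono[OF this, of "t - s"] show ?thesis using \<xi> by (simp add: mult_ac)
  qed auto
qed

definition M :: "nat \<Rightarrow> (real \<Rightarrow> real) \<Rightarrow> real"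
  where "M i u = Sup (u ` {\<sigma> i..\<tau> i})"

lemma M_attained:
  assumes u: "continuous_on {A..B} u" and i: "i \<in> {1..m}"
  obtains t where "t \<in> {\<sigma> i..\<tau> i}" "u t = M i u" "\<And>x. x \<in> {\<sigma> i..\<tau> i} \<Longrightarrow> u x \<le> u t"
proof -
  have "continuous_on {\<sigma> i..\<tau> i} u"
    by (rule continuous_on_subset[OF u]) (use \<sigma>_bounds[of i] \<tau>_bounds[of i] i in auto)
  then obtain t where t: "t \<in> {\<sigma> i..\<tau> i}" "\<And>x. x \<in> {\<sigma> i..\<tau> i} \<Longrightarrow> u x \<le> u t"
    using continuous_attains_sup[of "{\<sigma> i..\<tau> i}" u] \<sigma>_less_\<tau>[OF i] by force
  have "M i u = u t" unfolding M_def
    by (rule cSup_eq_maximum) (use t in auto)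
  with t that show ?thesis by auto
qed

lemma M_upper:
  assumes u: "continuous_on {A..B} u" and i: "i \<in> {1..m}" and "t \<in> {\<sigma> i..\<tau> i}"
  shows "u t \<le> M i u"
  by (metis M_attained assms)

lemma M_leI:
  assumes u: "continuous_on {A..B} u" and i: "i \<in> {1..m}" and "\<And>t. t \<in> {\<sigma> i..\<tau> i} \<Longrightarrow> u t \<le> c"
  shows "M i u \<le> c"
  by (metis M_attained assms)

end

section \<open>Behaviour of solutions near the levels\<close>

lemma compact_Icc_preimage:
  fixes h :: "real \<Rightarrow> real"
  assumes "continuous_on {a..c} h"
  shows "compact ({a..c} \<inter> h -` {0..})"
  using continuous_closed_preimage[OF assms closed_atLeastAtMost closed_atLeast]
  by (metis compact_Icc closed_Int_compact compact_Int_closed inf.idem inf_commute inf_left_idem)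

text \<open>While \<open>u\<close> stays below \<open>\<kappa> \<in> {r, R}\<close>, its slope \<open>v\<close> drops by at most \<open>e * \<kappa>\<close> over a positivity
  interval, which moves \<open>u\<close> by at most \<open>\<kappa> / 4\<close>. \<open>\<gamma>\<close> and \<open>\<gamma>1\<close> bound \<open>f\<close> from below where the growth
  and the level \<open>1\<close> arguments need it, and the shooting parameter \<open>C\<close> is so large that \<open>u\<close> reaches
  \<open>R\<close> on the first positivity interval.\<close>

locale shooting = indefinite_weights +
  fixes l \<mu> r R e \<gamma> \<gamma>1 F K C :: real and f :: "real \<Rightarrow> real"
  assumes l: "0 < l" and \<mu>: "0 < \<mu>" and r: "0 < r" "r < 1" and R: "1 < R"
    and f_nonpos: "\<And>s. s \<le> 0 \<Longrightarrow> f s = 0"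
    and f_bounds: "\<And>s. 0 \<le> f s \<and> f s \<le> F"
    and f_linear: "\<And>s. \<bar>f s\<bar> \<le> K * \<bar>s\<bar>"
    and f_middle: "\<And>s. \<lbrakk>\<alpha>0 * d / (\<alpha>0 * d + \<alpha>1 * (B - A)) \<le> s; s \<le> 1\<rbrakk> \<Longrightarrow> \<gamma>1 \<le> f s"
    and l_large: "2 / (\<alpha>0 * d) < l * d * d * \<gamma>1"
    and f_level: "\<And>\<kappa> s. \<lbrakk>\<kappa> = r \<or> \<kappa> = R; s \<le> \<kappa>\<rbrakk> \<Longrightarrow> l * W * (B - A) * f s \<le> e * \<kappa>"
    and e: "0 \<le> e" "\<alpha>1 * (B - A) * e \<le> 1/4"
    and \<gamma>: "0 < \<gamma>" and f_lower: "\<And>s. r / 4 \<le> s \<Longrightarrow> \<gamma> \<le> f s"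
    and \<mu>_large: "R < \<alpha>0 * d * (\<mu> * d * d * \<gamma> - e * R)"
    and C: "R \<le> C" "R \<le> \<alpha>0 * d * (C - l * W * F * (B - A))"
begin

definition b :: "real \<Rightarrow> real"
  where "b t = l * wp t - \<mu> * wm t"

abbreviation sol :: "(real \<Rightarrow> real) \<Rightarrow> (real \<Rightarrow> real) \<Rightarrow> bool"
  where "sol \<equiv> solves A B \<alpha> b f"

lemma b_cont: "continuous_on {A..B} b"
  unfolding b_def by (intro continuous_intros wp_cont wm_cont)

lemma interval_I: "i \<in> {1..m} \<Longrightarrow> A \<le> \<sigma> i \<and> \<sigma> i < \<tau> i \<and> \<tau> i \<le> B"
  using \<sigma>_bounds[of i] \<tau>_bounds[of i] \<sigma>_less_\<tau>[of i] by auto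

lemma interval_J: "i \<le> m \<Longrightarrow> A \<le> \<tau> i \<and> \<tau> i \<le> \<sigma> (Suc i) \<and> \<sigma> (Suc i) \<le> B"
  using \<sigma>_bounds[of "Suc i"] \<tau>_bounds[of i] \<tau>_le_\<sigma>[of i] by auto

lemma v_mvt:
  assumes s: "sol u v" and st: "A \<le> s" "s \<le> t" "t \<le> B"
  shows "\<exists>\<xi>\<in>{s..t}. v s - v t = (t - s) * (b \<xi> * f (u \<xi>))"
proof (cases "s = t")
  case False
  then show ?thesis
    using solves_mvt(2)[OF s st(1) _ st(3)] st(2) greaterThanLessThan_subseteq_atLeastAtMost_iff[of s t s t]
    by (smt (verit, best) subsetD)
qed auto

lemma v_drop:
  assumes s: "sol u v" and i: "i \<in> {1..m}" and st: "\<sigma> i \<le> s" "s \<le> t" "t \<le> \<tau> i"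
  shows "v t \<le> v s"
    and "\<lbrakk>\<kappa> = r \<or> \<kappa> = R; \<And>x. x \<in> {\<sigma> i..\<tau> i} \<Longrightarrow> u x \<le> \<kappa>\<rbrakk> \<Longrightarrow> v s - v t \<le> e * \<kappa>"
    and "v s - v t \<le> l * W * F * (B - A)"
proof -
  note I = interval_I[OF i]
  obtain \<xi> where \<xi>: "\<xi> \<in> {s..t}" "v s - v t = (t - s) * (b \<xi> * f (u \<xi>))"
    using v_mvt[OF s, of s t] I st by auto
  have b\<xi>: "b \<xi> = l * wp \<xi>" using wm_0[OF i, of \<xi>] \<xi>(1) st by (simp add: b_def)
  have wp: "0 \<le> wp \<xi>" "wp \<xi> \<le> W" using wp_bounds[of \<xi>] I st \<xi>(1) by auto
  have f: "0 \<le> f (u \<xi>)" "f (u \<xi>) \<le> F" using f_bounds by auto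
  have "0 \<le> (t - s) * (b \<xi> * f (u \<xi>))"
    using wp f l st by (auto simp: b\<xi>)
  then show "v t \<le> v s" using \<xi> by simp
  have "(t - s) * (b \<xi> * f (u \<xi>)) \<le> (B - A) * ((l * W) * f (u \<xi>))"
    using wp f l st I by (intro mult_mono mult_nonneg_nonneg) (auto simp: b\<xi>)
  then have *: "v s - v t \<le> l * W * (B - A) * f (u \<xi>)" using \<xi> by (simp add: mult_ac)
  show "v s - v t \<le> e * \<kappa>" if "\<kappa> = r \<or> \<kappa> = R" "\<And>x. x \<in> {\<sigma> i..\<tau> i} \<Longrightarrow> u x \<le> \<kappa>"
    using f_level[OF that(1), of "u \<xi>"] that(2)[of \<xi>] \<xi>(1) st * by auto
  have "l * W * (B - A) * f (u \<xi>) \<le> l * W * (B - A) * F"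
    using l W_nonneg AB f by (intro mult_left_mono) auto
  then show "v s - v t \<le> l * W * F * (B - A)" using * by (simp add: mult_ac)
qed

lemma v_mono:
  assumes s: "sol u v" and i: "i \<le> m" and st: "\<tau> i \<le> s" "s \<le> t" "t \<le> \<sigma> (Suc i)"
  shows "v s \<le> v t"
proof (cases "s = t")
  \<comment> \<open>This excludes a degenerate interval, at whose single point \<open>wp\<close> may
    be positive.\<close>
  case False
  note J = interval_J[OF i]
  obtain \<xi> where \<xi>: "\<xi> \<in> {s..t}" "v s - v t = (t - s) * (b \<xi> * f (u \<xi>))"
    using v_mvt[OF s, of s t] J st by auto
  have b\<xi>: "b \<xi> \<le> 0" using wp_0[OF i, of \<xi>] wm_nonneg[of \<xi>] \<xi>(1) st False \<mu> J by (auto simp: b_def)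
  have "(t - s) * (b \<xi> * f (u \<xi>)) \<le> 0"
    using b\<xi> f_bounds[of "u \<xi>"] st by (intro mult_nonneg_nonpos mult_nonpos_nonneg) auto
  then show ?thesis using \<xi> by simp
qed simp

text \<open>The source of growth: this gain is proportional to \<open>\<mu>\<close>, while the
  losses it has to beat do not depend on \<open>\<mu>\<close>.\<close>

lemma v_rise:
  assumes s: "sol u v" and i: "i \<le> m" and st: "\<tau> i \<le> x" "x \<le> y" "y \<le> \<sigma> (Suc i)" "\<tau> i < \<sigma> (Suc i)"
    and wm: "\<And>t. t \<in> {x..y} \<Longrightarrow> d \<le> wm t" and u: "\<And>t. t \<in> {x..y} \<Longrightarrow> r / 4 \<le> u t"
  shows "v x + \<mu> * d * \<gamma> * (y - x) \<le> v y"
proof -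
  note J = interval_J[OF i]
  obtain \<xi> where \<xi>: "\<xi> \<in> {x..y}" "v x - v y = (y - x) * (b \<xi> * f (u \<xi>))"
    using v_mvt[OF s, of x y] J st by auto
  have b\<xi>: "- b \<xi> = \<mu> * wm \<xi>" using wp_0[OF i, of \<xi>] \<xi>(1) st by (auto simp: b_def)
  have "(\<mu> * d) * \<gamma> \<le> - b \<xi> * f (u \<xi>)"
    unfolding b\<xi> using wm[OF \<xi>(1)] u[OF \<xi>(1)] f_lower \<mu> \<gamma> d by (intro mult_mono) auto
  then have "(y - x) * (\<mu> * d * \<gamma>) \<le> (y - x) * (- b \<xi> * f (u \<xi>))"
    using st by (intro mult_left_mono) auto
  then show ?thesis using \<xi>(2) by (simp add: algebra_simps)
qed

lemma \<kappa>_bounds: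
  assumes "\<kappa> = r \<or> \<kappa> = R"
  shows "r \<le> \<kappa>" "\<kappa> \<le> R" "0 < \<kappa>" "\<alpha>1 * (e * \<kappa>) * (B - A) \<le> \<kappa> / 4"
proof -
  show "r \<le> \<kappa>" "\<kappa> \<le> R" and k: "0 < \<kappa>" using assms r R by auto
  show "\<alpha>1 * (e * \<kappa>) * (B - A) \<le> \<kappa> / 4"
    using mult_right_mono[OF e(2), of \<kappa>] k by (simp add: mult_ac)
qed

lemma growth_const: "0 < \<mu> * d * d * \<gamma> - e * R"
proof (rule ccontr)
  assume "\<not> ?thesis"
  then have "\<alpha>0 * d * (\<mu> * d * d * \<gamma> - e * R) \<le> 0"
    using \<alpha>0 d by (intro mult_nonneg_nonpos) auto
  then show False using \<mu>_large R by simp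
qed

text \<open>Since \<open>v\<close> is nondecreasing it never falls below -e \<kappa>, so
  \<open>u\<close> loses at most \<kappa>/4 and stays above r/4, where \<open>f_lower\<close>
  applies. The rise over [x,y] then makes the slope large, and the distance of at least
  \<open>d\<close> from y to the end carries \<open>u\<close> past R.\<close>

lemma growth_forward:
  assumes s: "sol u v" and i: "i \<le> m" "\<tau> i < \<sigma> (Suc i)" and \<kappa>: "\<kappa> = r \<or> \<kappa> = R"
    and u: "\<kappa> / 2 \<le> u (\<tau> i)" and v: "- (e * \<kappa>) \<le> v (\<tau> i)"
  shows "R < u (\<sigma> (Suc i))" "0 < v (\<sigma> (Suc i))" "\<And>t. t \<in> {\<tau> i..\<sigma> (Suc i)} \<Longrightarrow> 0 < u t"
proof -
  note J = interval_J[OF i(1)] and k = \<kappa>_bounds[OF \<kappa>]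
  obtain x y where xy: "\<tau> i + d \<le> x" "x + d \<le> y" "y + d \<le> \<sigma> (Suc i)" "\<And>t. t \<in> {x..y} \<Longrightarrow> d \<le> wm t"
    using wm_large[OF i] by blast
  have vl: "- (e * \<kappa>) \<le> v t" if "t \<in> {\<tau> i..\<sigma> (Suc i)}" for t
    using v_mono[OF s i(1), of "\<tau> i" t] that v by auto
  have ul: "r / 4 \<le> u t" if t: "t \<in> {\<tau> i..\<sigma> (Suc i)}" for t
  proof -
    have "- (\<alpha>1 * (e * \<kappa>) * (t - \<tau> i)) \<le> u t - u (\<tau> i)"
      by (rule solution_bounds(2)[OF s]) (use J t e k vl in auto)
    moreover have "\<alpha>1 * (e * \<kappa>) * (t - \<tau> i) \<le> \<alpha>1 * (e * \<kappa>) * (B - A)"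
      using \<alpha>1 e k J t by (intro mult_left_mono) auto
    ultimately show ?thesis using k u by linarith
  qed
  then show "\<And>t. t \<in> {\<tau> i..\<sigma> (Suc i)} \<Longrightarrow> 0 < u t" using r by force
  \<comment> \<open>The gain of slope over [x,y] minus the loss e \<kappa>, estimated by e R so that
    one constant serves both levels.\<close>
  define c where "c = \<mu> * d * d * \<gamma> - e * R"
  have c: "0 < c" unfolding c_def by (rule growth_const)
  have "v x + \<mu> * d * \<gamma> * d \<le> v x + \<mu> * d * \<gamma> * (y - x)"
    using xy \<mu> d \<gamma> by (intro add_left_mono mult_left_mono) auto
  also have "\<dots> \<le> v y"
    by (rule v_rise[OF s i(1)]) (use xy d i ul in auto)
  finally have "c \<le> v y"
    using vl[of x] xy d mult_left_mono[OF k(2) e(1)] by (auto simp: c_def mult_ac)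
  then have vc: "c \<le> v t" if "t \<in> {y..\<sigma> (Suc i)}" for t
    using v_mono[OF s i(1), of y t] that xy d by auto
  show "0 < v (\<sigma> (Suc i))" using vc[of "\<sigma> (Suc i)"] c xy d by auto
  have "\<alpha>0 * c * (\<sigma> (Suc i) - y) \<le> u (\<sigma> (Suc i)) - u y"
    by (rule solution_bounds(1)[OF s]) (use J xy d c vc in auto)
  moreover have "\<alpha>0 * c * d \<le> \<alpha>0 * c * (\<sigma> (Suc i) - y)"
    using xy \<alpha>0 c by (intro mult_left_mono) auto
  moreover have "R < \<alpha>0 * c * d" using \<mu>_large by (simp add: c_def mult_ac)
  moreover have "0 < u y" using ul[of y] xy d r by auto
  ultimately show "R < u (\<sigma> (Suc i))" by linarith
qed

text \<open>Time reversal of \<open>growth_forward\<close>. It refutes a wrong slope at the right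
  end: backwards one meets either a value above R on the previous positivity interval or, on the
  first negativity interval, a negative initial slope.\<close>

lemma growth_backward:
  assumes s: "sol u v" and i: "i \<le> m" "\<tau> i < \<sigma> (Suc i)" and \<kappa>: "\<kappa> = r \<or> \<kappa> = R"
    and u: "\<kappa> / 2 \<le> u (\<sigma> (Suc i))" and v: "v (\<sigma> (Suc i)) \<le> e * \<kappa>"
  shows "R < u (\<tau> i)" "v (\<tau> i) < 0"
proof -
  note J = interval_J[OF i(1)] and k = \<kappa>_bounds[OF \<kappa>]
  obtain x y where xy: "\<tau> i + d \<le> x" "x + d \<le> y" "y + d \<le> \<sigma> (Suc i)" "\<And>t. t \<in> {x..y} \<Longrightarrow> d \<le> wm t"
    using wm_large[OF i] by blast
  have vl: "v t \<le> e * \<kappa>" if "t \<in> {\<tau> i..\<sigma> (Suc i)}" for t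
    using v_mono[OF s i(1), of t "\<sigma> (Suc i)"] that v by auto
  have ul: "r / 4 \<le> u t" if t: "t \<in> {\<tau> i..\<sigma> (Suc i)}" for t
  proof -
    have "u (\<sigma> (Suc i)) - u t \<le> \<alpha>1 * (e * \<kappa>) * (\<sigma> (Suc i) - t)"
      by (rule solution_bounds(3)[OF s]) (use J t e k vl in auto)
    moreover have "\<alpha>1 * (e * \<kappa>) * (\<sigma> (Suc i) - t) \<le> \<alpha>1 * (e * \<kappa>) * (B - A)"
      using \<alpha>1 e k J t by (intro mult_left_mono) auto
    ultimately show ?thesis using k u by linarith
  qed
  define c where "c = \<mu> * d * d * \<gamma> - e * R"
  have c: "0 < c" unfolding c_def by (rule growth_const)
  have "v x + \<mu> * d * \<gamma> * d \<le> v x + \<mu> * d * \<gamma> * (y - x)"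
    using xy \<mu> d \<gamma> by (intro add_left_mono mult_left_mono) auto
  also have "\<dots> \<le> v y"
    by (rule v_rise[OF s i(1)]) (use xy d i ul in auto)
  finally have "v x \<le> - c"
    using vl[of y] xy d mult_left_mono[OF k(2) e(1)] by (auto simp: c_def mult_ac)
  then have vc: "v t \<le> - c" if "t \<in> {\<tau> i..x}" for t
    using v_mono[OF s i(1), of t x] that xy d by auto
  show "v (\<tau> i) < 0" using vc[of "\<tau> i"] c xy d by auto
  have "u x - u (\<tau> i) \<le> - (\<alpha>0 * c * (x - \<tau> i))"
    by (rule solution_bounds(4)[OF s]) (use J xy d c vc in auto)
  moreover have "\<alpha>0 * c * d \<le> \<alpha>0 * c * (x - \<tau> i)"
    using xy \<alpha>0 c by (intro mult_left_mono) auto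
  moreover have "R < \<alpha>0 * c * d" using \<mu>_large by (simp add: c_def mult_ac)
  moreover have "0 < u x" using ul[of x] xy d r by auto
  ultimately show "R < u (\<tau> i)" by linarith
qed

text \<open>As \<open>f\<close> vanishes on negative values, \<open>v\<close> is constant while
  \<open>u\<close> is below 0; the way down makes it negative, so \<open>u\<close> can only keep
  falling.\<close>

lemma hit:
  assumes s: "sol u v" and A: "0 \<le> u A" and us: "u s < 0" and st: "A \<le> s" "s \<le> t" "t \<le> B"
  shows "u t < 0" "v t < 0"
proof -
  note uc = solves_continuous(1)[OF s]
  \<comment> \<open>Its maximum is the last point before \<open>s\<close> with \<open>u\<close>
    nonnegative; a mean value point after it has both \<open>u\<close> and \<open>v\<close>
    negative.\<close>
  define S where "S = {A..s} \<inter> u -` {0..}"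
  have "compact S"
    unfolding S_def using st
    by (intro compact_Icc_preimage continuous_on_subset[OF uc]) auto
  moreover have "A \<in> S" using A st by (auto simp: S_def)
  ultimately have "\<exists>z\<in>S. \<forall>x\<in>S. x \<le> z"
    by (intro compact_attains_sup) auto
  then obtain z where z: "z \<in> S" "\<And>x. x \<in> S \<Longrightarrow> x \<le> z"
    by blast
  have zs: "A \<le> z" "0 \<le> u z" "z \<le> s" using z(1) by (auto simp: S_def)
  with us have zs: "z < s" "A \<le> z" "0 \<le> u z" by (cases "z = s"; simp)+
  obtain \<xi> where \<xi>: "\<xi> \<in> {z<..<s}" "u s - u z = (s - z) * (\<alpha> \<xi> * v \<xi>)"
    using solves_mvt(1)[OF s zs(2,1)] st by auto
  have "u \<xi> < 0" using z(2)[of \<xi>] \<xi>(1) zs by (force simp: S_def)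
  have "(s - z) * (\<alpha> \<xi> * v \<xi>) < 0" using \<xi>(2) us zs by linarith
  moreover have "0 < \<alpha> \<xi>" using \<alpha>_bounds[of \<xi>] \<alpha>0 \<xi>(1) zs st by auto
  ultimately have "v \<xi> < 0" using zs by (simp add: mult_less_0_iff)
  have const: "v x = v \<xi>" if "\<xi> \<le> x" "x \<le> B" "\<And>y. \<xi> \<le> y \<Longrightarrow> y \<le> x \<Longrightarrow> u y \<le> 0" for x
  proof -
    have "A \<le> \<xi>" using \<xi>(1) zs by auto
    from v_mvt[OF s this that(1,2)]
    obtain y where "y \<in> {\<xi>..x}" "v \<xi> - v x = (x - \<xi>) * (b y * f (u y))"
      by blast
    with that(3)[of y] f_nonpos[of "u y"] show ?thesis by simp
  qed
  have neg: "u x < 0" if x: "\<xi> \<le> x" "x \<le> B" for x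
  proof (rule ccontr)
    assume n: "\<not> u x < 0"
    \<comment> \<open>Its minimum is the first return to nonnegative values. Up to there
      \<open>v\<close> keeps its negative value, which the mean value theorem makes incompatible
      with a return.\<close>
    define T where "T = {\<xi>..x} \<inter> u -` {0..}"
    have "compact T"
      unfolding T_def using x \<xi> zs
      by (intro compact_Icc_preimage continuous_on_subset[OF uc]) auto
    moreover have "x \<in> T" using n x by (auto simp: T_def)
    ultimately have "\<exists>w\<in>T. \<forall>y\<in>T. w \<le> y"
      by (intro compact_attains_inf) auto
    then obtain w where w: "w \<in> T" "\<And>y. y \<in> T \<Longrightarrow> w \<le> y"
      by blast
    have w': "\<xi> \<le> w" "w \<le> B" "0 \<le> u w" using w(1) x by (auto simp: T_def)
    with \<open>u \<xi> < 0\<close> have w': "\<xi> < w" "w \<le> B" "0 \<le> u w" by (cases "w = \<xi>"; simp)+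
    obtain y where y: "y \<in> {\<xi><..<w}" "u w - u \<xi> = (w - \<xi>) * (\<alpha> y * v y)"
      using solves_mvt(1)[OF s _ w'(1,2)] \<xi> zs by auto
    have "u q \<le> 0" if "\<xi> \<le> q" "q \<le> y" for q
      using w(2)[of q] that y(1) w(1) by (force simp: T_def)
    then have "v y = v \<xi>" using const[of y] y(1) w' by auto
    moreover have "0 < \<alpha> y" using \<alpha>_bounds[of y] \<alpha>0 \<xi>(1) y(1) zs w' by auto
    ultimately have "(w - \<xi>) * (\<alpha> y * v y) < 0"
      using \<open>v \<xi> < 0\<close> w' by (simp add: mult_pos_neg)
    then show False using y(2) w' \<open>u \<xi> < 0\<close> by linarith
  qed
  have key: "u x < 0 \<and> v x = v \<xi>" if x: "\<xi> \<le> x" "x \<le> B" for x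
    using neg[OF x] const[OF x] neg x by (force intro: less_imp_le)
  show "u t < 0" "v t < 0" using key[of t] \<open>v \<xi> < 0\<close> \<xi>(1) st by auto
qed

text \<open>By \<open>hit\<close>, a solution that becomes positive again was never negative before;
  it would then touch 0 at \<open>s\<close> with zero slope and vanish identically. The point A is
  excluded because Dirichlet solutions start from 0.\<close>

lemma persistence:
  assumes s: "sol u v" and A: "0 \<le> u A" and us: "u s \<le> 0" and st: "A < s" "s \<le> t" "t \<le> B"
  shows "u t \<le> 0"
proof (rule ccontr)
  assume n: "\<not> ?thesis"
  then have "s < t" using us st by (cases "s = t") auto
  have nn: "0 \<le> u x" if "x \<in> {A..t}" for x
    using hit(1)[OF s A, of x t] that st n by force
  have "u s = 0" using nn[of s] us st by auto
  moreover have "v s = 0"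
    by (rule solves_interior_zero[OF s st(1) \<open>s < t\<close> st(3) nn \<open>u s = 0\<close>])
       (use \<alpha>_bounds[of s] \<alpha>0 st in auto)
  ultimately have "u t = 0"
    using solves_zero(1)[OF s \<alpha>_cont b_cont _ f_linear, of s t] f_nonpos[of 0] st by auto
  with n show False by simp
qed

text \<open>A strong maximum principle: \<open>hit\<close> makes \<open>u\<close> nonnegative up to
  B, and an interior zero would have zero slope and force the zero solution.\<close>

lemma positive_inside:
  assumes s: "sol u v" and A: "0 \<le> u A" and Bn: "0 \<le> u B" and st: "A < s" "s < B"
    and nt: "\<exists>t\<in>{A..B}. u t \<noteq> 0"
  shows "0 < u s"
proof (rule ccontr)
  assume n: "\<not> ?thesis"
  have nn: "0 \<le> u x" if "x \<in> {A..B}" for x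
    using hit(1)[OF s A, of x B] that Bn by force
  have "u s = 0" using nn[of s] n st by auto
  moreover have "v s = 0"
    by (rule solves_interior_zero[OF s st order_refl nn \<open>u s = 0\<close>])
       (use \<alpha>_bounds[of s] \<alpha>0 st in auto)
  ultimately have "\<forall>t\<in>{A..B}. u t = 0"
    using solves_zero(1)[OF s \<alpha>_cont b_cont _ f_linear, of s] f_nonpos[of 0] st by auto
  with nt show False by simp
qed

lemma max_slope:
  assumes s: "sol u v" and i: "i \<in> {1..m}" and t: "t \<in> {\<sigma> i..\<tau> i}"
    and mx: "\<And>x. x \<in> {\<sigma> i..\<tau> i} \<Longrightarrow> u x \<le> u t"
  shows "t < \<tau> i \<Longrightarrow> v t \<le> 0" "\<sigma> i < t \<Longrightarrow> 0 \<le> v t"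
proof -
  note I = interval_I[OF i]
  have D: "(u has_real_derivative \<alpha> t * v t) (at t within {\<sigma> i..\<tau> i})"
    by (rule DERIV_subset[of _ _ _ "{A..B}"]) (use s I t in \<open>auto simp: solves_def\<close>)
  have a: "0 < \<alpha> t" using \<alpha>_bounds[of t] \<alpha>0 I t by auto
  show "v t \<le> 0" if "t < \<tau> i"
  proof (rule ccontr)
    assume "\<not> v t \<le> 0"
    then have "0 < \<alpha> t * v t" using a by simp
    from has_real_derivative_pos_inc_right[OF D this] obtain h where
      h: "h > 0" "\<And>k. 0 < k \<Longrightarrow> t + k \<in> {\<sigma> i..\<tau> i} \<Longrightarrow> k < h \<Longrightarrow> u t < u (t + k)" by blast
    have "u t < u (t + min (h/2) (\<tau> i - t))" using h(1) that t by (intro h(2)) auto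
    moreover have "u (t + min (h/2) (\<tau> i - t)) \<le> u t" using h(1) that t by (intro mx) auto
    ultimately show False by simp
  qed
  show "0 \<le> v t" if "\<sigma> i < t"
  proof (rule ccontr)
    assume "\<not> 0 \<le> v t"
    then have "\<alpha> t * v t < 0" using a by (simp add: mult_pos_neg)
    from has_real_derivative_neg_dec_left[OF D this] obtain h where
      h: "h > 0" "\<And>k. 0 < k \<Longrightarrow> t - k \<in> {\<sigma> i..\<tau> i} \<Longrightarrow> k < h \<Longrightarrow> u t < u (t - k)" by blast
    have "u t < u (t - min (h/2) (t - \<sigma> i))" using h(1) that t by (intro h(2)) auto
    moreover have "u (t - min (h/2) (t - \<sigma> i)) \<le> u t" using h(1) that t by (intro mx) auto
    ultimately show False by simp
  qed
qed

text \<open>At a maximum point the slope is nonnegative, and over the rest of the interval it drops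
  by at most e \<kappa>, which costs \<open>u\<close> at most \<kappa>/4. The first two conclusions
  feed \<open>growth_forward\<close>; the third feeds \<open>growth_backward\<close> when the last
  positivity interval ends at B.\<close>

lemma level:
  assumes s: "sol u v" and v0: "0 \<le> v A" and i: "i \<in> {1..m}" and \<kappa>: "\<kappa> = r \<or> \<kappa> = R"
    and Mi: "M i u = \<kappa>" and prev: "\<And>j. j \<in> {1..<i} \<Longrightarrow> M j u \<le> R"
  shows "\<kappa> / 2 \<le> u (\<tau> i)" "- (e * \<kappa>) \<le> v (\<tau> i)"
    and "v (\<tau> i) \<le> 0 \<Longrightarrow> \<kappa> / 2 \<le> u (\<sigma> i) \<and> v (\<sigma> i) \<le> e * \<kappa>"
proof -
  note I = interval_I[OF i] and k = \<kappa>_bounds[OF \<kappa>] and uc = solves_continuous(1)[OF s]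
  obtain t where t: "t \<in> {\<sigma> i..\<tau> i}" "u t = \<kappa>" and mx: "\<And>x. x \<in> {\<sigma> i..\<tau> i} \<Longrightarrow> u x \<le> \<kappa>"
    using M_attained[OF uc i] Mi by metis
  have vt: "0 \<le> v t"
  proof (cases "\<sigma> i < t")
    case True
    then show ?thesis using max_slope(2)[OF s i t(1)] mx t(2) by auto
  next
    case False
    then have ts: "t = \<sigma> i" using t by auto
    show ?thesis
    proof (cases "i = 1")
      case True
      then show ?thesis using v_mono[OF s, of 0 A "\<sigma> 1"] interval_J[of 0] ends v0 ts by auto
    next
      case False
      then obtain j where j: "i = Suc j" "j \<in> {1..<m}" using i by (cases i) auto
      show ?thesis
      proof (rule ccontr)
        (* Followed backwards, a descending u would exceed R on the previous positivity interval. *)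
        assume "\<not> 0 \<le> v t"
        moreover have "0 \<le> e * \<kappa>" using e k by simp
        ultimately have "v (\<sigma> (Suc j)) \<le> e * \<kappa>" using ts j by simp
        then have "R < u (\<tau> j)"
          using growth_backward(1)[OF s _ _ \<kappa>, of j] \<tau>_less_\<sigma>[of j] j t ts k by auto
        moreover have "u (\<tau> j) \<le> M j u"
          by (rule M_upper[OF uc]) (use j interval_I[of j] in auto)
        ultimately show False using prev[of j] j by auto
      qed
    qed
  qed
  have vl: "- (e * \<kappa>) \<le> v x" if "x \<in> {t..\<tau> i}" for x
    using v_drop(2)[OF s i _ _ _ \<kappa> mx, of t x] vt that t by auto
  have fac: "\<alpha>1 * (e * \<kappa>) * h \<le> \<kappa> / 4" if "h \<le> B - A" for h
  proof -
    have "\<alpha>1 * (e * \<kappa>) * h \<le> \<alpha>1 * (e * \<kappa>) * (B - A)"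
      using \<alpha>1 e k by (intro mult_left_mono that mult_nonneg_nonneg) auto
    with k(4) show ?thesis by linarith
  qed
  show "- (e * \<kappa>) \<le> v (\<tau> i)" using vl[of "\<tau> i"] t by auto
  have "- (\<alpha>1 * (e * \<kappa>) * (\<tau> i - t)) \<le> u (\<tau> i) - u t"
    by (rule solution_bounds(2)[OF s]) (use I t e k vl in auto)
  moreover have "\<alpha>1 * (e * \<kappa>) * (\<tau> i - t) \<le> \<kappa> / 4" using I t by (intro fac) auto
  ultimately show "\<kappa> / 2 \<le> u (\<tau> i)" using t(2) k by linarith
  assume vn: "v (\<tau> i) \<le> 0"
  have vu: "v x \<le> e * \<kappa>" if "x \<in> {\<sigma> i..\<tau> i}" for x
    using v_drop(2)[OF s i _ _ _ \<kappa> mx, of x "\<tau> i"] vn that by auto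
  have "u t - u (\<sigma> i) \<le> \<alpha>1 * (e * \<kappa>) * (t - \<sigma> i)"
    by (rule solution_bounds(3)[OF s]) (use I t e k vu in auto)
  moreover have "\<alpha>1 * (e * \<kappa>) * (t - \<sigma> i) \<le> \<kappa> / 4" using I t by (intro fac) auto
  ultimately have "\<kappa> / 2 \<le> u (\<sigma> i)" using t(2) k by linarith
  then show "\<kappa> / 2 \<le> u (\<sigma> i) \<and> v (\<sigma> i) \<le> e * \<kappa>" using vu[of "\<sigma> i"] I by auto
qed

text \<open>If \<open>u\<close> stayed between 0 and 1, the margins of length \<open>d\<close> on
  both sides of [x,y] would give v x \<le> 1/(\<alpha>0 d) and -v y \<le> 1/(\<alpha>0 d). But
  \<open>u\<close> is at least \<eta> on [x,y], so f(u) \<ge> \<gamma>1 and the slope drops there by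
  at least l d d \<gamma>1, which \<open>l_large\<close> makes too much.\<close>

lemma middle:
  assumes s: "sol u v" and i: "i \<in> {1..m}" and Mi: "M i u = 1"
  shows "\<exists>t\<in>{\<sigma> i..\<tau> i}. u t < 0"
proof (rule ccontr)
  assume "\<not> ?thesis"
  then have nn: "0 \<le> u x" if "x \<in> {\<sigma> i..\<tau> i}" for x using that by (meson not_less)
  note I = interval_I[OF i] and uc = solves_continuous(1)[OF s]
  obtain t where t: "t \<in> {\<sigma> i..\<tau> i}" "u t = 1" and mx: "\<And>x. x \<in> {\<sigma> i..\<tau> i} \<Longrightarrow> u x \<le> 1"
    using M_attained[OF uc i] Mi by metis
  obtain x y where xy: "\<sigma> i + d \<le> x" "x + d \<le> y" "y + d \<le> \<tau> i" "\<And>t. t \<in> {x..y} \<Longrightarrow> d \<le> wp t"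
    using wp_large[OF i] by blast
  define \<eta> where "\<eta> = \<alpha>0 * d / (\<alpha>0 * d + \<alpha>1 * (B - A))"
  have den: "0 < \<alpha>0 * d + \<alpha>1 * (B - A)" using \<alpha>0 d \<alpha>1 AB by (intro add_pos_nonneg) auto
  have low: "\<eta> \<le> u z" if z: "z \<in> {x..y}" for z
  proof -
    \<comment> \<open>Here c = |v z|. As \<open>v\<close> is nonincreasing, from z away from the
      maximum \<open>u\<close> falls at rate at least \<alpha>0 c over a length \<open>d\<close> and
      still ends nonnegative; between the maximum and z it falls at rate at most \<alpha>1 c.
      Eliminating c yields \<eta>.\<close>
    have "\<exists>c\<ge>0. \<alpha>0 * c * d \<le> u z \<and> 1 - u z \<le> \<alpha>1 * c * (B - A)"
    proof (cases "t \<le> z")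
      case True
      have vz: "v z \<le> 0"
        using max_slope(1)[OF s i t(1)] mx t True z xy d v_drop(1)[OF s i, of t z] by auto
      have 1: "u (\<tau> i) - u z \<le> - (\<alpha>0 * - v z * (\<tau> i - z))"
        by (rule solution_bounds(4)[OF s])
           (use I z xy d vz v_drop(1)[OF s i, of z] in auto)
      have 2: "- (\<alpha>1 * - v z * (z - t)) \<le> u z - u t"
        by (rule solution_bounds(2)[OF s])
           (use I z xy d vz t True v_drop(1)[OF s i, of _ z] in auto)
      have 3: "\<alpha>0 * - v z * d \<le> \<alpha>0 * - v z * (\<tau> i - z)"
        using \<alpha>0 vz z xy by (intro mult_left_mono mult_nonneg_nonneg) auto
      have 4: "\<alpha>1 * - v z * (z - t) \<le> \<alpha>1 * - v z * (B - A)"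
        using \<alpha>1 vz z xy I t d by (intro mult_left_mono mult_nonneg_nonneg) auto
      show ?thesis
        using 1 2 3 4 vz t nn[of "\<tau> i"] I by (intro exI[of _ "- v z"]) auto
    next
      case False
      have vz: "0 \<le> v z"
        using max_slope(2)[OF s i t(1)] mx t False z xy d v_drop(1)[OF s i, of z t] by auto
      have 1: "\<alpha>0 * v z * (z - \<sigma> i) \<le> u z - u (\<sigma> i)"
        by (rule solution_bounds(1)[OF s])
           (use I z xy d vz v_drop(1)[OF s i, of _ z] in auto)
      have 2: "u t - u z \<le> \<alpha>1 * v z * (t - z)"
        by (rule solution_bounds(3)[OF s])
           (use I z xy d vz t False v_drop(1)[OF s i, of z] in auto)
      have 3: "\<alpha>0 * v z * d \<le> \<alpha>0 * v z * (z - \<sigma> i)"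
        using \<alpha>0 vz z xy by (intro mult_left_mono mult_nonneg_nonneg) auto
      have 4: "\<alpha>1 * v z * (t - z) \<le> \<alpha>1 * v z * (B - A)"
        using \<alpha>1 vz z xy I t d by (intro mult_left_mono mult_nonneg_nonneg) auto
      show ?thesis
        using 1 2 3 4 vz t nn[of "\<sigma> i"] I by (intro exI[of _ "v z"]) auto
    qed
    then obtain c where c: "\<alpha>0 * c * d \<le> u z" "1 - u z \<le> \<alpha>1 * c * (B - A)" by blast
    have "\<alpha>0 * d * (1 - u z) \<le> \<alpha>0 * d * (\<alpha>1 * c * (B - A))"
      using c(2) \<alpha>0 d by (intro mult_left_mono) auto
    also have "\<dots> = \<alpha>1 * (B - A) * (\<alpha>0 * c * d)" by (simp add: mult_ac)
    also have "\<dots> \<le> \<alpha>1 * (B - A) * u z"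
      using c(1) \<alpha>1 AB by (intro mult_left_mono) auto
    finally have "\<alpha>0 * d \<le> u z * (\<alpha>0 * d + \<alpha>1 * (B - A))" by (simp add: algebra_simps)
    then show ?thesis unfolding \<eta>_def using den by (simp add: divide_le_eq)
  qed
  obtain \<xi> where \<xi>: "\<xi> \<in> {x..y}" "v x - v y = (y - x) * (b \<xi> * f (u \<xi>))"
    using v_mvt[OF s, of x y] I xy d by auto
  have b\<xi>: "b \<xi> = l * wp \<xi>" using wm_0[OF i, of \<xi>] \<xi>(1) xy d by (simp add: b_def)
  have f\<xi>: "\<gamma>1 \<le> f (u \<xi>)"
    using f_middle[of "u \<xi>"] low[OF \<xi>(1)] mx[of \<xi>] \<xi>(1) xy d unfolding \<eta>_def by auto
  have \<gamma>1: "0 < \<gamma>1"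
  proof -
    have "0 < 2 / (\<alpha>0 * d)" using \<alpha>0 d by simp
    then have "0 < l * d * d * \<gamma>1" using l_large by linarith
    moreover have "0 < l * d * d" using l d by simp
    ultimately show ?thesis by (metis zero_less_mult_pos)
  qed
  have "0 \<le> wp \<xi>" using xy(4)[OF \<xi>(1)] d by linarith
  then have "d * ((l * d) * \<gamma>1) \<le> (y - x) * (b \<xi> * f (u \<xi>))"
    unfolding b\<xi> using xy \<xi>(1) l d f\<xi> \<gamma>1 by (intro mult_mono mult_nonneg_nonneg) auto
  then have big: "2 / (\<alpha>0 * d) < v x - v y" using l_large \<xi>(2) by (simp add: mult_ac)
  have vx: "v x \<le> 1 / (\<alpha>0 * d)"
  proof (cases "0 \<le> v x")
    case True
    have "\<alpha>0 * v x * (x - \<sigma> i) \<le> u x - u (\<sigma> i)"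
      by (rule solution_bounds(1)[OF s]) (use I xy d True v_drop(1)[OF s i, of _ x] in auto)
    moreover have "\<alpha>0 * v x * d \<le> \<alpha>0 * v x * (x - \<sigma> i)"
      using xy \<alpha>0 True by (intro mult_left_mono) auto
    ultimately have "\<alpha>0 * v x * d \<le> 1" using mx[of x] nn[of "\<sigma> i"] xy d I by auto
    then show ?thesis using \<alpha>0 d by (simp add: field_simps)
  next
    case False
    then show ?thesis using \<alpha>0 d by (smt (verit) divide_pos_pos mult_pos_pos)
  qed
  have vy: "- v y \<le> 1 / (\<alpha>0 * d)"
  proof (cases "v y \<le> 0")
    case True
    have "u (\<tau> i) - u y \<le> - (\<alpha>0 * - v y * (\<tau> i - y))"
      by (rule solution_bounds(4)[OF s]) (use I xy d True v_drop(1)[OF s i, of y] in auto)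
    moreover have "\<alpha>0 * - v y * d \<le> \<alpha>0 * - v y * (\<tau> i - y)"
      using xy \<alpha>0 True by (intro mult_left_mono mult_nonneg_nonneg) auto
    ultimately have "\<alpha>0 * - v y * d \<le> 1" using mx[of y] nn[of "\<tau> i"] xy d I by auto
    then show ?thesis using \<alpha>0 d by (simp add: field_simps)
  next
    case False
    then show ?thesis using \<alpha>0 d by (smt (verit) divide_pos_pos mult_pos_pos)
  qed
  show False using big vx vy by (simp add: field_simps)
qed

end

section \<open>Shooting\<close>

text \<open>Take the first point where h reaches q, then the last point before it where h is at most
  p; in between h is trapped.\<close>

lemma segment_levels_aux:
  fixes h :: "real \<Rightarrow> real"
  assumes h: "continuous_on {a..c} h" and ac: "a \<le> c" and p: "h a \<le> p" "p \<le> q" "q \<le> h c"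
  shows "\<exists>a' c'. a \<le> a' \<and> a' \<le> c' \<and> c' \<le> c \<and> h a' = p \<and> h c' = q \<and> (\<forall>x\<in>{a'..c'}. p \<le> h x \<and> h x \<le> q)"
proof -
  have "compact ({a..c} \<inter> (\<lambda>x. h x - q) -` {0..})"
    by (intro compact_Icc_preimage continuous_intros h)
  moreover have "c \<in> {a..c} \<inter> (\<lambda>x. h x - q) -` {0..}" using ac p by auto
  ultimately have "\<exists>x\<in>{a..c} \<inter> (\<lambda>x. h x - q) -` {0..}. \<forall>y\<in>{a..c} \<inter> (\<lambda>x. h x - q) -` {0..}. x \<le> y"
    by (intro compact_attains_inf) blast+
  then obtain c' where c': "a \<le> c'" "c' \<le> c" "q \<le> h c'" "\<And>y. a \<le> y \<Longrightarrow> y \<le> c \<Longrightarrow> q \<le> h y \<Longrightarrow> c' \<le> y"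
    by auto
  obtain z where z: "a \<le> z" "z \<le> c'" "h z = q"
    using IVT'[of h a q c'] continuous_on_subset[OF h, of "{a..c'}"] p c' by auto
  then have hc': "h c' = q" using c'(4)[of z] c'(2) by force
  have "compact ({a..c'} \<inter> (\<lambda>x. p - h x) -` {0..})"
    by (intro compact_Icc_preimage continuous_intros continuous_on_subset[OF h]) (use c' in auto)
  moreover have "a \<in> {a..c'} \<inter> (\<lambda>x. p - h x) -` {0..}" using c' p by auto
  ultimately have "\<exists>x\<in>{a..c'} \<inter> (\<lambda>x. p - h x) -` {0..}. \<forall>y\<in>{a..c'} \<inter> (\<lambda>x. p - h x) -` {0..}. y \<le> x"
    by (intro compact_attains_sup) blast+
  then obtain a' where a': "a \<le> a'" "a' \<le> c'" "h a' \<le> p" "\<And>y. a \<le> y \<Longrightarrow> y \<le> c' \<Longrightarrow> h y \<le> p \<Longrightarrow> y \<le> a'"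
    by auto
  obtain z' where z': "a' \<le> z'" "z' \<le> c'" "h z' = p"
    using IVT'[of h a' p c'] continuous_on_subset[OF h, of "{a'..c'}"] p c' a' hc' by auto
  then have ha': "h a' = p" using a'(4)[of z'] a'(1) by force
  have "p \<le> h x \<and> h x \<le> q" if "x \<in> {a'..c'}" for x
    using a'(4)[of x] c'(4)[of x] that a'(1) c'(2) ha' hc' by (smt (verit) atLeastAtMost_iff)
  with a' c' ha' hc' show ?thesis by blast
qed

text \<open>Stated for \<open>closed_segment\<close>, which ignores the order of its ends, because
  in the induction the low end may lie on either side. The case a > c follows by reflection.\<close>

lemma segment_levels:
  fixes h :: "real \<Rightarrow> real"
  assumes h: "continuous_on (closed_segment a c) h" and p: "h a \<le> p" "p \<le> q" "q \<le> h c"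
  obtains a' c' where "closed_segment a' c' \<subseteq> closed_segment a c" "h a' = p" "h c' = q"
    "\<And>x. x \<in> closed_segment a' c' \<Longrightarrow> p \<le> h x \<and> h x \<le> q"
proof (cases "a \<le> c")
  case True
  then obtain a' c' where "a \<le> a'" "a' \<le> c'" "c' \<le> c" "h a' = p" "h c' = q" "\<forall>x\<in>{a'..c'}. p \<le> h x \<and> h x \<le> q"
    using segment_levels_aux[of a c h p q] h p by (auto simp: closed_segment_eq_real_ivl)
  then show ?thesis using that[of a' c'] True by (auto simp: closed_segment_eq_real_ivl)
next
  case False
  have "continuous_on {-a..-c} (\<lambda>x. h (- x))"
    by (rule continuous_on_compose2[OF h]) (use False in \<open>auto simp: closed_segment_eq_real_ivl intro!: continuous_intros\<close>)
  then obtain a' c' where 1: "-a \<le> a'" "a' \<le> c'" "c' \<le> -c" "h (-a') = p" "h (-c') = q"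
     "\<forall>x\<in>{a'..c'}. p \<le> h (-x) \<and> h (-x) \<le> q"
    using segment_levels_aux[of "-a" "-c" "\<lambda>x. h (-x)" p q] False p by auto
  have "p \<le> h x \<and> h x \<le> q" if "x \<in> closed_segment (-a') (-c')" for x
    using 1(6)[rule_format, of "-x"] that 1(2) by (auto simp: closed_segment_eq_real_ivl split: if_splits)
  with 1 show ?thesis using that[of "-a'" "-c'"] False
    by (auto simp: closed_segment_eq_real_ivl)
qed

context indefinite_weights
begin

lemma M_dist:
  assumes u: "continuous_on {A..B} u" "continuous_on {A..B} w" and i: "i \<in> {1..m}"
    and D: "\<And>t. t \<in> {A..B} \<Longrightarrow> \<bar>u t - w t\<bar> \<le> D"
  shows "\<bar>M i u - M i w\<bar> \<le> D"
proof -
  have I: "t \<in> {A..B}" if "t \<in> {\<sigma> i..\<tau> i}" for t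
    using that \<sigma>_bounds[of i] \<tau>_bounds[of i] i by auto
  have "M i u \<le> M i w + D"
    by (rule M_leI[OF u(1) i]) (use M_upper[OF u(2) i] D I in \<open>smt (verit)\<close>)
  moreover have "M i w \<le> M i u + D"
    by (rule M_leI[OF u(2) i]) (use M_upper[OF u(1) i] D I in \<open>smt (verit)\<close>)
  ultimately show ?thesis by linarith
qed

end

context shooting
begin

definition level_bound :: "nat \<Rightarrow> real"
  where "level_bound j = (if j = 0 then 0 else if j = 1 then r else if j = 2 then 1 else R)"

text \<open>Closed, so that membership survives uniform limits; \<open>bvp_level_open\<close> later
  rules out the thresholds that neighbouring classes share.\<close>

definition level_class :: "nat \<Rightarrow> real set"
  where "level_class j = {level_bound j..level_bound (Suc j)}"

lemma level_class_le: "x \<in> level_class j \<Longrightarrow> x \<le> R"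
  using r R by (auto simp: level_class_def level_bound_def split: if_splits)

text \<open>The high end of a shooting segment. At B the sign of \<open>v\<close> is recorded beside
  that of \<open>u\<close>, since the Neumann condition is about \<open>v\<close>.\<close>

lemma above_level:
  assumes s: "sol u v" and v0: "0 \<le> v A" and i: "i \<in> {1..m}" and \<kappa>: "\<kappa> = r \<or> \<kappa> = R"
    and Mi: "M i u = \<kappa>" and prev: "\<And>j. j \<in> {1..<i} \<Longrightarrow> M j u \<le> R"
  shows "i < m \<Longrightarrow> R < M (Suc i) u" "i = m \<Longrightarrow> 0 < u B" "i = m \<Longrightarrow> 0 < v B"
proof -
  note L = level[OF s v0 i \<kappa> Mi prev] and k = \<kappa>_bounds[OF \<kappa>] and uc = solves_continuous(1)[OF s]
  show "R < M (Suc i) u" if "i < m"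
    using growth_forward(1)[OF s _ \<tau>_less_\<sigma> \<kappa> L(1,2)] that i M_upper[OF uc, of "Suc i" "\<sigma> (Suc i)"]
      interval_I[of "Suc i"] by force
  assume im: "i = m"
  consider "\<tau> m < B" | "\<tau> m = B" using interval_J[of m] ends by force
  then have "0 < u B \<and> 0 < v B"
  proof cases
    case 1
    then show ?thesis using growth_forward(1,2)[OF s _ _ \<kappa> L(1,2)] im ends R by force
  next
    case 2
    \<comment> \<open>No proper negativity interval follows. A nonpositive slope at B is instead
      followed backwards over the preceding negativity interval, proper by \<open>not_whole\<close>
      or \<open>\<tau>_less_\<sigma>\<close>, to a value above R or a negative initial
      slope.\<close>
    have "0 < v B"
    proof (rule ccontr)
      assume "\<not> 0 < v B"
      then have L3: "\<kappa> / 2 \<le> u (\<sigma> i)" "v (\<sigma> i) \<le> e * \<kappa>" using L(3) 2 im by auto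
      obtain j where j: "m = Suc j" using m by (cases m) auto
      have "\<tau> j < \<sigma> (Suc j)"
        using not_whole \<tau>_less_\<sigma>[of j] j 2 ends by (cases j) auto
      note g = growth_backward[OF s _ this \<kappa>]
      show False
      proof (cases "j = 0")
        case True
        then show False using g(2) L3 im j ends v0 by auto
      next
        case False
        then have "u (\<tau> j) \<le> M j u" using M_upper[OF uc, of j "\<tau> j"] interval_I[of j] j by auto
        then show False using g(1) L3 im j False prev[of j] by auto
      qed
    qed
    then show ?thesis using L(1) k 2 im by auto
  qed
  then show "0 < u B" "0 < v B" by auto
qed

text \<open>The dead end of a shooting segment: level 0 by \<open>persistence\<close>, level 1 by
  \<open>middle\<close> and \<open>hit\<close>. The inequality is weak because the zero solution is
  also a dead end.\<close>

lemma M_le_0_persists: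
  assumes s: "sol u v" and u0: "0 \<le> u A" and i: "i \<in> {1..m}" and Mi: "M i u = 0 \<or> M i u = 1"
    and t: "t \<in> {\<tau> i..B}"
  shows "u t \<le> 0"
proof -
  note I = interval_I[OF i] and uc = solves_continuous(1)[OF s]
  from Mi show ?thesis
  proof
    assume "M i u = 0"
    then have "u (\<tau> i) \<le> 0" using M_upper[OF uc i, of "\<tau> i"] I by auto
    then show ?thesis using persistence[OF s u0, of "\<tau> i" t] I t by auto
  next
    assume "M i u = 1"
    from middle[OF s i this] obtain x where "x \<in> {\<sigma> i..\<tau> i}" "u x < 0" by blast
    then show ?thesis using hit(1)[OF s u0, of x t] I t by auto
  qed
qed

text \<open>With Neumann data \<open>u\<close> does not decrease up to \<sigma> 1, so C \<ge> R
  suffices. With Dirichlet data the initial slope C can lose at most l W F (B - A) before \<tau> 1,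
  and the second bound on \<open>C\<close> says that what remains lifts \<open>u\<close> to
  R.\<close>

lemma start_high:
  assumes s: "sol u v" and init: "(u A = C \<and> v A = 0) \<or> (u A = 0 \<and> v A = C)"
  shows "R \<le> M 1 u"
proof -
  have i: "(1::nat) \<in> {1..m}" using m by auto
  note I = interval_I[OF i] and uc = solves_continuous(1)[OF s] and J = interval_J[of 0, simplified]
  have v0: "v A \<le> v t" if "t \<in> {A..\<sigma> 1}" for t
    using v_mono[OF s, of 0 A t] that ends by auto
  from init show ?thesis
  proof
    assume a: "u A = C \<and> v A = 0"
    have "\<alpha>0 * 0 * (\<sigma> 1 - A) \<le> u (\<sigma> 1) - u A"
      by (rule solution_bounds(1)[OF s]) (use I v0 a in auto)
    then show ?thesis using a C M_upper[OF uc i, of "\<sigma> 1"] I by auto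
  next
    assume a: "u A = 0 \<and> v A = C"
    define c where "c = C - l * W * F * (B - A)"
    have X: "0 \<le> l * W * F * (B - A)" using l W_nonneg f_bounds[of 0] AB
      by (intro mult_nonneg_nonneg) auto
    have c: "0 \<le> c"
    proof (rule ccontr)
      assume "\<not> 0 \<le> c"
      then have "\<alpha>0 * d * c \<le> 0" using \<alpha>0 d by (intro mult_nonneg_nonpos) auto
      then show False using C(2) R by (auto simp: c_def)
    qed
    have vc: "c \<le> v t" if t: "t \<in> {A..\<tau> 1}" for t
    proof (cases "t \<le> \<sigma> 1")
      case True
      then show ?thesis using v0[of t] t a X by (auto simp: c_def)
    next
      case False
      then show ?thesis using v_drop(3)[OF s i, of "\<sigma> 1" t] v0[of "\<sigma> 1"] t a I by (auto simp: c_def)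
    qed
    have "\<alpha>0 * c * (\<tau> 1 - A) \<le> u (\<tau> 1) - u A"
      by (rule solution_bounds(1)[OF s]) (use I vc c in auto)
    moreover have "\<alpha>0 * c * d \<le> \<alpha>0 * c * (\<tau> 1 - A)"
      using wp_large[OF i] I d c \<alpha>0 by (intro mult_left_mono) auto
    ultimately show ?thesis using C(2) a M_upper[OF uc i, of "\<tau> 1"] I by (auto simp: c_def mult_ac)
  qed
qed

lemma shooting_segments:
  assumes U: "\<And>c. sol (U c) (V c)"
    and init: "\<And>c. (if neu then U c A = c \<and> V c A = 0 else U c A = 0 \<and> V c A = c)"
    and dist: "\<And>c c' t. t \<in> {A..B} \<Longrightarrow> \<bar>U c t - U c' t\<bar> \<le> D * \<bar>c - c'\<bar>"
    and k: "k \<le> m" and s: "\<And>i. i \<in> {1..m} \<Longrightarrow> s i \<le> (2::nat)"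
  shows "\<exists>a c. closed_segment a c \<subseteq> {0..C} \<and>
    (\<forall>x\<in>closed_segment a c. \<forall>i\<in>{1..k}. M i (U x) \<in> level_class (s i)) \<and>
    (\<forall>t\<in>{\<tau> k..B}. U a t \<le> 0) \<and>
    (if k < m then R \<le> M (Suc k) (U c) else 0 < U c B \<and> 0 < V c B)"
  using k
proof (induction k)
  case 0
  have "0 \<le> C" using C R by simp
  \<comment> \<open>Shooting parameter 0 gives the zero solution, the first dead end; parameter
    \<open>C\<close> is the first high end.\<close>
  moreover have "U 0 t = 0" if "t \<in> {A..B}" for t
    using solves_zero(1)[OF U \<alpha>_cont b_cont _ f_linear, of 0 A t] f_nonpos[of 0] init[of 0] that AB
    by (auto split: if_splits)
  moreover have "R \<le> M 1 (U C)"
    using start_high[OF U, of C] init[of C] by (auto split: if_splits)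
  ultimately show ?case
    using m ends by (intro exI[of _ 0] exI[of _ C]) (auto simp: closed_segment_eq_real_ivl)
next
  case (Suc k)
  then obtain a c where ac: "closed_segment a c \<subseteq> {0..C}"
    and cls: "\<And>x i. x \<in> closed_segment a c \<Longrightarrow> i \<in> {1..k} \<Longrightarrow> M i (U x) \<in> level_class (s i)"
    and low: "\<And>t. t \<in> {\<tau> k..B} \<Longrightarrow> U a t \<le> 0" and high: "R \<le> M (Suc k) (U c)"
    by auto
  have i: "Suc k \<in> {1..m}" using Suc.prems by auto
  note uc = solves_continuous(1)[OF U]
  define h where "h x = M (Suc k) (U x)" for x
  have "D-lipschitz_on UNIV h"
  proof (rule lipschitz_onI)
    show "dist (h x) (h y) \<le> D * dist x y" for x y
      unfolding h_def dist_real_def by (rule M_dist[OF uc uc i dist])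
    have "0 \<le> D * \<bar>1 - 0\<bar>" using dist[of A 1 0] AB by (meson abs_ge_zero atLeastAtMost_iff less_imp_le order_refl order_trans)
    then show "0 \<le> D" by simp
  qed
  then have hc: "continuous_on (closed_segment a c) h"
    by (meson continuous_on_subset lipschitz_on_continuous_on top_greatest)
  have ha: "h a \<le> 0" unfolding h_def
    using low interval_J[of k] interval_I[OF i] Suc.prems by (intro M_leI[OF uc i]) auto
  have pq: "h a \<le> level_bound j" "level_bound j \<le> level_bound (Suc j)" "level_bound (Suc j) \<le> h c" for j
    using ha high r R unfolding h_def level_bound_def by auto
  obtain a' c' where ac': "closed_segment a' c' \<subseteq> closed_segment a c"
    "h a' = level_bound (s (Suc k))" "h c' = level_bound (Suc (s (Suc k)))"
    and hx: "\<And>x. x \<in> closed_segment a' c' \<Longrightarrow> level_bound (s (Suc k)) \<le> h x \<and> h x \<le> level_bound (Suc (s (Suc k)))"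
    using segment_levels[OF hc pq] by blast
  have cls': "M i (U x) \<in> level_class (s i)" if "x \<in> closed_segment a' c'" "i \<in> {1..Suc k}" for x i
  proof (cases "i = Suc k")
    case True
    then show ?thesis using hx[OF that(1)] by (simp add: h_def level_class_def)
  next
    case False
    then show ?thesis using cls[of x i] that ac'(1) by auto
  qed
  have nn: "0 \<le> U x A" "0 \<le> V x A" if "x \<in> closed_segment a' c'" for x
    using that ac' ac init[of x] by (auto split: if_splits)
  have Lo: "\<forall>t\<in>{\<tau> (Suc k)..B}. U x t \<le> 0" if "x \<in> closed_segment a' c'" "h x = 0 \<or> h x = 1" for x
    using M_le_0_persists[OF U nn(1)[OF that(1)] i] that(2) unfolding h_def by auto
  have Hi: "if Suc k < m then R \<le> M (Suc (Suc k)) (U x) else 0 < U x B \<and> 0 < V x B"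
    if x: "x \<in> closed_segment a' c'" "h x = r \<or> h x = R" for x
  proof -
    have "M j (U x) \<le> R" if "j \<in> {1..<Suc k}" for j
      using cls'[OF x(1), of j] that by (auto dest: level_class_le)
    note a = above_level[OF U nn(2)[OF x(1)] i x(2) _ this, folded h_def]
    show ?thesis using a Suc.prems by (auto simp: h_def)
  qed
  have "s (Suc k) = 0 \<or> s (Suc k) = 1 \<or> s (Suc k) = 2" using s[OF i] by auto
  \<comment> \<open>Codes 0 and 2 keep dead and high end in place; code 1, rising from r to 1,
    exchanges them.\<close>
  then consider "h a' = 0 \<or> h a' = 1" "h c' = r \<or> h c' = R" | "h a' = r \<or> h a' = R" "h c' = 0 \<or> h c' = 1"
    using ac' by (auto simp: level_bound_def)
  then show ?case
  proof cases
    case 1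
    show ?thesis
      using 1 ac ac'(1) cls' Lo[of a'] Hi[of c'] by (intro exI[of _ a'] exI[of _ c'] conjI) auto
  next
    case 2
    show ?thesis
      using 2 ac ac'(1) cls' Lo[of c'] Hi[of a']
      by (intro exI[of _ c'] exI[of _ a'] conjI) (auto simp: closed_segment_commute)
  qed
qed

text \<open>Apart from the equation these are closed conditions, ready for a uniform limit. The
  bound \<open>C\<close> on the initial data supplies compactness, and \<open>0 \<le> u B\<close>
  excludes solutions that have become negative.\<close>

definition bvp :: "bool \<Rightarrow> (nat \<Rightarrow> nat) \<Rightarrow> (real \<Rightarrow> real) \<Rightarrow> (real \<Rightarrow> real) \<Rightarrow> bool"
  where "bvp neu s u v \<longleftrightarrow> sol u v \<and> u A \<in> {0..C} \<and> v A \<in> {0..C} \<and> 0 \<le> u B \<and>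
    (if neu then v A = 0 \<and> v B = 0 else u A = 0 \<and> u B = 0) \<and>
    (\<forall>i\<in>{1..m}. M i u \<in> level_class (s i))"

lemma bvp_exists:
  assumes f: "L-lipschitz_on UNIV f" and s: "\<And>i. i \<in> {1..m} \<Longrightarrow> s i \<le> (2::nat)"
  shows "\<exists>u v. bvp neu s u v"
proof -
  have "\<exists>u v. sol u v \<and> (if neu then u A = c \<and> v A = 0 else u A = 0 \<and> v A = c)" for c
    using solves_exists[OF less_imp_le[OF AB] \<alpha>_cont b_cont f, of "if neu then c else 0" "if neu then 0 else c"]
    by (metis (full_types))
  then obtain U V where U: "\<And>c. sol (U c) (V c)"
    and init: "\<And>c. (if neu then U c A = c \<and> V c A = 0 else U c A = 0 \<and> V c A = c)"
    by metis
  obtain D where D: "D > 0" and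
    D': "\<And>u1 v1 u2 v2 t. \<lbrakk>sol u1 v1; sol u2 v2; t \<in> {A..B}\<rbrakk>
     \<Longrightarrow> \<bar>u1 t - u2 t\<bar> \<le> D * (\<bar>u1 A - u2 A\<bar> + \<bar>v1 A - v2 A\<bar>) \<and>
         \<bar>v1 t - v2 t\<bar> \<le> D * (\<bar>u1 A - u2 A\<bar> + \<bar>v1 A - v2 A\<bar>)"
    using solves_dist[OF \<alpha>_cont b_cont f] by blast
  have dist: "\<bar>U c t - U c' t\<bar> \<le> D * \<bar>c - c'\<bar>" "\<bar>V c t - V c' t\<bar> \<le> D * \<bar>c - c'\<bar>" if "t \<in> {A..B}" for c c' t
    using D'[OF U[of c] U[of c'] that] init[of c] init[of c'] by (auto split: if_splits)
  obtain a c where ac: "closed_segment a c \<subseteq> {0..C}"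
    and cls: "\<And>x i. x \<in> closed_segment a c \<Longrightarrow> i \<in> {1..m} \<Longrightarrow> M i (U x) \<in> level_class (s i)"
    and low: "\<And>t. t \<in> {\<tau> m..B} \<Longrightarrow> U a t \<le> 0" and high: "0 < U c B" "0 < V c B"
    using shooting_segments[where k = m and s = s, OF U init dist(1) order_refl s] by fastforce
  have Bm: "B \<in> {\<tau> m..B}" using \<tau>_bounds[of m] by auto
  have BAB: "B \<in> {A..B}" using AB by auto
  have UVc: "continuous_on (closed_segment a c) (\<lambda>x. U x B)" "continuous_on (closed_segment a c) (\<lambda>x. V x B)"
    using dist[OF BAB] D
    by (auto intro!: lipschitz_on_continuous_on[of D] lipschitz_onI simp: dist_real_def)
  \<comment> \<open>At the dead end only the sign of \<open>u\<close> is known, at the high end both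
    signs; taking the minimum turns the Neumann condition into a single intermediate value
    problem.\<close>
  define h where "h x = (if neu then min (U x B) (V x B) else U x B)" for x
  have hcont: "continuous_on (closed_segment a c) h"
    unfolding h_def using UVc by (cases neu) (auto intro!: continuous_intros)
  have ha: "h a \<le> 0" using low[OF Bm] by (simp add: h_def min_le_iff_disj)
  have hc: "0 \<le> h c" using high by (simp add: h_def less_imp_le)
  obtain x c' where "closed_segment x c' \<subseteq> closed_segment a c" and hx: "h x = 0"
    using segment_levels[OF hcont ha order_refl hc] by metis
  then have x: "x \<in> closed_segment a c" "h x = 0" by auto
  have xC: "x \<in> {0..C}" using x ac by auto
  then have A0: "U x A \<in> {0..C}" "V x A \<in> {0..C}" using init[of x] C R by (auto split: if_splits)
  have "0 \<le> U x B \<and> (if neu then V x B = 0 else U x B = 0)"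
  proof (cases neu)
    case True
    then have mn: "min (U x B) (V x B) = 0" using x by (simp add: h_def)
    \<comment> \<open>The minimum could also vanish with u B = 0 and v B > 0. Then \<open>u\<close>
      is negative just before B, and \<open>hit\<close> makes it negative at B as well.\<close>
    have "V x B = 0"
    proof (rule ccontr)
      assume "V x B \<noteq> 0"
      with mn have UB: "U x B = 0" "0 < V x B" by (auto simp: min_def split: if_splits)
      have "(U x has_real_derivative \<alpha> B * V x B) (at B within {A..B})"
        using U[of x] BAB by (auto simp: solves_def)
      from has_real_derivative_pos_inc_left[OF this] obtain \<delta> where
        \<delta>: "\<delta> > 0" "\<And>k. 0 < k \<Longrightarrow> B - k \<in> {A..B} \<Longrightarrow> k < \<delta> \<Longrightarrow> U x (B - k) < U x B"
        using UB \<alpha>_bounds[OF BAB] \<alpha>0 by auto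
      define k where "k = min (\<delta> / 2) (B - A)"
      have k: "0 < k" "k < \<delta>" "k \<le> B - A" using \<delta>(1) AB by (auto simp: k_def)
      then have "U x (B - k) < 0" using \<delta>(2)[of k] UB by auto
      from hit(1)[OF U _ this, of B] show False
        using A0 UB k by auto
    qed
    then show ?thesis using mn True by (auto simp: min_def split: if_splits)
  next
    case False
    then show ?thesis using x by (simp add: h_def)
  qed
  then have "bvp neu s (U x) (V x)"
    unfolding bvp_def using U A0 init[of x] cls[OF x(1)] by auto
  then show ?thesis by blast
qed

end

section \<open>Passing to continuous nonlinearities\<close>

text \<open>Inf-convolution with slope F/\<delta>: beyond distance \<delta> the penalty is at least
  F, and at smaller distance \<open>f\<close> varies by less than \<epsilon>. Staying between 0 and
  \<open>f\<close> preserves the zeros and all upper bounds of \<open>f\<close>.\<close>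

lemma lipschitz_approximation:
  fixes f :: "real \<Rightarrow> real"
  assumes uc: "uniformly_continuous_on UNIV f" and f: "\<And>s. 0 \<le> f s \<and> f s \<le> F" and \<epsilon>: "0 < \<epsilon>"
  obtains h L where "L-lipschitz_on UNIV h" "\<And>s. 0 \<le> h s \<and> h s \<le> f s \<and> f s \<le> h s + \<epsilon>"
proof -
  obtain \<delta> where \<delta>: "0 < \<delta>" "\<And>s t. \<bar>s - t\<bar> < \<delta> \<Longrightarrow> \<bar>f s - f t\<bar> < \<epsilon>"
    using uc \<epsilon> unfolding uniformly_continuous_on_def dist_real_def by (metis UNIV_I)
  define L where "L = F / \<delta>"
  have "0 \<le> F" using f[of 0] by linarith
  then have L: "0 \<le> L" using \<delta> by (simp add: L_def)
  define h where "h s = (INF t. f t + L * \<bar>s - t\<bar>)" for s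
  have nn: "0 \<le> f t + L * \<bar>s - t\<bar>" for s t using f[of t] L by simp
  have bdd: "bdd_below (range (\<lambda>t. f t + L * \<bar>s - t\<bar>))" for s
    using nn by (auto intro: bdd_belowI2[where m = 0])
  have h_le: "h s \<le> f t + L * \<bar>s - t\<bar>" for s t
    unfolding h_def by (rule cINF_lower[OF bdd]) simp
  have le_h: "c \<le> h s" if "\<And>t. c \<le> f t + L * \<bar>s - t\<bar>" for c s
    unfolding h_def by (rule cINF_greatest) (use that in auto)
  have h_lip: "h s - h s' \<le> L * \<bar>s - s'\<bar>" for s s'
  proof -
    have "h s - L * \<bar>s - s'\<bar> \<le> h s'"
    proof (rule le_h)
      fix t
      have "L * \<bar>s - t\<bar> \<le> L * (\<bar>s - s'\<bar> + \<bar>s' - t\<bar>)" using L by (intro mult_left_mono) auto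
      with h_le[of s t] show "h s - L * \<bar>s - s'\<bar> \<le> f t + L * \<bar>s' - t\<bar>" by (simp add: algebra_simps)
    qed
    then show ?thesis by simp
  qed
  show ?thesis
  proof (rule that[of L h])
    show "L-lipschitz_on UNIV h"
    proof (rule lipschitz_onI[OF _ L])
      show "dist (h s) (h s') \<le> L * dist s s'" for s s'
        using h_lip[of s s'] h_lip[of s' s] by (simp add: dist_real_def abs_le_iff abs_minus_commute)
    qed
    fix s
    have "f s - \<epsilon> \<le> f t + L * \<bar>s - t\<bar>" for t
    proof (cases "\<bar>s - t\<bar> < \<delta>")
      case True
      then show ?thesis using \<delta>(2)[OF True] mult_nonneg_nonneg[OF L, of "\<bar>s - t\<bar>"] by linarith
    next
      case False
      then have "L * \<delta> \<le> L * \<bar>s - t\<bar>" using L by (intro mult_left_mono) auto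
      then show ?thesis using f[of s] f[of t] \<delta> \<epsilon> by (simp add: L_def)
    qed
    then have "f s - \<epsilon> \<le> h s" by (rule le_h)
    moreover have "0 \<le> h s" by (rule le_h) (rule nn)
    ultimately show "0 \<le> h s \<and> h s \<le> f s \<and> f s \<le> h s + \<epsilon>" using h_le[of s s] by simp
  qed
qed

lemma uniform_limit_has_real_derivative:
  fixes h :: "nat \<Rightarrow> real \<Rightarrow> real"
  assumes d: "\<And>n x. x \<in> {A..B} \<Longrightarrow> (h n has_real_derivative h' n x) (at x within {A..B})"
    and u': "uniform_limit {A..B} h' k' sequentially"
    and lim: "\<And>x. x \<in> {A..B} \<Longrightarrow> (\<lambda>n. h n x) \<longlonglongrightarrow> k x" and x: "x \<in> {A..B}"
  shows "(k has_real_derivative k' x) (at x within {A..B})"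
proof -
  have "\<exists>g. \<forall>x\<in>{A..B}. (\<lambda>n. h n x) \<longlonglongrightarrow> g x \<and> (g has_derivative (\<lambda>y. k' x * y)) (at x within {A..B})"
  proof (rule has_derivative_sequence[where f' = "\<lambda>n x y. h' n x * y"])
    show "(h n has_derivative (\<lambda>y. h' n x * y)) (at x within {A..B})" if "x \<in> {A..B}" for n x
      using d[OF that] by (simp add: has_field_derivative_def)
    show "\<forall>\<^sub>F n in sequentially. \<forall>x\<in>{A..B}. \<forall>y. norm (h' n x * y - k' x * y) \<le> e * norm y"
      if "0 < e" for e
      using uniform_limitD[OF u' that]
    proof eventually_elim
      case (elim n)
      show ?case
      proof (intro ballI allI)
        fix x y assume "x \<in> {A..B}"
        then have "\<bar>h' n x - k' x\<bar> \<le> e" using elim by (auto simp: dist_real_def intro: less_imp_le)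
        then have "\<bar>h' n x - k' x\<bar> * \<bar>y\<bar> \<le> e * \<bar>y\<bar>" by (rule mult_right_mono) auto
        then show "norm (h' n x * y - k' x * y) \<le> e * norm y"
          by (simp flip: left_diff_distrib abs_mult)
      qed
    qed
  qed (use lim x in auto)
  then obtain g where g: "\<And>x. x \<in> {A..B} \<Longrightarrow> (\<lambda>n. h n x) \<longlonglongrightarrow> g x"
    "\<And>x. x \<in> {A..B} \<Longrightarrow> (g has_derivative (\<lambda>y. k' x * y)) (at x within {A..B})" by blast
  have "g y = k y" if "y \<in> {A..B}" for y using g(1) lim that LIMSEQ_unique by blast
  then have "(k has_derivative (\<lambda>y. k' x * y)) (at x within {A..B})"
    using has_derivative_transform[OF x _ g(2)[OF x], of k] by simp
  then show ?thesis by (simp add: has_field_derivative_def)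
qed

context shooting
begin

text \<open>Every \<open>fn n\<close> satisfies the locale with the same constants, so the solutions
  are bounded and Lipschitz in time uniformly in n, although the Lipschitz constants of
  \<open>fn n\<close> may blow up.\<close>

lemma bvp_limit:
  assumes fn: "\<And>n. shooting A B \<alpha>0 \<alpha>1 d W \<alpha> wp wm \<sigma> \<tau> m l \<mu> r R e \<gamma> \<gamma>1 F K C (fn n)"
    and lip: "\<And>n. \<exists>L. L-lipschitz_on UNIV (fn n)"
    and close: "\<And>n s. \<bar>fn n s - f s\<bar> \<le> 1 / real (Suc n)"
    and uc: "uniformly_continuous_on UNIV f"
    and s: "\<And>i. i \<in> {1..m} \<Longrightarrow> s i \<le> (2::nat)"
  shows "\<exists>u v. bvp neu s u v"
proof -
  interpret fn: shooting A B \<alpha>0 \<alpha>1 d W \<alpha> wp wm \<sigma> \<tau> m l \<mu> r R e \<gamma> \<gamma>1 F K C "fn n" for n by (rule fn)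
  have "\<exists>u v. fn.bvp n neu s u v" for n
  proof -
    obtain L where "L-lipschitz_on UNIV (fn n)" using lip by blast
    from fn.bvp_exists[where s = s, OF this s] show ?thesis by blast
  qed
  then obtain un vn where bvp: "\<And>n. fn.bvp n neu s (un n) (vn n)" by metis
  have sl: "solves A B \<alpha> b (fn n) (un n) (vn n)" for n
    using bvp[of n] by (simp add: fn.bvp_def)
  have init: "un n A \<in> {0..C}" "vn n A \<in> {0..C}" for n
    using bvp[of n] by (auto simp: fn.bvp_def)
  obtain b1 where b1: "\<And>t. t \<in> {A..B} \<Longrightarrow> \<bar>b t\<bar> \<le> b1"
    using continuous_on_interval_bounded[OF b_cont] by blast
  have F0: "0 \<le> F" using f_bounds[of 0] by linarith
  have b10: "0 \<le> b1" using b1[of A] AB by (metis abs_ge_zero atLeastAtMost_iff less_imp_le order_refl order_trans)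
  have vlip: "\<bar>vn n t - vn n x\<bar> \<le> b1 * F * \<bar>t - x\<bar>" if tx: "t \<in> {A..B}" "x \<in> {A..B}" for n t x
  proof -
    have *: "\<bar>vn n t - vn n x\<bar> \<le> b1 * F * \<bar>t - x\<bar>" if xt: "A \<le> x" "x < t" "t \<le> B" for t x
    proof -
      obtain \<xi> where \<xi>: "\<xi> \<in> {x<..<t}" "vn n x - vn n t = (t - x) * (b \<xi> * fn n (un n \<xi>))"
        using solves_mvt(2)[OF sl xt] by blast
      have "\<bar>vn n t - vn n x\<bar> = \<bar>t - x\<bar> * (\<bar>b \<xi>\<bar> * \<bar>fn n (un n \<xi>)\<bar>)"
        using \<xi>(2) by (metis abs_minus_commute abs_mult)
      also have "\<dots> \<le> \<bar>t - x\<bar> * (b1 * F)"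
        using fn.f_bounds[of n "un n \<xi>"] b1[of \<xi>] \<xi>(1) that b10
        by (intro mult_left_mono mult_mono) auto
      finally show ?thesis by (simp add: mult_ac)
    qed
    show ?thesis using *[of x t] *[of t x] tx
      by (cases x t rule: linorder_cases) (auto simp: abs_minus_commute)
  qed
  define Vb where "Vb = C + b1 * F * (B - A)"
  have vb: "\<bar>vn n t\<bar> \<le> Vb" if t: "t \<in> {A..B}" for n t
  proof -
    have "b1 * F * \<bar>t - A\<bar> \<le> b1 * F * (B - A)" using b10 F0 t by (intro mult_left_mono) auto
    then show ?thesis using vlip[OF t, of A n] init(2)[of n] AB unfolding Vb_def by auto
  qed
  have Vb0: "0 \<le> Vb" using vb[of A] AB by (metis abs_ge_zero atLeastAtMost_iff less_imp_le order_refl order_trans)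
  have ulip: "\<bar>un n t - un n x\<bar> \<le> \<alpha>1 * Vb * \<bar>t - x\<bar>" if tx: "t \<in> {A..B}" "x \<in> {A..B}" for n t x
  proof -
    have *: "\<bar>un n t - un n x\<bar> \<le> \<alpha>1 * Vb * \<bar>t - x\<bar>" if xt: "A \<le> x" "x < t" "t \<le> B" for t x
    proof -
      obtain \<xi> where \<xi>: "\<xi> \<in> {x<..<t}" "un n t - un n x = (t - x) * (\<alpha> \<xi> * vn n \<xi>)"
        using solves_mvt(1)[OF sl xt] by blast
      have "\<bar>un n t - un n x\<bar> = \<bar>t - x\<bar> * (\<bar>\<alpha> \<xi>\<bar> * \<bar>vn n \<xi>\<bar>)"
        using \<xi>(2) by (metis abs_mult)
      also have "\<dots> \<le> \<bar>t - x\<bar> * (\<alpha>1 * Vb)"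
        using vb[of \<xi> n] \<alpha>_bounds[of \<xi>] \<xi>(1) that \<alpha>0 \<alpha>1
        by (intro mult_left_mono mult_mono) auto
      finally show ?thesis by (simp add: mult_ac)
    qed
    show ?thesis using *[of x t] *[of t x] tx
      by (cases x t rule: linorder_cases) (auto simp: abs_minus_commute)
  qed
  define Ub where "Ub = C + \<alpha>1 * Vb * (B - A)"
  have ub: "\<bar>un n t\<bar> \<le> Ub" if t: "t \<in> {A..B}" for n t
  proof -
    have "\<alpha>1 * Vb * \<bar>t - A\<bar> \<le> \<alpha>1 * Vb * (B - A)" using \<alpha>1 Vb0 t by (intro mult_left_mono) auto
    then show ?thesis using ulip[OF t, of A n] init(1)[of n] AB unfolding Ub_def by auto
  qed
  \<comment> \<open>Pairing both components yields one subsequence for which \<open>u\<close> and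
    \<open>v\<close> converge together.\<close>
  define zn where "zn n t = (un n t, vn n t)" for n t
  have zlip: "norm (zn n x - zn n y) \<le> (\<alpha>1 * Vb + b1 * F) * \<bar>x - y\<bar>" if "x \<in> {A..B}" "y \<in> {A..B}" for n x y
  proof -
    have "norm (zn n x - zn n y) \<le> \<bar>un n x - un n y\<bar> + \<bar>vn n x - vn n y\<bar>"
      unfolding zn_def using norm_Pair_le[of "un n x - un n y" "vn n x - vn n y"] by simp
    then show ?thesis using ulip[OF that, of n] vlip[OF that, of n] by (simp add: algebra_simps)
  qed
  define Z where "Z = \<alpha>1 * Vb + b1 * F + 1"
  have Z: "0 < Z" unfolding Z_def using \<alpha>1 Vb0 b10 F0 by (intro add_nonneg_pos add_nonneg_nonneg mult_nonneg_nonneg) auto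
  obtain z k where z: "strict_mono (k :: nat \<Rightarrow> nat)"
    "\<And>e. 0 < e \<Longrightarrow> \<exists>N. \<forall>n x. n \<ge> N \<and> x \<in> {A..B} \<longrightarrow> norm (zn (k n) x - z x) < e"
  proof (rule Arzela_Ascoli[of "{A..B}" zn "Ub + Vb"])
    show "compact {A..B}" by simp
    show "norm (zn n x) \<le> Ub + Vb" if "x \<in> {A..B}" for n x
      unfolding zn_def using norm_Pair_le[of "un n x" "vn n x"] ub[OF that, of n] vb[OF that, of n] by simp
    show "\<exists>\<delta>. 0 < \<delta> \<and> (\<forall>n y. y \<in> {A..B} \<and> norm (x - y) < \<delta> \<longrightarrow> norm (zn n x - zn n y) < e)"
      if "x \<in> {A..B}" "0 < e" for x e
    proof (intro exI[of _ "e / Z"] conjI allI impI)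
      show "0 < e / Z" using Z that by simp
      fix n y assume y: "y \<in> {A..B} \<and> norm (x - y) < e / Z"
      have "norm (zn n x - zn n y) \<le> (\<alpha>1 * Vb + b1 * F) * \<bar>x - y\<bar>" using zlip that y by blast
      also have "\<dots> \<le> Z * \<bar>x - y\<bar>" unfolding Z_def by (intro mult_right_mono) auto
      also have "\<dots> < Z * (e / Z)" using y Z by (intro mult_strict_left_mono) auto
      finally show "norm (zn n x - zn n y) < e" using Z by simp
    qed
  qed blast
  define u v where "u t = fst (z t)" and "v t = snd (z t)" for t
  have conv: "\<exists>N. \<forall>n x. n \<ge> N \<and> x \<in> {A..B} \<longrightarrow> \<bar>un (k n) x - u x\<bar> < e \<and> \<bar>vn (k n) x - v x\<bar> < e"
    if e: "0 < e" for e
  proof -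
    obtain N where N: "\<And>n x. n \<ge> N \<Longrightarrow> x \<in> {A..B} \<Longrightarrow> norm (zn (k n) x - z x) < e" using z(2)[OF e] by blast
    have "\<bar>un (k n) x - u x\<bar> \<le> norm (zn (k n) x - z x) \<and> \<bar>vn (k n) x - v x\<bar> \<le> norm (zn (k n) x - z x)" for n x
      using norm_fst_le[of "fst (zn (k n) x - z x)" "snd (zn (k n) x - z x)"]
        norm_snd_le[of "snd (zn (k n) x - z x)" "fst (zn (k n) x - z x)"]
      unfolding prod.collapse by (simp add: zn_def u_def v_def)
    then show ?thesis using N by (meson le_less_trans)
  qed
  have uu: "uniform_limit {A..B} (\<lambda>n. un (k n)) u sequentially"
    and vv: "uniform_limit {A..B} (\<lambda>n. vn (k n)) v sequentially"
    unfolding uniform_limit_sequentially_iff dist_real_def using conv by blast+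
  have lim: "(\<lambda>n. un (k n) x) \<longlonglongrightarrow> u x" "(\<lambda>n. vn (k n) x) \<longlonglongrightarrow> v x" if "x \<in> {A..B}" for x
    using tendsto_uniform_limitI[OF uu that] tendsto_uniform_limitI[OF vv that] by auto
  have du: "uniform_limit {A..B} (\<lambda>n x. \<alpha> x * vn (k n) x) (\<lambda>x. \<alpha> x * v x) sequentially"
    unfolding uniform_limit_sequentially_iff dist_real_def
  proof (intro allI impI)
    fix e :: real assume e: "e > 0"
    then have "0 < e / \<alpha>1" using \<alpha>1 by simp
    from conv[OF this] obtain N where N: "\<And>n x. n \<ge> N \<Longrightarrow> x \<in> {A..B} \<Longrightarrow> \<bar>vn (k n) x - v x\<bar> < e / \<alpha>1" by blast
    have "\<bar>\<alpha> x * vn (k n) x - \<alpha> x * v x\<bar> < e" if "n \<ge> N" "x \<in> {A..B}" for n x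
    proof -
      have "\<bar>\<alpha> x * vn (k n) x - \<alpha> x * v x\<bar> = \<bar>\<alpha> x\<bar> * \<bar>vn (k n) x - v x\<bar>"
        by (simp flip: abs_mult right_diff_distrib)
      also have "\<dots> \<le> \<alpha>1 * \<bar>vn (k n) x - v x\<bar>"
        using \<alpha>_bounds[OF that(2)] \<alpha>0 by (intro mult_right_mono) auto
      also have "\<dots> < \<alpha>1 * (e / \<alpha>1)" using N[OF that] \<alpha>1 by (intro mult_strict_left_mono) auto
      finally show ?thesis using \<alpha>1 by simp
    qed
    then show "\<exists>N. \<forall>n\<ge>N. \<forall>x\<in>{A..B}. \<bar>\<alpha> x * vn (k n) x - \<alpha> x * v x\<bar> < e" by blast
  qed
  have dv: "uniform_limit {A..B} (\<lambda>n x. - (b x * fn (k n) (un (k n) x))) (\<lambda>x. - (b x * f (u x))) sequentially"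
    unfolding uniform_limit_sequentially_iff dist_real_def
  proof (intro allI impI)
    fix e :: real assume e: "e > 0"
    define e' where "e' = e / (2 * (b1 + 1))"
    have e': "0 < e'" using e b10 by (simp add: e'_def)
    obtain \<delta> where \<delta>: "0 < \<delta>" "\<And>s t. \<bar>s - t\<bar> < \<delta> \<Longrightarrow> \<bar>f s - f t\<bar> < e'"
      using uc e' unfolding uniformly_continuous_on_def dist_real_def by (metis UNIV_I)
    obtain N where N: "\<And>n x. n \<ge> N \<Longrightarrow> x \<in> {A..B} \<Longrightarrow> \<bar>un (k n) x - u x\<bar> < \<delta>" using conv[OF \<delta>(1)] by blast
    obtain N' where N': "1 / real (Suc N') < e'" using reals_Archimedean[OF e'] by (auto simp: inverse_eq_divide)
    have "\<bar>- (b x * fn (k n) (un (k n) x)) - - (b x * f (u x))\<bar> < e" if n: "n \<ge> max N N'" and x: "x \<in> {A..B}" for n x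
    proof -
      have "N' \<le> k n" using n seq_suble[OF z(1), of n] by linarith
      then have "1 / real (Suc (k n)) \<le> 1 / real (Suc N')" by (simp add: frac_le)
      then have "\<bar>fn (k n) (un (k n) x) - f (un (k n) x)\<bar> < e'" using close[of "k n" "un (k n) x"] N' by linarith
      moreover have "\<bar>f (un (k n) x) - f (u x)\<bar> < e'" using \<delta>(2) N n x by simp
      ultimately have *: "\<bar>f (u x) - fn (k n) (un (k n) x)\<bar> \<le> 2 * e'" by linarith
      have "\<bar>- (b x * fn (k n) (un (k n) x)) - - (b x * f (u x))\<bar> = \<bar>b x\<bar> * \<bar>f (u x) - fn (k n) (un (k n) x)\<bar>"
        by (simp flip: abs_mult add: right_diff_distrib)
      also have "\<dots> \<le> b1 * (2 * e')" using b1[OF x] * b10 by (intro mult_mono) auto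
      also have "\<dots> < (b1 + 1) * (2 * e')" using e' by (intro mult_strict_right_mono) auto
      also have "\<dots> = e" using b10 by (auto simp: e'_def field_simps)
      finally show ?thesis .
    qed
    then show "\<exists>N. \<forall>n\<ge>N. \<forall>x\<in>{A..B}. \<bar>- (b x * fn (k n) (un (k n) x)) - - (b x * f (u x))\<bar> < e" by blast
  qed
  have sol: "sol u v"
    unfolding solves_def
  proof (intro ballI conjI)
    fix t assume t: "t \<in> {A..B}"
    show "(u has_real_derivative \<alpha> t * v t) (at t within {A..B})"
      by (rule uniform_limit_has_real_derivative[OF _ du lim(1) t])
         (use sl in \<open>auto simp: solves_def\<close>)
    show "(v has_real_derivative - (b t * f (u t))) (at t within {A..B})"
      by (rule uniform_limit_has_real_derivative[OF _ dv lim(2) t])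
         (use sl in \<open>auto simp: solves_def\<close>)
  qed
  have AA: "A \<in> {A..B}" "B \<in> {A..B}" using AB by auto
  have Mi: "M i u \<in> level_class (s i)" if i: "i \<in> {1..m}" for i
  proof -
    have "(\<lambda>n. M i (un (k n))) \<longlonglongrightarrow> M i u"
    proof (rule LIMSEQ_I)
      fix e :: real assume "0 < e"
      then have "0 < e / 2" by simp
      from conv[OF this] obtain N where N: "\<And>n x. n \<ge> N \<Longrightarrow> x \<in> {A..B} \<Longrightarrow> \<bar>un (k n) x - u x\<bar> < e / 2" by blast
      have "\<bar>M i (un (k n)) - M i u\<bar> \<le> e / 2" if "n \<ge> N" for n
        by (rule M_dist[OF solves_continuous(1)[OF sl] solves_continuous(1)[OF sol] i])
           (use N[OF that] in \<open>auto intro: less_imp_le\<close>)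
      then show "\<exists>N. \<forall>n\<ge>N. norm (M i (un (k n)) - M i u) < e"
        using \<open>0 < e\<close> by (intro exI[of _ N]) (force simp: real_norm_def)
    qed
    moreover have "M i (un (k n)) \<in> level_class (s i)" for n
      using bvp[of "k n"] i by (simp add: fn.bvp_def)
    moreover have "closed (level_class (s i))" by (simp add: level_class_def)
    ultimately show ?thesis by (metis closed_sequentially)
  qed
  have cl: "u x \<in> S" if "x \<in> {A..B}" "closed S" "\<And>n. un (k n) x \<in> S" for x S
    using closed_sequentially[OF that(2) that(3) lim(1)[OF that(1)]] .
  have cl': "v x \<in> S" if "x \<in> {A..B}" "closed S" "\<And>n. vn (k n) x \<in> S" for x S
    using closed_sequentially[OF that(2) that(3) lim(2)[OF that(1)]] .
  have "u A \<in> {0..C}" "v A \<in> {0..C}" using cl[OF AA(1), of "{0..C}"] cl'[OF AA(1), of "{0..C}"] init by auto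
  moreover have "u B \<in> {0..}" using bvp by (intro cl[OF AA(2)]) (auto simp: fn.bvp_def)
  moreover have "if neu then v A = 0 \<and> v B = 0 else u A = 0 \<and> u B = 0"
  proof (cases neu)
    case True
    then have "v A \<in> {0}" "v B \<in> {0}"
      using bvp by (intro cl'[OF AA(1)] cl'[OF AA(2)]; auto simp: fn.bvp_def)+
    then show ?thesis using True by simp
  next
    case False
    then have "u A \<in> {0}" "u B \<in> {0}"
      using bvp by (intro cl[OF AA(1)] cl[OF AA(2)]; auto simp: fn.bvp_def)+
    then show ?thesis using False by simp
  qed
  ultimately have "bvp neu s u v" unfolding bvp_def using sol Mi by auto
  then show ?thesis by blast
qed

text \<open>Level 1 would make \<open>u\<close> negative from some point up to B. Levels r and R
  would push the next maximum above R or, on the last interval, make both u B and v B positive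
  against the boundary condition.\<close>

lemma bvp_level_open:
  assumes bvp: "bvp neu s u v" and i: "i \<in> {1..m}"
  shows "M i u \<noteq> r" "M i u \<noteq> 1" "M i u \<noteq> R"
proof -
  have s: "sol u v" and A: "0 \<le> u A" "0 \<le> v A" and Bn: "0 \<le> u B" and bc: "v B = 0 \<or> u B = 0"
    and le: "\<And>j. j \<in> {1..m} \<Longrightarrow> M j u \<le> R"
    using bvp by (auto simp: bvp_def split: if_splits dest: level_class_le)
  show "M i u \<noteq> 1"
  proof
    assume "M i u = 1"
    from middle[OF s i this] obtain x where "x \<in> {\<sigma> i..\<tau> i}" "u x < 0" by blast
    then show False using hit(1)[OF s A(1), of x B] interval_I[OF i] Bn by auto
  qed
  have "\<not> (M i u = \<kappa>)" if \<kappa>: "\<kappa> = r \<or> \<kappa> = R" for \<kappa>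
  proof
    assume Mi: "M i u = \<kappa>"
    have "M j u \<le> R" if "j \<in> {1..<i}" for j using le that i by auto
    note a = above_level[OF s A(2) i \<kappa> Mi this]
    show False using a le[of "Suc i"] bc i by (cases "i = m") force+
  qed
  then show "M i u \<noteq> r" "M i u \<noteq> R" by auto
qed

text \<open>A nonzero code forces a maximum of at least r, so the solution is not zero and
  \<open>positive_inside\<close> applies. At a Neumann end u = 0 together with v = 0 would again
  give the zero solution.\<close>

lemma bvp_positive:
  assumes bvp: "bvp neu s u v" and i: "i \<in> {1..m}" "s i \<noteq> 0"
  shows "\<And>t. t \<in> {A<..<B} \<Longrightarrow> 0 < u t" "neu \<Longrightarrow> 0 < u A" "neu \<Longrightarrow> 0 < u B"
proof -
  have s: "sol u v" and A: "0 \<le> u A" "0 \<le> v A" and Bn: "0 \<le> u B" and bc: "neu \<Longrightarrow> v A = 0 \<and> v B = 0"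
    using bvp by (auto simp: bvp_def split: if_splits)
  note uc = solves_continuous(1)[OF s]
  have "r \<le> level_bound (s i)" using i(2) r R by (auto simp: level_bound_def)
  moreover have "M i u \<in> level_class (s i)" using bvp i(1) by (simp add: bvp_def)
  ultimately have "r \<le> M i u" by (simp add: level_class_def)
  then obtain t where "t \<in> {\<sigma> i..\<tau> i}" "r \<le> u t" using M_attained[OF uc i(1)] by metis
  then have nt: "\<exists>t\<in>{A..B}. u t \<noteq> 0" using r interval_I[OF i(1)] by (intro bexI[of _ t]) auto
  show "0 < u t" if "t \<in> {A<..<B}" for t
    using positive_inside[OF s A(1) Bn _ _ nt] that by auto
  have z: False if "x \<in> {A..B}" "u x = 0" "v x = 0" for x
    using solves_zero(1)[OF s \<alpha>_cont b_cont _ f_linear that(2,3,1)] f_nonpos[of 0] nt by auto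
  show "0 < u A" "0 < u B" if neu using z[of A] z[of B] A Bn bc[OF that] AB by force+
qed

text \<open>This removes the clamp on g. On a negativity interval \<open>v\<close> is nondecreasing,
  so \<open>u\<close> is largest at an end, which belongs to a positivity interval; at A the sign of
  the initial slope and at B the boundary condition take the place of the missing neighbour.\<close>

lemma bvp_le_R:
  assumes bvp: "bvp neu s u v" and t: "t \<in> {A..B}"
  shows "u t \<le> R"
proof -
  have s: "sol u v" and A: "0 \<le> u A" "0 \<le> v A" and bc: "v B = 0 \<or> u B = 0"
    and le: "\<And>j. j \<in> {1..m} \<Longrightarrow> M j u \<le> R"
    using bvp by (auto simp: bvp_def split: if_splits dest: level_class_le)
  note uc = solves_continuous(1)[OF s]
  have I: "u t \<le> R" if "i \<in> {1..m}" "t \<in> {\<sigma> i..\<tau> i}" for i t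
    using M_upper[OF uc that] le[OF that(1)] by simp
  have J: "u t \<le> R" if i: "i \<le> m" and t: "t \<in> {\<tau> i..\<sigma> (Suc i)}" for i t
  proof (cases "0 \<le> v t")
    case True
    have "\<alpha>0 * 0 * (\<sigma> (Suc i) - t) \<le> u (\<sigma> (Suc i)) - u t"
      by (rule solution_bounds(1)[OF s]) (use interval_J[OF i] t True v_mono[OF s i, of t] in force)+
    then have ut: "u t \<le> u (\<sigma> (Suc i))" by simp
    show ?thesis
    proof (cases "i = m")
      case False
      then show ?thesis using I[of "Suc i" "\<sigma> (Suc i)"] interval_I[of "Suc i"] i ut by auto
    next
      case im: True
      show ?thesis
      proof (cases "u B = 0")
        case True
        then show ?thesis using ut im ends R by auto
      next
        case False
        then have "v x \<le> 0" if "x \<in> {\<tau> m..t}" for x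
          using bc v_mono[OF s, of m x B] im t that ends by auto
        then have "u t - u (\<tau> m) \<le> - (\<alpha>0 * 0 * (t - \<tau> m))"
          by (intro solution_bounds(4)[OF s]) (use interval_J[OF i] t im in auto)
        then show ?thesis using I[of m "\<tau> m"] interval_I[of m] m by auto
      qed
    qed
  next
    case False
    have i0: "i \<noteq> 0" using v_mono[OF s, of 0 A t] t A ends False by (cases "i = 0") auto
    have "u t - u (\<tau> i) \<le> - (\<alpha>0 * 0 * (t - \<tau> i))"
      by (intro solution_bounds(4)[OF s]) (use interval_J[OF i] t False v_mono[OF s i, of _ t] in force)+
    then show ?thesis using I[of i "\<tau> i"] interval_I[of i] i i0 by auto
  qed
  have "\<forall>t. A \<le> t \<and> t \<le> \<sigma> (Suc k) \<longrightarrow> u t \<le> R" if "k \<le> m" for k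
    using that
  proof (induction k)
    case 0
    then show ?case using J[of 0] ends by auto
  next
    case (Suc k)
    show ?case
    proof (intro allI impI)
      fix t assume t: "A \<le> t \<and> t \<le> \<sigma> (Suc (Suc k))"
      consider "t \<le> \<sigma> (Suc k)" | "\<sigma> (Suc k) \<le> t" "t \<le> \<tau> (Suc k)" | "\<tau> (Suc k) \<le> t" by linarith
      then show "u t \<le> R"
        using Suc t I[of "Suc k" t] J[of "Suc k" t] by cases auto
    qed
  qed
  from this[of m] show ?thesis using t ends by auto
qed

end

section \<open>Bounds on g and the choice of the constants\<close>

lemma continuous_positive_lower_bound:
  fixes g :: "real \<Rightarrow> real"
  assumes "continuous_on {a..c} g" "\<And>s. s \<in> {a..c} \<Longrightarrow> 0 < g s"
  obtains k where "0 < k" "\<And>s. s \<in> {a..c} \<Longrightarrow> k \<le> g s"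
proof (cases "a \<le> c")
  case True
  then obtain x where "x \<in> {a..c}" "\<And>s. s \<in> {a..c} \<Longrightarrow> g x \<le> g s"
    using continuous_attains_inf[of "{a..c}" g] assms by auto
  with that[of "g x"] assms show ?thesis by blast
qed (use that[of 1] in auto)

lemma sublinear_at_0:
  fixes g :: "real \<Rightarrow> real"
  assumes "((\<lambda>s. g s / s) \<longlongrightarrow> 0) (at_right 0)" "g 0 = 0" "0 < \<epsilon>"
  obtains r where "0 < r" "r < 1" "\<And>s. s \<in> {0..r} \<Longrightarrow> g s \<le> \<epsilon> * s"
proof -
  have "\<forall>\<^sub>F s in at_right 0. g s / s < \<epsilon>" using order_tendstoD(2)[OF assms(1,3)] .
  then obtain c where c: "0 < c" "\<And>s. 0 < s \<Longrightarrow> s < c \<Longrightarrow> g s / s < \<epsilon>"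
    by (auto simp: eventually_at_right_field)
  have "g s \<le> \<epsilon> * s" if "s \<in> {0..min (c/2) (1/2)}" for s
  proof (cases "s = 0")
    case False
    then have "g s / s < \<epsilon>" using that c(1) by (intro c(2)) auto
    then show ?thesis using that False by (simp add: divide_less_eq less_imp_le)
  qed (use assms in simp)
  then show ?thesis using that[of "min (c/2) (1/2)"] c(1) by auto
qed

lemma sublinear_at_top:
  fixes g :: "real \<Rightarrow> real"
  assumes "((\<lambda>s. g s / s) \<longlongrightarrow> 0) at_top" "continuous_on {0..} g" "0 < \<epsilon>"
  obtains R where "1 < R" "\<And>s. s \<in> {0..R} \<Longrightarrow> g s \<le> \<epsilon> * R"
proof -
  have "\<forall>\<^sub>F s in at_top. g s / s < \<epsilon>" using order_tendstoD(2)[OF assms(1,3)] .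
  then obtain c where c: "\<And>s. c \<le> s \<Longrightarrow> g s / s < \<epsilon>" by (auto simp: eventually_at_top_linorder)
  have "continuous_on {0..max c 1} g" by (rule continuous_on_subset[OF assms(2)]) auto
  from continuous_on_interval_bounded[OF this] obtain G where
    G: "\<And>s. s \<in> {0..max c 1} \<Longrightarrow> \<bar>g s\<bar> \<le> G" by blast
  \<comment> \<open>The term G/\<epsilon> takes care of the compact part, where g(s)/s need not be
    small.\<close>
  define R where "R = max 2 (G / \<epsilon>)"
  have GR: "G \<le> \<epsilon> * R"
  proof -
    have "\<epsilon> * (G / \<epsilon>) \<le> \<epsilon> * R" unfolding R_def using assms(3) by (intro mult_left_mono) auto
    then show ?thesis using assms(3) by simp
  qed
  have "g s \<le> \<epsilon> * R" if "s \<in> {0..R}" for s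
  proof (cases "s \<le> max c 1")
    case True
    then show ?thesis using G[of s] that GR by auto
  next
    case False
    then have "g s / s < \<epsilon>" "0 < s" using c[of s] by auto
    then have "g s \<le> \<epsilon> * s" by (simp add: divide_less_eq less_imp_le)
    also have "\<dots> \<le> \<epsilon> * R" using that assms(3) by (intro mult_left_mono) auto
    finally show ?thesis .
  qed
  then show ?thesis using that[of R] by (auto simp: R_def)
qed

definition positive_bvp ::
    "real \<Rightarrow> real \<Rightarrow> (real \<Rightarrow> real) \<Rightarrow> (real \<Rightarrow> real) \<Rightarrow> (real \<Rightarrow> real) \<Rightarrow> bool \<Rightarrow> (real \<Rightarrow> real) \<Rightarrow> (real \<Rightarrow> real) \<Rightarrow> bool"
  where "positive_bvp A B \<alpha> b g neu u v \<longleftrightarrow> solves A B \<alpha> b g u v \<and> (\<forall>t\<in>{A<..<B}. 0 < u t) \<and>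
    (if neu then v A = 0 \<and> v B = 0 \<and> 0 < u A \<and> 0 < u B else u A = 0 \<and> u B = 0)"

definition nonzero_strings :: "nat \<Rightarrow> (nat \<Rightarrow> nat) set"
  where "nonzero_strings m = ({1..m} \<rightarrow>\<^sub>E {..2}) - {\<lambda>i\<in>{1..m}. 0}"

lemma card_nonzero_strings: "finite (nonzero_strings m)" "card (nonzero_strings m) = 3 ^ m - 1"
proof -
  have fin: "finite ({1..m} \<rightarrow>\<^sub>E {..2::nat})" by (intro finite_PiE) auto
  then show "finite (nonzero_strings m)" by (simp add: nonzero_strings_def)
  have "(\<lambda>i\<in>{1..m}. 0) \<in> {1..m} \<rightarrow>\<^sub>E {..2::nat}" by auto
  then show "card (nonzero_strings m) = 3 ^ m - 1"
    using fin unfolding nonzero_strings_def by (subst card_Diff_singleton) (auto simp: card_PiE numeral_3_eq_3)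
qed

context indefinite_weights
begin

text \<open>\<open>neu\<close> is quantified after both thresholds because one choice of constants
  serves both boundary conditions. Distinctness refers to values on [A,B], since the profiles are
  arbitrary functions elsewhere.\<close>

lemma many_positive_solutions:
  assumes g_cont: "continuous_on {0..} g" and g_0: "g 0 = 0" and g_pos: "\<And>s. 0 < s \<Longrightarrow> 0 < g s"
    and g_lim_0: "((\<lambda>s. g s / s) \<longlongrightarrow> 0) (at_right 0)"
    and g_lim_inf: "((\<lambda>s. g s / s) \<longlongrightarrow> 0) at_top"
  shows "\<exists>lambda_star>0. \<forall>l>lambda_star. \<exists>mu_star>0. \<forall>\<mu>>mu_star. \<forall>neu. \<exists>U V.
    (\<forall>s\<in>nonzero_strings m. positive_bvp A B \<alpha> (\<lambda>t. l * wp t - \<mu> * wm t) g neu (U s) (V s)) \<and>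
    (\<forall>s\<in>nonzero_strings m. \<forall>s'\<in>nonzero_strings m. s \<noteq> s' \<longrightarrow> (\<exists>t\<in>{A..B}. U s t \<noteq> U s' t))"
proof -
  have gc: "continuous_on {a..c} g" if "0 \<le> a" for a c
    by (rule continuous_on_subset[OF g_cont]) (use that in auto)
  have g_nn: "0 \<le> g s" if "0 \<le> s" for s using g_pos[of s] g_0 that by (cases "s = 0") auto
  define \<eta> where "\<eta> = \<alpha>0 * d / (\<alpha>0 * d + \<alpha>1 * (B - A))"
  have den: "0 < \<alpha>0 * d" "0 < \<alpha>1 * (B - A)" using \<alpha>0 d \<alpha>1 AB by auto
  then have \<eta>: "0 < \<eta>" unfolding \<eta>_def by simp
  have "0 < g s" if "s \<in> {\<eta>..1}" for s using that \<eta> by (intro g_pos) auto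
  then obtain k1 where k1: "0 < k1" "\<And>s. s \<in> {\<eta>..1} \<Longrightarrow> k1 \<le> g s"
    using continuous_positive_lower_bound[OF gc[OF less_imp_le[OF \<eta>]], of 1] by metis
  \<comment> \<open>Half the minimum leaves room for approximations from below;
    \<open>\<gamma>\<close> is halved for the same reason.\<close>
  define \<gamma>1 where "\<gamma>1 = k1 / 2"
  have \<gamma>1: "0 < \<gamma>1" using k1 by (simp add: \<gamma>1_def)
  \<comment> \<open>The value of l that gives equality in \<open>l_large\<close>; it involves
    neither r nor R, which are chosen after l.\<close>
  define ls where "ls = 2 / (\<alpha>0 * d) / (d * d * \<gamma>1)"
  have ls: "0 < ls" using den d \<gamma>1 by (simp add: ls_def)
  show ?thesis
  proof (rule exI[of _ ls], intro conjI allI impI ls)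
    fix l assume "ls < l"
    with ls have l: "0 < l" by simp
    have l_large: "2 / (\<alpha>0 * d) < l * d * d * \<gamma>1"
    proof -
      have p: "0 < d * d * \<gamma>1" using d \<gamma>1 by simp
      have "2 / (\<alpha>0 * d) = ls * (d * d * \<gamma>1)" using d \<gamma>1 by (simp add: ls_def)
      also have "\<dots> < l * (d * d * \<gamma>1)" using \<open>ls < l\<close> p by (rule mult_strict_right_mono)
      finally show ?thesis by (simp add: mult_ac)
    qed
    define e where "e = 1 / (4 * (\<alpha>1 * (B - A)))"
    have "q * (1 / (4 * q)) \<le> 1/4" if "0 < q" for q :: real using that by simp
    from this[OF den(2)] have e: "0 < e" "\<alpha>1 * (B - A) * e \<le> 1/4"
      using den(2) AB \<alpha>1 unfolding e_def by simp_all
    define X where "X = l * W * (B - A)"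
    have X: "0 \<le> X" unfolding X_def using l W_nonneg AB by auto
    \<comment> \<open>Sublinearity gives f s \<le> \<epsilon> \<kappa> below the level \<kappa>, and
      \<open>f_level\<close> asks for X f s \<le> e \<kappa>. Adding 1 covers X = 0.\<close>
    define \<epsilon> where "\<epsilon> = e / (X + 1)"
    have \<epsilon>: "0 < \<epsilon>" unfolding \<epsilon>_def using e X by auto
    have X\<epsilon>: "X * \<epsilon> \<le> e"
    proof -
      have "X * \<epsilon> \<le> (X + 1) * \<epsilon>" using \<epsilon> by simp
      also have "\<dots> = e" using X by (simp add: \<epsilon>_def)
      finally show ?thesis .
    qed
    obtain r where r: "0 < r" "r < 1" "\<And>s. s \<in> {0..r} \<Longrightarrow> g s \<le> \<epsilon> * s"
      using sublinear_at_0[OF g_lim_0 g_0 \<epsilon>] by blast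
    obtain R where R: "1 < R" "\<And>s. s \<in> {0..R} \<Longrightarrow> g s \<le> \<epsilon> * R"
      using sublinear_at_top[OF g_lim_inf g_cont \<epsilon>] by blast
    \<comment> \<open>Clamping the argument to [0,R] extends g by g 0 = 0 to the negative axis and
      makes it bounded and uniformly continuous.\<close>
    define cl where "cl s = max 0 (min s R)" for s
    have cl: "cl s \<in> {0..R}" for s using R by (auto simp: cl_def)
    define f where "f s = g (cl s)" for s
    define F where "F = \<epsilon> * R"
    have fF: "0 \<le> f s \<and> f s \<le> F" for s
      using R(2)[OF cl[of s]] g_nn[of "cl s"] cl[of s] by (auto simp: f_def F_def)
    have F0: "0 \<le> F" using fF[of 0] by linarith
    have f_neg: "f s = 0" if "s \<le> 0" for s using that R g_0 by (simp add: f_def cl_def)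
    \<comment> \<open>The ratio f s / |s| is at most \<epsilon> up to r and at most F/r
      beyond.\<close>
    define K where "K = \<epsilon> + F / r"
    have K: "0 \<le> K" using \<epsilon> F0 r by (simp add: K_def)
    have f_lin: "f s \<le> K * \<bar>s\<bar>" for s
    proof (cases "s \<le> r")
      case True
      then have "f s \<le> \<epsilon> * \<bar>s\<bar>"
        using r(3)[of s] r R f_neg[of s] mult_nonneg_nonneg[OF less_imp_le[OF \<epsilon>] abs_ge_zero[of s]]
        by (cases "s \<le> 0") (simp_all add: f_def cl_def)
      also have "\<dots> \<le> K * \<bar>s\<bar>" unfolding K_def using F0 r by (intro mult_right_mono) auto
      finally show ?thesis .
    next
      case False
      then have "F / r * r \<le> K * \<bar>s\<bar>" using K \<epsilon> F0 r unfolding K_def by (intro mult_mono) auto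
      then show ?thesis using fF[of s] r by simp
    qed
    have "0 < g s" if "s \<in> {r/4..R}" for s using that r by (intro g_pos) auto
    moreover have "continuous_on {r/4..R} g" using r by (intro gc) auto
    ultimately obtain k where k: "0 < k" "\<And>s. s \<in> {r/4..R} \<Longrightarrow> k \<le> g s"
      using continuous_positive_lower_bound[of "r/4" R g] by metis
    define \<gamma> where "\<gamma> = k / 2"
    have \<gamma>: "0 < \<gamma>" using k by (simp add: \<gamma>_def)
    define C where "C = max R (R / (\<alpha>0 * d) + l * W * F * (B - A))"
    have C: "R \<le> C" "R \<le> \<alpha>0 * d * (C - l * W * F * (B - A))"
    proof -
      show "R \<le> C" by (simp add: C_def)
      have "\<alpha>0 * d * (R / (\<alpha>0 * d)) \<le> \<alpha>0 * d * (C - l * W * F * (B - A))"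
        using den by (intro mult_left_mono) (auto simp: C_def)
      then show "R \<le> \<alpha>0 * d * (C - l * W * F * (B - A))" using \<alpha>0 d by simp
    qed
    \<comment> \<open>The value of \<mu> that gives equality in \<open>\<mu>_large\<close>.\<close>
    define ms where "ms = (R / (\<alpha>0 * d) + e * R) / (d * d * \<gamma>)"
    have ms: "0 < ms" unfolding ms_def using R e \<alpha>0 d \<gamma> by (intro divide_pos_pos add_pos_pos mult_pos_pos) auto
    show "\<exists>mu_star>0. \<forall>\<mu>>mu_star. \<forall>neu. \<exists>U V.
      (\<forall>s\<in>nonzero_strings m. positive_bvp A B \<alpha> (\<lambda>t. l * wp t - \<mu> * wm t) g neu (U s) (V s)) \<and>
      (\<forall>s\<in>nonzero_strings m. \<forall>s'\<in>nonzero_strings m. s \<noteq> s' \<longrightarrow> (\<exists>t\<in>{A..B}. U s t \<noteq> U s' t))"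
    proof (rule exI[of _ ms], intro conjI allI impI ms)
      fix \<mu> neu assume "ms < \<mu>"
      with ms have \<mu>: "0 < \<mu>" by simp
      have \<mu>_large: "R < \<alpha>0 * d * (\<mu> * d * d * \<gamma> - e * R)"
      proof -
        have p: "0 < d * d * \<gamma>" using d \<gamma> by simp
        have "R / (\<alpha>0 * d) + e * R = ms * (d * d * \<gamma>)" using d \<gamma> by (simp add: ms_def)
        also have "\<dots> < \<mu> * (d * d * \<gamma>)" using \<open>ms < \<mu>\<close> p by (rule mult_strict_right_mono)
        finally have "R / (\<alpha>0 * d) < \<mu> * d * d * \<gamma> - e * R" by (simp add: mult_ac)
        then have "\<alpha>0 * d * (R / (\<alpha>0 * d)) < \<alpha>0 * d * (\<mu> * d * d * \<gamma> - e * R)"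
          using den by (intro mult_strict_left_mono) auto
        then show ?thesis using \<alpha>0 d by simp
      qed
      \<comment> \<open>One instantiation for \<open>f\<close> and for all its approximations from
        below, with identical constants.\<close>
      have inst: "shooting A B \<alpha>0 \<alpha>1 d W \<alpha> wp wm \<sigma> \<tau> m l \<mu> r R e \<gamma> \<gamma>1 F K C h"
        if h: "\<And>s. 0 \<le> h s \<and> h s \<le> f s" "\<And>s. f s \<le> h s + min \<gamma> \<gamma>1" for h
      proof (intro shooting.intro shooting_axioms.intro indefinite_weights_axioms l \<mu> r(1,2) R(1)
          l_large less_imp_le[OF e(1)] e(2) \<gamma> \<mu>_large C)
        show "h s = 0" if "s \<le> 0" for s using h(1)[of s] f_neg[OF that] by simp
        show "0 \<le> h s \<and> h s \<le> F" for s using h(1)[of s] fF[of s] by auto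
        show "\<bar>h s\<bar> \<le> K * \<bar>s\<bar>" for s using h(1)[of s] f_lin[of s] by auto
        show "\<gamma>1 \<le> h s" if "\<alpha>0 * d / (\<alpha>0 * d + \<alpha>1 * (B - A)) \<le> s" "s \<le> 1" for s
          using k1(2)[of s] h(2)[of s] that R(1) \<eta> unfolding \<eta>_def[symmetric]
          by (auto simp: f_def cl_def \<gamma>1_def)
        show "\<gamma> \<le> h s" if "r / 4 \<le> s" for s
          using k(2)[of "cl s"] h(2)[of s] that R(1) r by (auto simp: f_def cl_def \<gamma>_def)
        show "l * W * (B - A) * h s \<le> e * \<kappa>" if \<kappa>: "\<kappa> = r \<or> \<kappa> = R" "s \<le> \<kappa>" for \<kappa> s
        proof -
          have k0: "0 \<le> \<kappa>" using \<kappa> r R by auto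
          have "f s \<le> \<epsilon> * \<kappa>"
          proof (cases "\<kappa> = R")
            case True
            then show ?thesis using R(2)[OF cl[of s]] by (simp add: f_def)
          next
            case False
            then have \<kappa>r: "\<kappa> = r" "s \<le> r" using \<kappa> by auto
            have "f s \<le> \<epsilon> * cl s"
              using r(3)[of "cl s"] \<kappa>r r R by (auto simp: f_def cl_def)
            also have "\<dots> \<le> \<epsilon> * r" using \<kappa>r \<epsilon> r by (intro mult_left_mono) (auto simp: cl_def)
            finally show ?thesis using \<kappa>r by simp
          qed
          then have "X * h s \<le> X * (\<epsilon> * \<kappa>)" using h(1)[of s] X by (intro mult_left_mono) auto
          also have "\<dots> \<le> e * \<kappa>" using mult_right_mono[OF X\<epsilon> k0] by (simp add: mult_ac)
          finally show ?thesis by (simp add: X_def)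
        qed
      qed
      interpret f: shooting A B \<alpha>0 \<alpha>1 d W \<alpha> wp wm \<sigma> \<tau> m l \<mu> r R e \<gamma> \<gamma>1 F K C f
        by (rule inst) (use fF \<gamma> \<gamma>1 in auto)
      have f_uc: "uniformly_continuous_on UNIV f"
      proof -
        have g_uc: "uniformly_continuous_on {0..R} g"
          by (rule compact_uniformly_continuous) (auto intro: gc)
        have "dist (cl s) (cl t) \<le> dist s t" for s t by (auto simp: cl_def dist_real_def)
        then have "dist (cl s) (cl t) < \<delta>" if "dist s t < \<delta>" for s t \<delta> using that by (rule le_less_trans)
        then show ?thesis
          using g_uc cl unfolding uniformly_continuous_on_def f_def by (meson UNIV_I)
      qed
      have "\<exists>h. (\<exists>L. L-lipschitz_on UNIV h) \<and>
          (\<forall>s. 0 \<le> h s \<and> h s \<le> f s \<and> f s \<le> h s + min (min \<gamma> \<gamma>1) (1 / real (Suc n)))" for n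
      proof -
        have "0 < min (min \<gamma> \<gamma>1) (1 / real (Suc n))" using \<gamma> \<gamma>1 by auto
        from lipschitz_approximation[OF f_uc fF this] show ?thesis by metis
      qed
      then obtain fn where fn_lip: "\<And>n. \<exists>L. L-lipschitz_on UNIV (fn n)"
        and fn: "\<And>n s. 0 \<le> fn n s \<and> fn n s \<le> f s \<and> f s \<le> fn n s + min (min \<gamma> \<gamma>1) (1 / real (Suc n))"
        by metis
      have fn_inst: "shooting A B \<alpha>0 \<alpha>1 d W \<alpha> wp wm \<sigma> \<tau> m l \<mu> r R e \<gamma> \<gamma>1 F K C (fn n)" for n
        by (rule inst) (use fn[of n] in \<open>smt (verit)\<close>)+
      have fn_close: "\<bar>fn n s - f s\<bar> \<le> 1 / real (Suc n)" for n s
        using fn[of n s] by linarith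
      have le2: "s i \<le> 2" if "s \<in> nonzero_strings m" "i \<in> {1..m}" for s i
        using that by (auto simp: nonzero_strings_def)
      have "\<exists>u v. f.bvp neu s u v" if "s \<in> nonzero_strings m" for s
        by (rule f.bvp_limit[OF fn_inst fn_lip fn_close f_uc le2[OF that]])
      then obtain U V where UV: "\<And>s. s \<in> nonzero_strings m \<Longrightarrow> f.bvp neu s (U s) (V s)" by metis
      have "positive_bvp A B \<alpha> (\<lambda>t. l * wp t - \<mu> * wm t) g neu (U s) (V s)"
        if s: "s \<in> nonzero_strings m" for s
      proof -
        have "\<exists>i\<in>{1..m}. s i \<noteq> 0"
        proof (rule ccontr)
          assume "\<not> ?thesis"
          then have "s = (\<lambda>i\<in>{1..m}. 0)"
            using s by (intro extensionalityI[of _ "{1..m}"]) (auto simp: nonzero_strings_def PiE_def)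
          then show False using s by (simp add: nonzero_strings_def)
        qed
        then obtain i where i: "i \<in> {1..m}" "s i \<noteq> 0" by blast
        note bvp = UV[OF s]
        note pos = f.bvp_positive[OF bvp i]
        have "f (U s t) = g (U s t)" if t: "t \<in> {A..B}" for t
        proof -
          have "0 \<le> U s t"
            using pos(1)[of t] t bvp by (cases "t = A \<or> t = B") (auto simp: f.bvp_def less_imp_le)
          then show ?thesis using f.bvp_le_R[OF bvp t] by (simp add: f_def cl_def)
        qed
        then have "solves A B \<alpha> (\<lambda>t. l * wp t - \<mu> * wm t) g (U s) (V s)"
          using bvp by (auto simp: f.bvp_def solves_def f.b_def)
        then show ?thesis
          using pos bvp by (auto simp: positive_bvp_def f.bvp_def)
      qed
      moreover have "\<exists>t\<in>{A..B}. U s t \<noteq> U s' t"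
        if s: "s \<in> nonzero_strings m" "s' \<in> nonzero_strings m" "s \<noteq> s'" for s s'
      proof (rule ccontr)
        assume "\<not> ?thesis"
        then have eq: "U s t = U s' t" if "t \<in> {A..B}" for t using that by blast
        obtain i where i: "i \<in> {1..m}" "s i \<noteq> s' i"
          using s PiE_ext[of s "{1..m}" "\<lambda>_. {..2}" s'] by (auto simp: nonzero_strings_def)
        have M: "M i (U s) = M i (U s')"
          unfolding M_def using eq f.interval_I[OF i(1)] by (intro arg_cong[of _ _ Sup] image_cong) auto
        have lev: "f.level_bound (Suc j) \<le> f.level_bound j'" if "j < j'" "j' \<le> 2" for j j'
          using that r(1,2) R(1) by (auto simp: f.level_bound_def)
        \<comment> \<open>Classes with different codes meet at most in the upper threshold of the
          smaller code, which is r or 1, and no solution attains these levels.\<close>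
        have False if "s i < s' i" "s \<in> nonzero_strings m" "s' \<in> nonzero_strings m" "M i (U s) = M i (U s')" for s s'
        proof -
          have j: "s i = 0 \<or> s i = 1" using le2[OF that(3) i(1)] that(1) by auto
          have "M i (U s) \<in> f.level_class (s i)" "M i (U s') \<in> f.level_class (s' i)"
            using UV[OF that(2)] UV[OF that(3)] i(1) by (auto simp: f.bvp_def)
          then have "M i (U s) = f.level_bound (Suc (s i))"
            using lev[OF that(1) le2[OF that(3) i(1)]] that(4) by (auto simp: f.level_class_def)
          then show False
            using f.bvp_level_open[OF UV[OF that(2)] i(1)] j by (auto simp: f.level_bound_def)
        qed
        from this[of s s'] this[of s' s] show False using s i M by (auto simp: neq_iff)
      qed
      ultimately show "\<exists>U V.
        (\<forall>s\<in>nonzero_strings m. positive_bvp A B \<alpha> (\<lambda>t. l * wp t - \<mu> * wm t) g neu (U s) (V s)) \<and>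
        (\<forall>s\<in>nonzero_strings m. \<forall>s'\<in>nonzero_strings m. s \<noteq> s' \<longrightarrow> (\<exists>t\<in>{A..B}. U s t \<noteq> U s' t))"
        by blast
    qed
  qed
qed

end

section \<open>Radial functions on the annulus\<close>

lemma continuous_gt_on_subinterval:
  fixes w :: "real \<Rightarrow> real"
  assumes w: "continuous_on {a..c} w" and ac: "a < c" and x: "x \<in> {a..c}" "k < w x"
  obtains y z where "a < y" "y < z" "z < c" "\<And>t. t \<in> {y..z} \<Longrightarrow> k < w t"
proof -
  obtain \<delta> where \<delta>: "0 < \<delta>" "\<And>t. t \<in> {a..c} \<Longrightarrow> dist t x < \<delta> \<Longrightarrow> dist (w t) (w x) < w x - k"
    using w x unfolding continuous_on_iff by (metis diff_gt_0_iff_gt)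
  \<comment> \<open>The middle third of this window stays away from a and c even when x is one of
    them.\<close>
  define lo hi where "lo = max a (x - \<delta>)" and "hi = min c (x + \<delta>)"
  have lh: "lo < hi" "a \<le> lo" "x - \<delta> \<le> lo" "hi \<le> c" "hi \<le> x + \<delta>"
    using \<delta>(1) x ac by (auto simp: lo_def hi_def)
  show ?thesis
  proof (rule that[of "(2 * lo + hi) / 3" "(lo + 2 * hi) / 3"])
    fix t assume "t \<in> {(2 * lo + hi) / 3..(lo + 2 * hi) / 3}"
    then have "lo < t" "t < hi" using lh(1) by (auto simp: field_simps)
    then have "t \<in> {a..c}" "dist t x < \<delta>" using lh by (auto simp: dist_real_def)
    from \<delta>(2)[OF this] show "k < w t" by (auto simp: dist_real_def abs_if split: if_splits)
  qed (use lh in auto)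
qed

text \<open>A continuous function that is negative somewhere is negative on a whole interval, which
  is not negligible; so the almost everywhere sign holds at every point.\<close>

lemma succ_zero_continuous:
  assumes sz: "succ_zero w {a..c}" and w: "continuous_on {a..c} w" and ac: "a < c"
  shows "\<And>x. x \<in> {a..c} \<Longrightarrow> 0 \<le> w x" and "\<exists>x\<in>{a..c}. 0 < w x"
proof -
  show nn: "0 \<le> w x" if x: "x \<in> {a..c}" for x
  proof (rule ccontr)
    assume "\<not> 0 \<le> w x"
    then obtain y z where yz: "a < y" "y < z" "z < c" "\<And>t. t \<in> {y..z} \<Longrightarrow> 0 < - w t"
      using continuous_gt_on_subinterval[of a c "\<lambda>x. - w x" x 0] w ac x
      by (auto intro: continuous_on_minus)
    from sz have "AE x in lebesgue. x \<in> {a..c} \<longrightarrow> w x \<ge> 0" by (simp add: succ_zero_def)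
    then obtain N where N: "{x \<in> space lebesgue. \<not> (x \<in> {a..c} \<longrightarrow> w x \<ge> 0)} \<subseteq> N"
      "emeasure lebesgue N = 0" "N \<in> sets lebesgue" by (rule AE_E)
    have "cbox y z \<subseteq> N" using N(1) yz by force
    moreover have "negligible N" using N by (simp add: negligible_iff_null_sets null_setsI)
    ultimately have "negligible (cbox y z)" by (rule negligible_subset[rotated])
    then have "box y z = {}" using negligible_interval(1) by blast
    then show False using yz(2) by (simp add: box_real)
  qed
  show "\<exists>x\<in>{a..c}. 0 < w x"
  proof (rule ccontr)
    assume "\<not> ?thesis"
    then have "w x = 0" if "x \<in> {a..c}" for x using nn[OF that] that by force
    then have "AE x\<in>{a..c} in lebesgue. w x = 0" by simp
    with sz show False by (simp add: succ_zero_def)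
  qed
qed

lemma positive_weight_margin:
  fixes w :: "real \<Rightarrow> real"
  assumes w: "continuous_on {a..c} w" and ac: "a < c" and x: "x \<in> {a..c}" "0 < w x"
  shows "\<exists>d>0. \<exists>y z. a + d \<le> y \<and> y + d \<le> z \<and> z + d \<le> c \<and> (\<forall>t\<in>{y..z}. d \<le> w t)"
proof -
  obtain y z where yz: "a < y" "y < z" "z < c" "\<And>t. t \<in> {y..z} \<Longrightarrow> w x / 2 < w t"
    using continuous_gt_on_subinterval[OF w ac x(1), of "w x / 2"] x(2) by auto
  define d where "d = min (min (y - a) (z - y)) (min (c - z) (w x / 2))"
  have "0 < d" "d \<le> y - a" "d \<le> z - y" "d \<le> c - z" "d \<le> w x / 2" using yz x by (auto simp: d_def min_def)
  with yz(4) show ?thesis by (intro exI[of _ d] conjI exI[of _ y] exI[of _ z]) force+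
qed

lemma finite_uniform_margin:
  fixes P :: "'a \<Rightarrow> real \<Rightarrow> bool"
  assumes "finite I" "\<And>i. i \<in> I \<Longrightarrow> \<exists>d>0. P i d" "\<And>i d d'. P i d \<Longrightarrow> 0 < d' \<Longrightarrow> d' \<le> d \<Longrightarrow> P i d'"
  shows "\<exists>d>0. \<forall>i\<in>I. P i d"
  using assms(1,2)
proof (induction I)
  case empty
  show ?case by (intro exI[of _ 1]) auto
next
  case (insert i I)
  obtain d1 where d1: "0 < d1" "\<forall>i\<in>I. P i d1" using insert by blast
  obtain d2 where d2: "0 < d2" "P i d2" using insert.prems by blast
  show ?case
    using assms(3)[of i d2 "min d1 d2"] assms(3)[of _ d1 "min d1 d2"] d1 d2
    by (intro exI[of _ "min d1 d2"]) auto
qed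

section \<open>Calculus of radial functions on the annulus\<close>

lemma open_annulus: "open (annulus R1 R2)"
proof -
  have "annulus R1 R2 = norm -` {R1<..<R2}" by (auto simp: annulus_def)
  then show ?thesis
    by (metis open_greaterThanLessThan open_vimage continuous_on_norm_id)
qed

lemma closure_annulus_subset: "closure (annulus R1 R2) \<subseteq> {x. R1 \<le> norm x \<and> norm x \<le> R2}"
proof (rule closure_minimal)
  have "closed (norm -` {R1..R2})" by (intro closed_vimage closed_atLeastAtMost continuous_on_norm_id)
  then show "closed {x. R1 \<le> norm x \<and> norm x \<le> R2}" by (simp add: vimage_def)
qed (auto simp: annulus_def)

lemma frontier_annulus_norm:
  assumes "x \<in> frontier (annulus R1 R2)" shows "norm x = R1 \<or> norm x = R2"
proof -
  have "x \<in> closure (annulus R1 R2)" "x \<notin> annulus R1 R2"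
    using assms interior_open[OF open_annulus] by (auto simp: frontier_def)
  then show ?thesis using closure_annulus_subset by (force simp: annulus_def)
qed

text \<open>Derivatives are local. This matters twice: \<open>u\<close> is \<open>undefined\<close>
  off the closure, and the formula for its first partials, which is differentiated again, is known
  only inside the annulus.\<close>

lemma partial_eqI:
  fixes f g :: "'a::euclidean_space \<Rightarrow> real"
  assumes "open S" "x \<in> S" "\<And>y. y \<in> S \<Longrightarrow> g y = f y" "(f has_derivative f') (at x)"
  shows "partial i g x = f' i" "g differentiable (at x)"
proof -
  have "(g has_derivative f') (at x)"
    using has_derivative_transform_within_open[OF assms(4,1,2)] assms(3) by auto
  then show "partial i g x = f' i" "g differentiable (at x)"
    by (auto simp: partial_def differentiable_def dest: frechet_derivative_at)
qed

text \<open>The chain rule with x/|x| as the gradient of the norm. The resulting formulas are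
  themselves the continuous extensions to the closure, where |x| stays away from 0.\<close>

lemma radial_C2:
  fixes u :: "'a::euclidean_space \<Rightarrow> real" and U U1 U2 :: "real \<Rightarrow> real"
  assumes R: "0 < R1"
    and u: "\<And>x. x \<in> closure (annulus R1 R2) \<Longrightarrow> u x = U (norm x)"
    and U: "\<And>t. t \<in> {R1..R2} \<Longrightarrow> (U has_real_derivative U1 t) (at t within {R1..R2})"
    and U1: "\<And>t. t \<in> {R1..R2} \<Longrightarrow> (U1 has_real_derivative U2 t) (at t within {R1..R2})"
    and U2: "continuous_on {R1..R2} U2"
  shows "C2_closure (annulus R1 R2) u"
    and "x \<in> annulus R1 R2 \<Longrightarrow> laplacian u x = U2 (norm x) + (real DIM('a) - 1) / norm x * U1 (norm x)"
proof -
  let ?\<Omega> = "annulus R1 R2 :: 'a set"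
  note op = open_annulus[of R1 R2, where ?'a = 'a]
  have cl: "norm x \<in> {R1..R2}" "x \<noteq> 0" if "x \<in> closure ?\<Omega>" for x
    using that closure_annulus_subset R by force+
  have Uc: "continuous_on {R1..R2} U" "continuous_on {R1..R2} U1"
    using U U1 unfolding continuous_on_eq_continuous_within by (blast intro: DERIV_continuous)+
  have comp: "continuous_on (closure ?\<Omega>) (\<lambda>x. h (norm x))" if "continuous_on {R1..R2} h" for h :: "real \<Rightarrow> real"
    by (rule continuous_on_compose2[OF that]) (use cl in \<open>auto intro!: continuous_intros\<close>)
  have dn: "(norm has_derivative (\<lambda>h. h \<bullet> x / norm x)) (at x)" if "x \<in> ?\<Omega>" for x :: 'a
  proof -
    have "x \<noteq> 0" using that R by (auto simp: annulus_def)
    from GDERIV_norm[OF this] show ?thesis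
      by (simp add: gderiv_def sgn_div_norm divide_inverse mult.commute)
  qed
  have at: "(h has_real_derivative h' (norm x)) (at (norm x))"
    if "\<And>t. t \<in> {R1..R2} \<Longrightarrow> (h has_real_derivative h' t) (at t within {R1..R2})" "x \<in> ?\<Omega>" for h h' :: "real \<Rightarrow> real" and x
    using that(1)[of "norm x"] that(2) at_within_interior[of "norm x" "{R1..R2}"] by (simp add: annulus_def)
  have dh: "((\<lambda>x. h (norm x)) has_derivative (\<lambda>k. h' (norm x) * (k \<bullet> x / norm x))) (at x)"
    if "\<And>t. t \<in> {R1..R2} \<Longrightarrow> (h has_real_derivative h' t) (at t within {R1..R2})" "x \<in> ?\<Omega>" for h h' :: "real \<Rightarrow> real" and x
    using has_derivative_compose[OF dn[OF that(2)] at[OF that, unfolded has_field_derivative_def]] by simp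
  have u\<Omega>: "u x = U (norm x)" if "x \<in> ?\<Omega>" for x using u closure_subset that by blast
  have p1: "partial i u x = U1 (norm x) * (i \<bullet> x / norm x)" and d1: "u differentiable (at x)"
    if "x \<in> ?\<Omega>" for i x
    using partial_eqI[OF op that u\<Omega> dh[OF U that]] by auto
  define H where "H i x k = (U1 (norm x) * ((i \<bullet> k * norm x - (i \<bullet> x) * (k \<bullet> x / norm x)) / (norm x * norm x))
       + U2 (norm x) * (k \<bullet> x / norm x) * (i \<bullet> x / norm x))" for i x k :: 'a
  have dp: "((\<lambda>x. U1 (norm x) * (i \<bullet> x / norm x)) has_derivative H i x) (at x)"
    if "x \<in> ?\<Omega>" for i x
  proof -
    have nz: "norm x \<noteq> 0" using that R unfolding annulus_def mem_Collect_eq by linarith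
    have "((\<lambda>x. i \<bullet> x / norm x) has_derivative (\<lambda>k. (i \<bullet> k * norm x - (i \<bullet> x) * (k \<bullet> x / norm x)) / (norm x * norm x))) (at x)"
      by (rule has_derivative_divide'[OF has_derivative_inner_right[OF has_derivative_ident] dn[OF that] nz])
    from has_derivative_mult[OF dh[OF U1 that] this] show ?thesis by (simp only: H_def[abs_def])
  qed
  have p2: "partial j (partial i u) x = H i x j" and d2: "partial i u differentiable (at x)"
    if "x \<in> ?\<Omega>" for i j x
    using partial_eqI[OF op that p1 dp[OF that]] by auto
  show "C2_closure ?\<Omega> u"
    unfolding C2_closure_def
  proof (intro conjI ballI)
    show "continuous_on (closure ?\<Omega>) u"
      using comp[OF Uc(1)] by (rule continuous_on_cong[THEN iffD1, rotated 2]) (auto simp: u)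
    show "u differentiable at x" if "x \<in> ?\<Omega>" for x by (rule d1[OF that])
    show "partial i u differentiable at x" if "x \<in> ?\<Omega>" for i x by (rule d2[OF that])
    have nz: "\<forall>x\<in>closure ?\<Omega>. norm x \<noteq> 0" using cl(2) by auto
    show "extends_continuously ?\<Omega> (partial i u)" for i
      unfolding extends_continuously_def using nz
      by (intro exI[of _ "\<lambda>x. U1 (norm x) * (i \<bullet> x / norm x)"] conjI)
         (auto simp: p1 intro!: continuous_intros comp Uc)
    show "extends_continuously ?\<Omega> (partial j (partial i u))" for i j
      unfolding extends_continuously_def using nz
      by (intro exI[of _ "\<lambda>x. H i x j"] conjI)
         (auto simp: p2 H_def intro!: continuous_intros comp Uc U2)
  qed
  show "laplacian u x = U2 (norm x) + (real DIM('a) - 1) / norm x * U1 (norm x)" if x: "x \<in> ?\<Omega>"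
  proof -
    define \<rho> where "\<rho> = norm x"
    have \<rho>: "0 < \<rho>" using x R unfolding \<rho>_def annulus_def mem_Collect_eq by linarith
    have "laplacian u x = (\<Sum>i\<in>Basis. H i x i)" by (simp add: laplacian_def p2[OF x])
    \<comment> \<open>The diagonal of the Hessian; as the squared coordinates of x add up to
      \<rho>^2, its sum is U'' + (N-1) U'/\<rho>.\<close>
    also have "\<dots> = (\<Sum>i\<in>Basis. U1 \<rho> / \<rho> - U1 \<rho> / \<rho> ^ 3 * ((x \<bullet> i) * (x \<bullet> i)) + U2 \<rho> / \<rho>\<^sup>2 * ((x \<bullet> i) * (x \<bullet> i)))"
    proof (rule sum.cong)
      fix i :: 'a assume "i \<in> Basis"
      then have "i \<bullet> i = 1" by simp
      then show "H i x i = U1 \<rho> / \<rho> - U1 \<rho> / \<rho> ^ 3 * ((x \<bullet> i) * (x \<bullet> i)) + U2 \<rho> / \<rho>\<^sup>2 * ((x \<bullet> i) * (x \<bullet> i))"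
        unfolding H_def \<rho>_def[symmetric] inner_commute[of i x] using \<rho>
        by (simp add: field_simps power2_eq_square power3_eq_cube)
    qed simp
    also have "\<dots> = real DIM('a) * (U1 \<rho> / \<rho>) - U1 \<rho> / \<rho> ^ 3 * (x \<bullet> x) + U2 \<rho> / \<rho>\<^sup>2 * (x \<bullet> x)"
      by (simp only: sum.distrib sum_subtractf sum_distrib_left[symmetric] euclidean_inner[of x x, symmetric] sum_constant)
    also have "x \<bullet> x = \<rho>\<^sup>2" by (simp add: \<rho>_def power2_norm_eq_inner)
    finally show ?thesis
      unfolding \<rho>_def[symmetric] using \<rho> by (simp add: field_simps power2_eq_square power3_eq_cube)
  qed
qed

lemma radial_normal_derivative:
  fixes u :: "'a::real_normed_vector \<Rightarrow> real"
  assumes R: "0 < R1" "R1 < R2"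
    and u: "\<And>x. x \<in> closure (annulus R1 R2) \<Longrightarrow> u x = U (norm x)"
    and U: "\<And>t. t \<in> {R1..R2} \<Longrightarrow> (U has_real_derivative U1 t) (at t within {R1..R2})"
    and z: "U1 R1 = 0" "U1 R2 = 0" and x: "x \<in> frontier (annulus R1 R2)"
  shows "has_normal_derivative u x (annulus_normal R1 R2 x) 0"
proof -
  define n where "n = annulus_normal R1 R2 x"
  define c :: real where "c = (if norm x = R2 then 1 else - 1)"
  \<comment> \<open>Half the width of the shell keeps x + t n strictly inside for t < 0, so only
    values of \<open>u\<close> on the closure enter.\<close>
  define T where "T = {(R1 - R2) / 2..0}"
  have nx: "norm x = R1 \<or> norm x = R2" by (rule frontier_annulus_norm[OF x])
  have x0: "0 < norm x" using nx R by auto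
  have n: "x + t *\<^sub>R n = ((norm x + c * t) / norm x) *\<^sub>R x" for t
  proof -
    have "(norm x + c * t) / norm x = 1 + t * (c * inverse (norm x))"
      using x0 by (simp add: field_simps)
    then show ?thesis
      by (simp add: n_def annulus_normal_def c_def scaleR_left_distrib)
  qed
  have rng: "norm x + c * t \<in> {R1..R2}" and nn: "norm (x + t *\<^sub>R n) = norm x + c * t" if t: "t \<in> T" for t
  proof -
    show rng: "norm x + c * t \<in> {R1..R2}"
      using t nx R by (auto simp: T_def c_def field_simps)
    then show "norm (x + t *\<^sub>R n) = norm x + c * t" unfolding n using x0 R by simp
  qed
  have cl: "x + t *\<^sub>R n \<in> closure (annulus R1 R2)" if t: "t \<in> T" for t
  proof (cases "t = 0")
    case True
    then show ?thesis using x by (simp add: frontier_def)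
  next
    case False
    then have "R1 < norm x + c * t \<and> norm x + c * t < R2"
      using t nx R by (auto simp: T_def c_def field_simps)
    then have "x + t *\<^sub>R n \<in> annulus R1 R2" using nn[OF t] by (simp add: annulus_def)
    then show ?thesis using closure_subset by blast
  qed
  have x': "norm x \<in> {R1..R2}" "U1 (norm x) = 0" using nx R z by auto
  have "((\<lambda>t. norm x + c * t) has_real_derivative c) (at 0 within T)"
    by (auto intro!: derivative_eq_intros)
  moreover have "(U has_real_derivative 0) (at (norm x + c * 0) within (\<lambda>t. norm x + c * t) ` T)"
    using DERIV_subset[OF U[OF x'(1)] image_subsetI[OF rng]] x'(2) by simp
  ultimately have "((U \<circ> (\<lambda>t. norm x + c * t)) has_real_derivative 0 * c) (at 0 within T)"
    by (intro DERIV_image_chain)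
  then have "((U \<circ> (\<lambda>t. norm x + c * t)) has_real_derivative 0) (at 0 within T)"
    by simp
  then have "((\<lambda>t. u (x + t *\<^sub>R n)) has_real_derivative 0) (at 0 within T)"
    unfolding has_field_derivative_def
    by (rule has_derivative_transform[rotated 2])
       (use R cl nn u in \<open>auto simp: T_def\<close>)
  moreover have "at 0 within T = at_left 0"
    unfolding T_def by (rule at_within_Icc_at_left) (use R in auto)
  ultimately show ?thesis by (simp add: has_normal_derivative_def n_def)
qed

lemma radial_solution:
  fixes q :: "'a::euclidean_space \<Rightarrow> real"
  assumes R: "0 < R1" "R1 < R2"
    and Q: "continuous_on {R1..R2} Q" and g: "continuous_on {0..} g"
    and q: "\<And>x. x \<in> closure (annulus R1 R2) \<Longrightarrow> q x = Q (norm x)"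
    and bvp: "positive_bvp R1 R2 (\<lambda>t. 1 / t ^ (DIM('a) - 1))
      (\<lambda>t. l * (t ^ (DIM('a) - 1) * max (Q t) 0) - \<mu> * (t ^ (DIM('a) - 1) * max (- Q t) 0)) g neu U V"
  shows "restrict (\<lambda>x. U (norm x)) (closure (annulus R1 R2)) \<in>
    (if neu then neumann_solutions R1 R2 (\<lambda>x. l * pos_part q x - \<mu> * neg_part q x) g
     else dirichlet_solutions R1 R2 (\<lambda>x. l * pos_part q x - \<mu> * neg_part q x) g)"
proof -
  let ?\<Omega> = "annulus R1 R2 :: 'a set"
  let ?u = "restrict (\<lambda>x. U (norm x)) (closure ?\<Omega>)"
  define n where "n = DIM('a) - 1"
  have n: "real DIM('a) - 1 = real n" unfolding n_def using DIM_positive[where ?'a = 'a] by linarith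
  define a where "a t = l * max (Q t) 0 - \<mu> * max (- Q t) 0" for t
  define U1 where "U1 t = V t / t ^ n" for t
  \<comment> \<open>This is U'' obtained from U' = V/t^n by the quotient rule; its last term cancels
    against the first-order term of the radial Laplacian.\<close>
  define U2 where "U2 t = - a t * g (U t) - real n / t * U1 t" for t
  have sol: "(U has_real_derivative U1 t) (at t within {R1..R2})"
     "(V has_real_derivative - (t ^ n * a t * g (U t))) (at t within {R1..R2})" if "t \<in> {R1..R2}" for t
    using bvp that unfolding positive_bvp_def solves_def U1_def a_def n_def by (auto simp: algebra_simps)
  have dU1: "(U1 has_real_derivative U2 t) (at t within {R1..R2})" if t: "t \<in> {R1..R2}" for t
  proof -
    have t0: "0 < t" using t R by auto
    have tn: "real n * t ^ (n - 1) = real n * t ^ n / t" using t0 by (cases n) auto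
    have "(U1 has_real_derivative (- (t ^ n * a t * g (U t)) * t ^ n - V t * (real n * t ^ (n - 1))) / (t ^ n * t ^ n))
       (at t within {R1..R2})"
      unfolding U1_def
      by (rule DERIV_divide[OF sol(2)[OF t]]) (use t0 in \<open>auto intro!: derivative_eq_intros\<close>)
    also have "(- (t ^ n * a t * g (U t)) * t ^ n - V t * (real n * t ^ (n - 1))) / (t ^ n * t ^ n) = U2 t"
      unfolding U2_def U1_def tn using t0 by (simp add: field_simps)
    finally show ?thesis .
  qed
  have pos: "0 \<le> U t" if "t \<in> {R1..R2}" for t
    using bvp that unfolding positive_bvp_def
    by (cases "t = R1 \<or> t = R2") (auto split: if_splits intro: less_imp_le)
  have Uc: "continuous_on {R1..R2} U" "continuous_on {R1..R2} U1"
    using sol(1) dU1 unfolding continuous_on_eq_continuous_within by (blast intro: DERIV_continuous)+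
  have U2c: "continuous_on {R1..R2} U2"
    unfolding U2_def a_def
    by (intro continuous_intros Q Uc continuous_on_compose2[OF g Uc(1)]) (use pos R in auto)
  have u: "?u x = U (norm x)" if "x \<in> closure ?\<Omega>" for x using that by simp
  have C2: "C2_closure ?\<Omega> ?u"
    "\<And>x. x \<in> ?\<Omega> \<Longrightarrow> laplacian ?u x = U2 (norm x) + (real DIM('a) - 1) / norm x * U1 (norm x)"
    by (rule radial_C2[OF R(1) u sol(1) dU1 U2c]; assumption)+
  have pde: "- laplacian ?u x = (l * pos_part q x - \<mu> * neg_part q x) * g (?u x)" if x: "x \<in> ?\<Omega>" for x
  proof -
    have xc: "x \<in> closure ?\<Omega>" using x closure_subset by blast
    have "laplacian ?u x = - a (norm x) * g (U (norm x))"
      using C2(2)[OF x] by (simp add: n U2_def)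
    moreover have "a (norm x) = l * pos_part q x - \<mu> * neg_part q x"
      by (simp add: a_def pos_part_def neg_part_def q[OF xc])
    ultimately show ?thesis using u[OF xc] by (simp only: minus_mult_left[symmetric] minus_minus)
  qed
  have ext: "?u \<in> extensional (closure ?\<Omega>)" by simp
  have rad: "radially_symmetric (closure ?\<Omega>) ?u" using u unfolding radially_symmetric_def by blast
  have clx: "x \<in> closure ?\<Omega> \<Longrightarrow> norm x \<in> {R1..R2}" for x using closure_annulus_subset by auto
  show ?thesis
  proof (cases neu)
    case True
    then have b: "V R1 = 0" "V R2 = 0" "0 < U R1" "0 < U R2" "\<And>t. t \<in> {R1<..<R2} \<Longrightarrow> 0 < U t"
      using bvp by (auto simp: positive_bvp_def)
    have "0 < U t" if "t \<in> {R1..R2}" for t using b that by (cases "t = R1 \<or> t = R2") auto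
    then have "\<forall>x\<in>closure ?\<Omega>. 0 < ?u x" using clx by auto
    moreover have "\<forall>x\<in>frontier ?\<Omega>. has_normal_derivative ?u x (annulus_normal R1 R2 x) 0"
      using b by (intro ballI radial_normal_derivative[OF R u sol(1)]) (auto simp: U1_def)
    ultimately show ?thesis
      using True ext rad C2(1) pde by (simp add: neumann_solutions_def)
  next
    case False
    then have b: "U R1 = 0" "U R2 = 0" "\<And>t. t \<in> {R1<..<R2} \<Longrightarrow> 0 < U t"
      using bvp by (auto simp: positive_bvp_def)
    have "\<forall>x\<in>?\<Omega>. 0 < ?u x"
      using b(3) closure_subset[of ?\<Omega>] by (auto simp: annulus_def)
    moreover have "\<forall>x\<in>frontier ?\<Omega>. ?u x = 0"
      using frontier_annulus_norm b by (force simp: frontier_def)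
    ultimately show ?thesis
      using False ext rad C2(1) pde by (simp add: dirichlet_solutions_def)
  qed
qed

text \<open>Along the ray through a basis vector the functions give back their profiles on the open
  interval, and continuity extends equality to R1 and R2.\<close>

lemma radial_profiles_differ:
  fixes U U' :: "real \<Rightarrow> real"
  assumes R: "0 < R1" "R1 < R2" and U: "continuous_on {R1..R2} U" "continuous_on {R1..R2} U'"
    and t: "t \<in> {R1..R2}" "U t \<noteq> U' t"
  shows "restrict (\<lambda>x::'a::euclidean_space. U (norm x)) (closure (annulus R1 R2))
    \<noteq> restrict (\<lambda>x. U' (norm x)) (closure (annulus R1 R2))"
proof
  assume eq: "restrict (\<lambda>x::'a. U (norm x)) (closure (annulus R1 R2))
    = restrict (\<lambda>x. U' (norm x)) (closure (annulus R1 R2))"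
  obtain i :: 'a where i: "i \<in> Basis" using nonempty_Basis by blast
  have "U s - U' s = 0" if s: "s \<in> {R1<..<R2}" for s
  proof -
    have "norm (s *\<^sub>R i) = s" using i s R by simp
    moreover from this have "s *\<^sub>R i \<in> closure (annulus R1 R2)"
      using s closure_subset[of "annulus R1 R2 :: 'a set"] by (auto simp: annulus_def)
    ultimately show ?thesis using fun_cong[OF eq, of "s *\<^sub>R i"] by simp
  qed
  then have "U t - U' t = 0"
    using continuous_constant_on_closure[of "{R1<..<R2}" "\<lambda>s. U s - U' s" 0 t] R t U
    by (auto intro: continuous_on_diff)
  with t show False by simp
qed

text \<open>The factor t^n comes from writing the radial equation as (t^n U')' = - t^n a g(U); it is
  positive on [R1,R2] and so leaves the signs of Q intact.\<close>

lemma annulus_weights: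
  fixes Q :: "real \<Rightarrow> real" and \<sigma> \<tau> :: "nat \<Rightarrow> real"
  assumes R: "0 < R1" "R1 < R2"
    and Q: "continuous_on {R1..R2} Q"
    and Q_neg: "\<exists>r\<in>{R1..R2}. neg_part Q r \<noteq> 0"
    and m: "m \<ge> 1"
    and ends: "\<tau> 0 = R1" "\<sigma> (m + 1) = R2"
    and first_last: "\<tau> 0 \<le> \<sigma> 1" "\<tau> m \<le> \<sigma> (m + 1)"
    and \<sigma>_less_\<tau>: "\<And>i. i \<in> {1..m} \<Longrightarrow> \<sigma> i < \<tau> i"
    and \<tau>_less_\<sigma>: "\<And>i. i \<in> {1..<m} \<Longrightarrow> \<tau> i < \<sigma> (i + 1)"
    and Q_succ: "\<And>i. i \<in> {1..m} \<Longrightarrow> succ_zero Q {\<sigma> i..\<tau> i}"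
    and Q_prec: "\<And>i. i \<in> {0..m} \<Longrightarrow> \<tau> i < \<sigma> (i + 1) \<Longrightarrow> prec_zero Q {\<tau> i..\<sigma> (i + 1)}"
  obtains \<alpha>0 \<alpha>1 d W where "indefinite_weights R1 R2 \<alpha>0 \<alpha>1 d W (\<lambda>t. 1 / t ^ n)
    (\<lambda>t. t ^ n * max (Q t) 0) (\<lambda>t. t ^ n * max (- Q t) 0) \<sigma> \<tau> m"
proof -
  define wp wm where "wp t = t ^ n * max (Q t) 0" and "wm t = t ^ n * max (- Q t) 0" for t
  have wc: "continuous_on {R1..R2} wp" "continuous_on {R1..R2} wm"
    unfolding wp_def wm_def by (intro continuous_intros Q)+
  have \<tau>_le: "\<tau> i \<le> \<sigma> (Suc i)" if "i \<le> m" for i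
    using that first_last \<tau>_less_\<sigma>[of i] by (cases "i = 0 \<or> i = m") (auto intro: less_imp_le)
  have \<tau>_step: "\<tau> i < \<tau> (Suc i)" if "i < m" for i
    using \<tau>_le[of i] \<sigma>_less_\<tau>[of "Suc i"] that by auto
  have mono: "\<tau> i \<le> \<tau> j" if "i \<le> j" "j \<le> m" for i j
    using that
  proof (induction j rule: dec_induct)
    case (step k)
    then show ?case using \<tau>_step[of k] by auto
  qed auto
  have \<tau>b: "R1 \<le> \<tau> i" "\<tau> i \<le> R2" if "i \<le> m" for i
    using mono[of 0 i] mono[of i m] that ends first_last by auto
  have \<sigma>b: "R1 \<le> \<sigma> (Suc i)" "\<sigma> (Suc i) \<le> R2" if "i \<le> m" for i
  proof -
    show "R1 \<le> \<sigma> (Suc i)" using \<tau>_le[OF that] \<tau>b(1)[OF that] by linarith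
    show "\<sigma> (Suc i) \<le> R2"
      using \<sigma>_less_\<tau>[of "Suc i"] \<tau>b(2)[of "Suc i"] that ends by (cases "i = m") auto
  qed
  have Isub: "{\<sigma> i..\<tau> i} \<subseteq> {R1..R2}" if "i \<in> {1..m}" for i
    using that \<sigma>b[of "i - 1"] \<tau>b[of i] by auto
  have Jsub: "{\<tau> i..\<sigma> (Suc i)} \<subseteq> {R1..R2}" if "i \<le> m" for i
    using that \<sigma>b[of i] \<tau>b[of i] by auto
  have t0: "0 < t" if "t \<in> {R1..R2}" for t using that R by auto
  have I_nn: "0 \<le> Q t" if "i \<in> {1..m}" "t \<in> {\<sigma> i..\<tau> i}" for i t
    using succ_zero_continuous(1)[OF Q_succ[OF that(1)] continuous_on_subset[OF Q Isub[OF that(1)]] \<sigma>_less_\<tau>[OF that(1)] that(2)] .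
  have J_sz: "succ_zero (\<lambda>t. - Q t) {\<tau> i..\<sigma> (Suc i)}" if "i \<le> m" "\<tau> i < \<sigma> (Suc i)" for i
    using Q_prec[of i] that by (simp add: prec_zero_def)
  have J_cont: "continuous_on {\<tau> i..\<sigma> (Suc i)} (\<lambda>t. - Q t)" if "i \<le> m" for i
    by (intro continuous_on_minus continuous_on_subset[OF Q Jsub[OF that]])
  have J_np: "Q t \<le> 0" if "i \<le> m" "\<tau> i < \<sigma> (Suc i)" "t \<in> {\<tau> i..\<sigma> (Suc i)}" for i t
    using succ_zero_continuous(1)[OF J_sz[OF that(1,2)] J_cont[OF that(1)] that(2,3)] by simp
  define margin where "margin w a c d \<longleftrightarrow> (\<exists>y z. a + d \<le> y \<and> y + d \<le> z \<and> z + d \<le> c \<and> (\<forall>t\<in>{y..z}. d \<le> w t))"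
    for w :: "real \<Rightarrow> real" and a c d
  have margin_mono: "margin w a c d'" if mg: "margin w a c d" "0 < d'" "d' \<le> d" for w a c d d'
  proof -
    obtain y z where yz: "a + d \<le> y" "y + d \<le> z" "z + d \<le> c" "\<forall>t\<in>{y..z}. d \<le> w t"
      using mg(1) unfolding margin_def by blast
    show ?thesis unfolding margin_def
      using yz mg(2,3) by (intro exI[of _ y] exI[of _ z]) (auto intro: order_trans)
  qed
  have I_margin: "\<exists>d>0. margin wp (\<sigma> i) (\<tau> i) d" if i: "i \<in> {1..m}" for i
  proof -
    obtain x where x: "x \<in> {\<sigma> i..\<tau> i}" "0 < Q x"
      using succ_zero_continuous(2)[OF Q_succ[OF i] continuous_on_subset[OF Q Isub[OF i]] \<sigma>_less_\<tau>[OF i]] by blast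
    have "0 < wp x" using x t0[of x] Isub[OF i] unfolding wp_def by (intro mult_pos_pos zero_less_power) auto
    from positive_weight_margin[OF continuous_on_subset[OF wc(1) Isub[OF i]] \<sigma>_less_\<tau>[OF i] x(1) this]
    show ?thesis unfolding margin_def .
  qed
  have J_margin: "\<exists>d>0. margin wm (\<tau> i) (\<sigma> (Suc i)) d" if i: "i \<le> m" "\<tau> i < \<sigma> (Suc i)" for i
  proof -
    obtain x where x: "x \<in> {\<tau> i..\<sigma> (Suc i)}" "0 < - Q x"
      using succ_zero_continuous(2)[OF J_sz[OF i] J_cont[OF i(1)] i(2)] by blast
    have "0 < wm x" using x t0[of x] Jsub[OF i(1)] unfolding wm_def by (intro mult_pos_pos zero_less_power) auto
    from positive_weight_margin[OF continuous_on_subset[OF wc(2) Jsub[OF i(1)]] i(2) x(1) this]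
    show ?thesis unfolding margin_def .
  qed
  have "\<exists>d>0. \<forall>i\<in>{..m}. (i \<in> {1..m} \<longrightarrow> margin wp (\<sigma> i) (\<tau> i) d) \<and>
      (\<tau> i < \<sigma> (Suc i) \<longrightarrow> margin wm (\<tau> i) (\<sigma> (Suc i)) d)"
  proof (rule finite_uniform_margin)
    fix i assume "i \<in> {..m}"
    then have i: "i \<le> m" by simp
    \<comment> \<open>Where the implication is vacuous, 1 serves as the margin.\<close>
    obtain d1 where d1: "0 < d1" "i \<in> {1..m} \<longrightarrow> margin wp (\<sigma> i) (\<tau> i) d1"
      using I_margin[of i] zero_less_one by blast
    obtain d2 where d2: "0 < d2" "\<tau> i < \<sigma> (Suc i) \<longrightarrow> margin wm (\<tau> i) (\<sigma> (Suc i)) d2"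
      using J_margin[OF i] zero_less_one by blast
    show "\<exists>d>0. (i \<in> {1..m} \<longrightarrow> margin wp (\<sigma> i) (\<tau> i) d) \<and>
      (\<tau> i < \<sigma> (Suc i) \<longrightarrow> margin wm (\<tau> i) (\<sigma> (Suc i)) d)"
      using d1 d2 margin_mono[of _ _ _ d1 "min d1 d2"] margin_mono[of _ _ _ d2 "min d1 d2"]
      by (intro exI[of _ "min d1 d2"]) auto
  qed (use margin_mono in blast)+
  then obtain d where d: "0 < d" "\<And>i. i \<in> {1..m} \<Longrightarrow> margin wp (\<sigma> i) (\<tau> i) d"
    "\<And>i. i \<le> m \<Longrightarrow> \<tau> i < \<sigma> (Suc i) \<Longrightarrow> margin wm (\<tau> i) (\<sigma> (Suc i)) d" by auto
  obtain W where W: "\<And>t. t \<in> {R1..R2} \<Longrightarrow> \<bar>wp t\<bar> \<le> W"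
    using continuous_on_interval_bounded[OF wc(1)] by blast
  \<comment> \<open>Otherwise a single positivity interval fills [R1,R2], and Q has no negative
    part.\<close>
  have not_whole: "\<tau> 0 < \<sigma> 1 \<or> \<tau> m < \<sigma> (Suc m) \<or> 2 \<le> m"
  proof (rule ccontr)
    assume n: "\<not> ?thesis"
    then have m1: "m = 1" using m by auto
    then have "\<sigma> 1 = R1" "\<tau> 1 = R2" using n ends first_last by auto
    then show False using I_nn[of 1] m1 Q_neg by (force simp: neg_part_def)
  qed
  have "indefinite_weights R1 R2 (1 / R2 ^ n) (1 / R1 ^ n) d W (\<lambda>t. 1 / t ^ n) wp wm \<sigma> \<tau> m"
  proof
    show "continuous_on {R1..R2} (\<lambda>t. 1 / t ^ n)"
      by (intro continuous_intros) (use R in auto)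
    show "1 / R2 ^ n \<le> 1 / t ^ n \<and> 1 / t ^ n \<le> 1 / R1 ^ n" if "t \<in> {R1..R2}" for t
      using that R by (auto intro!: divide_left_mono power_mono mult_pos_pos zero_less_power)
    show "0 \<le> wp t \<and> wp t \<le> W" if "t \<in> {R1..R2}" for t
      using W[OF that] t0[OF that] by (auto simp: wp_def)
    show "0 \<le> wm t" if "t \<in> {R1..R2}" for t using t0[OF that] by (simp add: wm_def)
    show "wm t = 0" if "i \<in> {1..m}" "t \<in> {\<sigma> i..\<tau> i}" for i t
      using I_nn[OF that] by (simp add: wm_def)
    show "wp t = 0" if "i \<le> m" "\<tau> i < \<sigma> (Suc i)" "t \<in> {\<tau> i..\<sigma> (Suc i)}" for i t
      using J_np[OF that] by (simp add: wp_def)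
  qed (use R wc m ends \<sigma>_less_\<tau> \<tau>_le \<tau>_less_\<sigma> not_whole d in \<open>auto simp: margin_def\<close>)
  then show ?thesis using that unfolding wp_def wm_def by blast
qed

theorem theorem7p2:
  fixes R1 R2 :: real
    and g Q :: "real \<Rightarrow> real"
    and \<sigma> \<tau> :: "nat \<Rightarrow> real"
    and m :: nat
    and q :: "real ^ 'n \<Rightarrow> real"
  assumes N: "CARD('n) \<ge> 2"
    and R: "0 < R1" "R1 < R2"
    and g_cont: "continuous_on {0..} g"
    and g_0: "g 0 = 0"
    and g_pos: "\<And>s. s > 0 \<Longrightarrow> g s > 0"
    and g_lim_0: "((\<lambda>s. g s / s) \<longlongrightarrow> 0) (at_right 0)"
    and g_lim_inf: "((\<lambda>s. g s / s) \<longlongrightarrow> 0) at_top"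
    and Q_cont: "continuous_on {R1..R2} Q"
    and Q_neg: "\<exists>r\<in>{R1..R2}. neg_part Q r \<noteq> 0"
    and m: "m \<ge> 1"
    and ends: "\<tau> 0 = R1" "\<sigma> (m + 1) = R2"
    and first_last: "\<tau> 0 \<le> \<sigma> 1" "\<tau> m \<le> \<sigma> (m + 1)"
    and \<sigma>_less_\<tau>: "\<And>i. i \<in> {1..m} \<Longrightarrow> \<sigma> i < \<tau> i"
    and \<tau>_less_\<sigma>: "\<And>i. i \<in> {1..<m} \<Longrightarrow> \<tau> i < \<sigma> (i + 1)"
    and Q_succ: "\<And>i. i \<in> {1..m} \<Longrightarrow> succ_zero Q {\<sigma> i..\<tau> i}"
    and Q_prec: "\<And>i. i \<in> {0..m} \<Longrightarrow> \<tau> i < \<sigma> (i + 1) \<Longrightarrow> prec_zero Q {\<tau> i..\<sigma> (i + 1)}"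
    and q: "\<And>x. x \<in> closure (annulus R1 R2) \<Longrightarrow> q x = Q (norm x)"
  shows "(\<exists>lambda_star>0. \<forall>l>lambda_star. \<exists>mu_star>0. \<forall>\<mu>>mu_star.
            at_least (3 ^ m - 1)
              (neumann_solutions R1 R2 (\<lambda>x. l * pos_part q x - \<mu> * neg_part q x) g))
       \<and> (\<exists>lambda_star>0. \<forall>l>lambda_star. \<exists>mu_star>0. \<forall>\<mu>>mu_star.
            at_least (3 ^ m - 1)
              (dirichlet_solutions R1 R2 (\<lambda>x. l * pos_part q x - \<mu> * neg_part q x) g))"
proof -
  define n where "n = DIM(real ^ 'n) - 1"
  obtain \<alpha>0 \<alpha>1 d W where w: "indefinite_weights R1 R2 \<alpha>0 \<alpha>1 d W (\<lambda>t. 1 / t ^ n)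
    (\<lambda>t. t ^ n * max (Q t) 0) (\<lambda>t. t ^ n * max (- Q t) 0) \<sigma> \<tau> m"
    using annulus_weights[OF R Q_cont Q_neg m ends first_last \<sigma>_less_\<tau> \<tau>_less_\<sigma> Q_succ Q_prec] by blast
  interpret indefinite_weights R1 R2 \<alpha>0 \<alpha>1 d W "\<lambda>t. 1 / t ^ n"
    "\<lambda>t. t ^ n * max (Q t) 0" "\<lambda>t. t ^ n * max (- Q t) 0" \<sigma> \<tau> m by (rule w)
  define sols where "sols neu l \<mu> = (if neu
     then neumann_solutions R1 R2 (\<lambda>x. l * pos_part q x - \<mu> * neg_part q x) g
     else dirichlet_solutions R1 R2 (\<lambda>x. l * pos_part q x - \<mu> * neg_part q x) g)" for neu l \<mu>
  have count: "at_least (3 ^ m - 1) (sols neu l \<mu>)"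
    if bvp: "\<forall>s\<in>nonzero_strings m. positive_bvp R1 R2 (\<lambda>t. 1 / t ^ n)
        (\<lambda>t. l * (t ^ n * max (Q t) 0) - \<mu> * (t ^ n * max (- Q t) 0)) g neu (U s) (V s)"
      and diff: "\<forall>s\<in>nonzero_strings m. \<forall>s'\<in>nonzero_strings m. s \<noteq> s' \<longrightarrow> (\<exists>t\<in>{R1..R2}. U s t \<noteq> U s' t)"
    for neu l \<mu> U V
  proof -
    define u where "u s = restrict (\<lambda>x :: real ^ 'n. U s (norm x)) (closure (annulus R1 R2))" for s
    have "u s \<in> sols neu l \<mu>" if "s \<in> nonzero_strings m" for s
      unfolding u_def sols_def
      by (rule radial_solution[OF R Q_cont g_cont q, where V = "V s"]) (use bvp that in \<open>auto simp: n_def\<close>)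
    moreover have Uc: "continuous_on {R1..R2} (U s)" if "s \<in> nonzero_strings m" for s
      using bvp that solves_continuous(1) unfolding positive_bvp_def by blast
    have "inj_on u (nonzero_strings m)"
      using diff radial_profiles_differ[OF R Uc Uc] unfolding inj_on_def u_def by blast
    ultimately show ?thesis
      unfolding at_least_def
      by (intro exI[of _ "u ` nonzero_strings m"]) (auto simp: card_image card_nonzero_strings)
  qed
  define P where "P l \<mu> neu \<longleftrightarrow> (\<exists>U V.
    (\<forall>s\<in>nonzero_strings m. positive_bvp R1 R2 (\<lambda>t. 1 / t ^ n)
        (\<lambda>t. l * (t ^ n * max (Q t) 0) - \<mu> * (t ^ n * max (- Q t) 0)) g neu (U s) (V s)) \<and>
    (\<forall>s\<in>nonzero_strings m. \<forall>s'\<in>nonzero_strings m. s \<noteq> s' \<longrightarrow> (\<exists>t\<in>{R1..R2}. U s t \<noteq> U s' t)))"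
    for l \<mu> neu
  have "\<exists>lambda_star>0. \<forall>l>lambda_star. \<exists>mu_star>0. \<forall>\<mu>>mu_star. \<forall>neu. P l \<mu> neu"
    unfolding P_def by (rule many_positive_solutions[OF g_cont g_0 g_pos g_lim_0 g_lim_inf])
  then obtain ls where ls: "0 < ls" "\<And>l. ls < l \<Longrightarrow> \<exists>mu_star>0. \<forall>\<mu>>mu_star. \<forall>neu. P l \<mu> neu" by blast
  have P: "at_least (3 ^ m - 1) (sols neu l \<mu>)" if "P l \<mu> neu" for l \<mu> neu
    using that unfolding P_def by (elim exE conjE) (rule count)
  have "\<exists>lambda_star>0. \<forall>l>lambda_star. \<exists>mu_star>0. \<forall>\<mu>>mu_star. at_least (3 ^ m - 1) (sols neu l \<mu>)" for neu
  proof (rule exI[of _ ls], intro conjI allI impI ls(1))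
    fix l assume "ls < l"
    from ls(2)[OF this] obtain ms where "0 < ms" "\<And>\<mu>. ms < \<mu> \<Longrightarrow> P l \<mu> neu" by blast
    then show "\<exists>mu_star>0. \<forall>\<mu>>mu_star. at_least (3 ^ m - 1) (sols neu l \<mu>)" using P by blast
  qed
  from this[of True] this[of False] show ?thesis by (simp add: sols_def)
qed

end
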